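(* Let $n\ge2$ and let $C_4,C_5,C_6>0$ be fixed constants. There exists $\delta_0>0$ (depending only on $n$ and these fixed constants) such that the following holds for all $0<\delta_1<\delta_2\le\delta_0$. Let $\alpha\in[\tfrac12,1]$ and fix $T$ with $$0<T<\left(\frac{C_5\delta_1}{2C_4}\right)^{1/\alpha}.$$ Let $(\gamma_s)_{s\ge0}$ be a family of curves $\gamma_s:\mathbb R\to\mathbb R^n$ with $\|\gamma_s(0)\|=s$ such that for all $s,s'\in[0,\delta_2)$ and $t,t'\in[-T,T]$, $$\big|\|\gamma_s(t)\|-\|\gamma_s(t')\|\big|\le C_4|t-t'|^\alpha,$$ $$C_5|s-s'|\le\big|\|\gamma_s(t)\|-\|\gamma_{s'}(t)\|\big|\le C_6|s-s'|.$$ Then for all $f\in\mathscr S(\mathbb R^n)_o$, $$\left(\int_{\delta_1}^{\delta_2}\Big(\sup_{t\in[-T,T]}|\tilde S_tf(\|\gamma_s(t)\|)|\Big)^2s^{n-1}\,ds\right)^{1/2}\le C\,\|f\|_{\dot H^{1/4}(\mathbb R^n)},$$ where (the constants $C_4,C_5,C_6$ being fixed) the positive constant $C$ depends only on $\delta_1,\delta_2$ and $n$.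
   Context: $\|\cdot\|$ is the Euclidean norm. $\mathscr S(\mathbb R^n)_o$ is the space of radial Schwartz functions on $\mathbb R^n$; a radial function is also written as a function of $s=\|x\|$. For $\mu\ge0$, $\mathscr J_\mu(z)=2^\mu\pi^{1/2}\Gamma(\mu+\tfrac12)\dfrac{J_\mu(z)}{z^\mu}$ with $J_\mu$ the Bessel function. The Euclidean spherical Fourier transform of a radial $f$ is $\mathscr Ff(\lambda)=\int_0^\infty f(s)\mathscr J_{\frac{n-2}2}(\lambda s)s^{n-1}\,ds$. The Schrödinger propagation is $$\tilde S_tf(s)=\int_0^\infty\mathscr J_{\frac{n-2}2}(\lambda s)\,e^{it\lambda^2}\,\mathscr Ff(\lambda)\,\lambda^{n-1}\,d\lambda,$$ and $\|f\|_{\dot H^{1/4}(\mathbb R^n)}=\left(\int_0^\infty\lambda^{1/2}|\mathscr Ff(\lambda)|^2\lambda^{n-1}\,d\lambda\right)^{1/2}$. *)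

theory Defs
  imports "HOL-Analysis.Analysis"
begin

section \<open>Radial Schwartz functions\<close>

primrec iter_partial :: "'a::euclidean_space list \<Rightarrow> ('a \<Rightarrow> complex) \<Rightarrow> 'a \<Rightarrow> complex" where
  "iter_partial [] f = f"
| "iter_partial (b # bs) f = (\<lambda>x. frechet_derivative (iter_partial bs f) (at x) b)"

text \<open>Smoothness is expressed by total differentiability of all iterated partial derivatives;
  the differentiability clause also guarantees that each \<^const>\<open>frechet_derivative\<close> in
  \<^const>\<open>iter_partial\<close> is a genuine derivative.\<close>

definition schwartz :: "('a::euclidean_space \<Rightarrow> complex) \<Rightarrow> bool" where
  "schwartz f \<longleftrightarrow> (\<forall>bs. set bs \<subseteq> Basis \<longrightarrow>
     (\<forall>x. iter_partial bs f differentiable (at x)) \<and>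
     (\<forall>k. bounded (range (\<lambda>x. norm x ^ k *\<^sub>R iter_partial bs f x))))"

definition radial :: "('a::euclidean_space \<Rightarrow> complex) \<Rightarrow> bool" where
  "radial f \<longleftrightarrow> (\<forall>x y. norm x = norm y \<longrightarrow> f x = f y)"

text \<open>For radial \<open>f\<close>, the value \<open>f(s)\<close>, \<open>s \<ge> 0\<close>, of \<open>f\<close> as a function of the norm;
  the choice of the unit vector does not matter then.\<close>

definition radial_profile :: "('a::euclidean_space \<Rightarrow> complex) \<Rightarrow> real \<Rightarrow> complex" where
  "radial_profile f s = f (s *\<^sub>R (SOME b. b \<in> Basis))"


section \<open>Bessel functions\<close>

text \<open>The Bessel function of the first kind of order \<open>\<mu> \<ge> 0\<close> at \<open>z \<ge> 0\<close>.
  The case distinction is needed because \<open>0 powr 0 = 0\<close> in HOL, whereas \<open>J\<^sub>0(0) = 1\<close>.\<close>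

definition bessel_J :: "real \<Rightarrow> real \<Rightarrow> real" where
  "bessel_J \<mu> z =
     (if \<mu> = 0 \<and> z = 0 then 1
      else (\<Sum>k. (-1) ^ k / (fact k * Gamma (\<mu> + real k + 1)) * (z / 2) powr (2 * real k + \<mu>)))"

text \<open>The normalised function \<open>2\<^sup>\<mu> \<pi>\<^sup>1\<^sup>/\<^sup>2 \<Gamma>(\<mu> + 1/2) J\<^sub>\<mu>(z) / z\<^sup>\<mu>\<close>, for \<open>\<mu> \<ge> 0\<close> and \<open>z \<ge> 0\<close>.
  At \<open>z = 0\<close> it is extended continuously: \<open>J\<^sub>\<mu>(z) / z\<^sup>\<mu>\<close> tends to
  \<open>1 / (2\<^sup>\<mu> \<Gamma>(\<mu> + 1))\<close> as \<open>z\<close> tends to \<open>0\<close>.\<close>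

definition bessel_norm :: "real \<Rightarrow> real \<Rightarrow> real" where
  "bessel_norm \<mu> z =
     (if z = 0 then sqrt pi * Gamma (\<mu> + 1/2) / Gamma (\<mu> + 1)
      else 2 powr \<mu> * sqrt pi * Gamma (\<mu> + 1/2) * (bessel_J \<mu> z / z powr \<mu>))"


section \<open>Spherical Fourier transform and Schroedinger propagation\<close>

definition spherical_fourier :: "('a::euclidean_space \<Rightarrow> complex) \<Rightarrow> real \<Rightarrow> complex" where
  "spherical_fourier f l =
     (LINT s:{0..}|lborel.
        radial_profile f s
        * of_real (bessel_norm ((real DIM('a) - 2) / 2) (l * s))
        * of_real (s ^ (DIM('a) - 1)))"

definition schroedinger :: "real \<Rightarrow> ('a::euclidean_space \<Rightarrow> complex) \<Rightarrow> real \<Rightarrow> complex" where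
  "schroedinger t f s =
     (LINT l:{0..}|lborel.
        of_real (bessel_norm ((real DIM('a) - 2) / 2) (l * s))
        * exp (\<i> * of_real (t * l\<^sup>2))
        * spherical_fourier f l
        * of_real (l ^ (DIM('a) - 1)))"

text \<open>Integrals of nonnegative functions are taken in \<open>[0, \<infinity>]\<close>, so their square roots are, too.\<close>

definition ennreal_sqrt :: "ennreal \<Rightarrow> ennreal" where
  "ennreal_sqrt x = (if x = top then top else ennreal (sqrt (enn2real x)))"

definition hdot_quarter_norm :: "('a::euclidean_space \<Rightarrow> complex) \<Rightarrow> ennreal" where
  "hdot_quarter_norm f =
     ennreal_sqrt (\<integral>\<^sup>+ l \<in> {0..}.
        ennreal (l powr (1/2) * (cmod (spherical_fourier f l))\<^sup>2 * l ^ (DIM('a) - 1)) \<partial>lborel)"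

end

theory Submission
  imports Defs
begin

text \<open>
  Bessel's equation turns \<open>z\<^sup>m \<J>\<^sub>\<mu>(z)\<close>, \<open>m = (n - 1)/2\<close>, into a solution of the oscillator
  \<open>u'' + u = O(z\<^sup>-\<^sup>2) u\<close>, so that \<open>\<J>\<^sub>\<mu>(z)\<close> is \<open>z\<^sup>-\<^sup>m (A cos z + B sin z)\<close> up to \<open>O(z\<^sup>-\<^sup>m\<^sup>-\<^sup>1)\<close>.
  The error and the frequencies \<open>\<lambda> \<le> 1\<close> are bounded pointwise by Cauchy-Schwarz. With
  \<open>\<rho>(s,t)\<close> the norm of the curve, what remains is the one-dimensional maximal operator with phase
  \<open>\<plusminus> \<lambda> \<rho>(s,t) + t \<lambda>\<^sup>2\<close> and weight \<open>\<lambda>\<^sup>-\<^sup>1\<^sup>/\<^sup>4\<close>, acting on the \<open>L\<^sup>2\<close> function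
  \<open>\<lambda>\<^sup>m\<^sup>+\<^sup>1\<^sup>/\<^sup>4 F(\<lambda>)\<close>. Linearising the supremum by a measurable choice of times \<open>t(s)\<close>, the
  kernel of \<open>T T\<^sup>*\<close> is the integral of \<open>\<lambda>\<^sup>-\<^sup>1\<^sup>/\<^sup>2 exp i(a \<lambda> + b \<lambda>\<^sup>2)\<close>, which van der Corput bounds
  by \<open>C \<bar>a\<bar>\<^sup>-\<^sup>1\<^sup>/\<^sup>2\<close> and by \<open>C \<bar>b\<bar>\<^sup>-\<^sup>1\<^sup>/\<^sup>4\<close>. The assumptions on the curves give
  \<open>\<bar>a\<bar> \<ge> c \<bar>s - s'\<bar>\<close> or \<open>\<bar>b\<bar> \<ge> c \<bar>s - s'\<bar>\<^sup>2\<close>, so the kernel is at most \<open>C \<bar>s - s'\<bar>\<^sup>-\<^sup>1\<^sup>/\<^sup>2\<close>,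
  and Schur's test applies.
\<close>

section \<open>Bessel functions at infinity\<close>

text \<open>The Sobolev exponent fixes the scaling. The weight becomes \<open>\<lambda>\<close> to
  the power \<open>-1/2\<close> in the kernel, and then a separation \<open>d\<close> in radius or
  \<open>d\<^sup>2\<close> in time yields the same bound
  \<open>d\<^sup>-\<^sup>1\<^sup>/\<^sup>2\<close>, which is integrable on a bounded interval. Two
  obstacles shape the argument. The Bessel asymptotics are uniform only for radii away from zero;
  the upper bound on \<open>T\<close> keeps every radius at least \<open>\<delta>1 / 2\<close>, and
  this is how the constant comes to depend on \<open>\<delta>1\<close>. Moreover, a square
  integrable function of the frequency need not be integrable on a half-line. Frequencies are
  therefore cut off at \<open>R\<close>, every estimate is uniform in \<open>R\<close>, and Fatou's
  lemma removes the cut-off at the end. Constants are obtained before the transform, the curves and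
  \<open>T\<close>, so that the order of quantifiers records what they may depend on.\<close>

definition bessel_coeff :: "real \<Rightarrow> nat \<Rightarrow> real" where
  "bessel_coeff \<mu> k = (-1) ^ k / (4 ^ k * fact k * Gamma (\<mu> + real k + 1))"

text \<open>The functional equation of \<open>Gamma\<close> gives this recurrence. It is Bessel's
  equation read coefficient by coefficient, and it also drives the ratio test.\<close>

lemma bessel_coeff_Suc:
  assumes "\<mu> \<ge> 0"
  shows "4 * real (Suc k) * (\<mu> + real k + 1) * bessel_coeff \<mu> (Suc k) = - bessel_coeff \<mu> k"
proof -
  define G where "G = Gamma (\<mu> + real k + 1)"
  have "\<mu> + real k + 1 > 0" using assms by linarith
  then have "\<mu> + real k + 1 \<notin> \<int>\<^sub>\<le>\<^sub>0" by (auto elim!: nonpos_Ints_cases)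
  then have *: "Gamma (\<mu> + real (Suc k) + 1) = (\<mu> + real k + 1) * G"
    using Gamma_plus1[of "\<mu> + real k + 1"] by (simp add: algebra_simps G_def)
  have "G > 0" unfolding G_def using \<open>\<mu> + real k + 1 > 0\<close> by (rule Gamma_real_pos)
  then show ?thesis
    using \<open>\<mu> + real k + 1 > 0\<close> unfolding bessel_coeff_def * G_def[symmetric] 
    by (simp add: divide_simps)
qed

lemma summable_bessel_coeff:
  fixes x :: real
  assumes "\<mu> \<ge> 0"
  shows "summable (\<lambda>k. bessel_coeff \<mu> k * x ^ k)"
proof (rule summable_ratio_test[where c = "1/2" and N = "nat \<lceil>\<bar>x\<bar>\<rceil>"])
  fix k assume "nat \<lceil>\<bar>x\<bar>\<rceil> \<le> k"
  then have k: "\<bar>x\<bar> \<le> real k" by linarith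
  \<comment> \<open>Up to sign, \<open>q\<close> is the quotient of consecutive coefficients. It is
    at least \<open>2 * \<bar>x\<bar>\<close> once \<open>k\<close> reaches
    \<open>\<bar>x\<bar>\<close>, hence the ratio \<open>1/2\<close>.\<close>
  define q where "q = 4 * real (Suc k) * (\<mu> + real k + 1)"
  have "4 * real (Suc k) * 1 \<le> q"
    unfolding q_def by (rule mult_left_mono) (use assms in auto)
  then have q: "2 * \<bar>x\<bar> \<le> q" "q > 0" using k by auto
  have "norm (bessel_coeff \<mu> k * x ^ k) = q * \<bar>bessel_coeff \<mu> (Suc k)\<bar> * \<bar>x\<bar> ^ k"
  proof -
    have "bessel_coeff \<mu> k = - (q * bessel_coeff \<mu> (Suc k))"
      using bessel_coeff_Suc[OF assms, of k] by (simp add: q_def)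
    then show ?thesis using \<open>q > 0\<close> by (simp add: abs_mult power_abs)
  qed
  moreover have "2 * \<bar>x\<bar> * (\<bar>bessel_coeff \<mu> (Suc k)\<bar> * \<bar>x\<bar> ^ k) \<le> q * (\<bar>bessel_coeff \<mu> (Suc k)\<bar> * \<bar>x\<bar> ^ k)"
    by (rule mult_right_mono[OF q(1)]) simp
  ultimately show "norm (bessel_coeff \<mu> (Suc k) * x ^ Suc k) \<le> 1/2 * norm (bessel_coeff \<mu> k * x ^ k)"
    by (simp only: norm_mult norm_power real_norm_def power_Suc abs_mult power_abs mult_ac)
qed simp

text \<open>In the variable \<open>x = z\<^sup>2\<close> the quotient of
  \<open>J\<^sub>\<mu>(z)\<close> by \<open>(z/2)\<^sup>\<mu>\<close> is an entire power series, so
  real powers and the singular point \<open>z = 0\<close> disappear.\<close>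

definition bessel_series :: "real \<Rightarrow> real \<Rightarrow> real" where
  "bessel_series \<mu> x = (\<Sum>k. bessel_coeff \<mu> k * x ^ k)"

lemma bessel_norm_series:
  assumes "\<mu> \<ge> 0" "z \<ge> 0"
  shows "bessel_norm \<mu> z = sqrt pi * Gamma (\<mu> + 1/2) * bessel_series \<mu> (z\<^sup>2)"
proof (cases "z = 0")
  case True
  have "bessel_series \<mu> 0 = bessel_coeff \<mu> 0"
    unfolding bessel_series_def by (rule powser_zero)
  then show ?thesis using True by (simp add: bessel_norm_def bessel_coeff_def)
next
  case False
  then have z: "z > 0" using assms by auto
  have "(-1) ^ k / (fact k * Gamma (\<mu> + real k + 1)) * (z / 2) powr (2 * real k + \<mu>)
     = (z / 2) powr \<mu> * (bessel_coeff \<mu> k * (z\<^sup>2) ^ k)" for k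
  proof -
    have "(z / 2) powr (2 * real k + \<mu>) = (z / 2) powr \<mu> * (z / 2) ^ (2 * k)"
      using z powr_realpow[of "z/2" "2*k"] by (simp add: powr_add mult.commute)
    also have "(z / 2) ^ (2 * k) = (z\<^sup>2) ^ k / 4 ^ k"
      by (simp add: power_mult power_divide)
    finally show ?thesis by (simp add: bessel_coeff_def mult_ac)
  qed
  then have "bessel_J \<mu> z = (z / 2) powr \<mu> * bessel_series \<mu> (z\<^sup>2)"
    unfolding bessel_J_def bessel_series_def using z summable_bessel_coeff[OF assms(1)]
    by (simp add: suminf_mult)
  moreover have "(z / 2) powr \<mu> = z powr \<mu> / 2 powr \<mu>" "z powr \<mu> > 0"
    using z by (simp_all add: powr_divide)
  ultimately show ?thesis using z by (simp add: bessel_norm_def)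
qed

text \<open>Substituting \<open>x = z\<^sup>2\<close> in Bessel's equation gives this form, whose
  coefficient at \<open>x ^ k\<close> vanishes by \<open>bessel_coeff_Suc\<close> divided by
  four.\<close>

lemma bessel_series_ode:
  assumes "\<mu> \<ge> 0"
  obtains P' P'' where
    "\<And>x. (bessel_series \<mu> has_real_derivative P' x) (at x)"
    "\<And>x. (P' has_real_derivative P'' x) (at x)"
    "\<And>x. x * P'' x + (\<mu> + 1) * P' x + bessel_series \<mu> x / 4 = 0"
proof -
  define c where "c = bessel_coeff \<mu>"
  define P' where "P' x = (\<Sum>k. diffs c k * x ^ k)" for x
  define P'' where "P'' x = (\<Sum>k. diffs (diffs c) k * x ^ k)" for x
  have s0: "summable (\<lambda>k. c k * x ^ k)" for x
    unfolding c_def by (rule summable_bessel_coeff[OF assms])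
  have s1: "summable (\<lambda>k. diffs c k * x ^ k)" for x
    by (rule termdiff_converges_all) (rule s0)
  have s2: "summable (\<lambda>k. diffs (diffs c) k * x ^ k)" for x
    by (rule termdiff_converges_all) (rule s1)
  have d0: "(bessel_series \<mu> has_real_derivative P' x) (at x)" for x
    unfolding P'_def bessel_series_def[abs_def] c_def[symmetric]
    by (rule termdiffs_strong_converges_everywhere) (rule s0)
  have d1: "(P' has_real_derivative P'' x) (at x)" for x
    unfolding P'_def[abs_def] P''_def
    by (rule termdiffs_strong_converges_everywhere) (rule s1)
  have "x * P'' x + (\<mu> + 1) * P' x + bessel_series \<mu> x / 4 = 0" for x
  proof -
    \<comment> \<open>Multiplying by \<open>x\<close> shifts the index by one; the new term at index
      \<open>0\<close> carries the factor \<open>0\<close>.\<close>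
    have "(\<lambda>k. real k * diffs c k * x ^ k) sums (x * P'' x)"
    proof -
      have "(\<lambda>k. x * (diffs (diffs c) k * x ^ k)) sums (x * P'' x)"
        unfolding P''_def by (intro sums_mult summable_sums s2)
      then have "(\<lambda>k. real (Suc k) * diffs c (Suc k) * x ^ Suc k) sums (x * P'' x)"
        by (simp add: diffs_def algebra_simps)
      then show ?thesis by (subst (asm) sums_Suc_iff) simp
    qed
    moreover have "(\<lambda>k. diffs c k * x ^ k) sums P' x"
      unfolding P'_def by (intro summable_sums s1)
    moreover have "(\<lambda>k. c k * x ^ k) sums bessel_series \<mu> x"
      unfolding bessel_series_def c_def[symmetric] by (intro summable_sums s0)
    ultimately have "(\<lambda>k. real k * diffs c k * x ^ k + (\<mu> + 1) * (diffs c k * x ^ k) + (c k * x ^ k) / 4)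
      sums (x * P'' x + (\<mu> + 1) * P' x + bessel_series \<mu> x / 4)"
      by (intro sums_add sums_mult sums_divide)
    moreover have "real k * diffs c k * x ^ k + (\<mu> + 1) * (diffs c k * x ^ k) + (c k * x ^ k) / 4 = 0" for k
    proof -
      have "real k * diffs c k + (\<mu> + 1) * diffs c k + c k / 4 = 0"
        using bessel_coeff_Suc[OF assms, of k] by (simp add: diffs_def c_def algebra_simps)
      moreover have "real k * diffs c k * x ^ k + (\<mu> + 1) * (diffs c k * x ^ k) + (c k * x ^ k) / 4
         = (real k * diffs c k + (\<mu> + 1) * diffs c k + c k / 4) * x ^ k"
        by (simp add: algebra_simps)
      ultimately show ?thesis by simp
    qed
    ultimately have "(\<lambda>k. 0) sums (x * P'' x + (\<mu> + 1) * P' x + bessel_series \<mu> x / 4)"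
      by (simp only:)
    then show ?thesis using sums_unique2[OF _ sums_zero] by metis
  qed
  then show ?thesis using that d0 d1 by blast
qed

lemma continuous_on_bessel_norm:
  assumes "\<mu> \<ge> 0"
  shows "continuous_on {0..} (bessel_norm \<mu>)"
proof -
  obtain P' where "\<And>x. (bessel_series \<mu> has_real_derivative P' x) (at x)"
    using bessel_series_ode[OF assms] by metis
  then have cont: "isCont (bessel_series \<mu>) x" for x by (rule DERIV_isCont)
  have "isCont (\<lambda>z. bessel_series \<mu> (z\<^sup>2)) x" for x
    by (rule isCont_o2[OF _ cont]) simp
  then have "continuous_on {0..} (\<lambda>z. sqrt pi * Gamma (\<mu> + 1/2) * bessel_series \<mu> (z\<^sup>2))"
    by (intro continuous_on_mult_left continuous_at_imp_continuous_on) auto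
  then show ?thesis
    by (rule continuous_on_eq) (simp add: bessel_norm_series[OF assms])
qed

section \<open>Asymptotics of a perturbed harmonic oscillator\<close>

text \<open>The bound on the derivative makes \<open>f - K / z\<close> nondecreasing and
  \<open>f + K / z\<close> nonincreasing. Every value of the first is thus below every value of the
  second, and the supremum of the first serves as \<open>L\<close>.\<close>

lemma limit_at_rate_inverse:
  fixes f f' :: "real \<Rightarrow> real"
  assumes "z0 > 0"
    and der: "\<And>z. z \<ge> z0 \<Longrightarrow> (f has_real_derivative f' z) (at z)"
    and bound: "\<And>z. z \<ge> z0 \<Longrightarrow> \<bar>f' z\<bar> \<le> K / z\<^sup>2"
  obtains L where "\<And>z. z \<ge> z0 \<Longrightarrow> \<bar>f z - L\<bar> \<le> K / z"
proof -
  have up: "f x - K / x \<le> f y - K / y" if "z0 \<le> x" "x \<le> y" for x y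
  proof (rule DERIV_nonneg_imp_nondecreasing[OF that(2)])
    fix z assume "x \<le> z" "z \<le> y"
    then have z: "z \<ge> z0" "z > 0" using that assms(1) by auto
    have "((\<lambda>z. f z - K / z) has_real_derivative f' z + K / z\<^sup>2) (at z)"
      using z by (auto intro!: derivative_eq_intros der simp: power2_eq_square)
    moreover have "f' z + K / z\<^sup>2 \<ge> 0" using bound[OF z(1)] by linarith
    ultimately show "\<exists>d. ((\<lambda>z. f z - K / z) has_real_derivative d) (at z) \<and> 0 \<le> d" by blast
  qed
  have down: "f y + K / y \<le> f x + K / x" if "z0 \<le> x" "x \<le> y" for x y
  proof (rule DERIV_nonpos_imp_nonincreasing[OF that(2)])
    fix z assume "x \<le> z" "z \<le> y"
    then have z: "z \<ge> z0" "z > 0" using that assms(1) by auto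
    have "((\<lambda>z. f z + K / z) has_real_derivative f' z - K / z\<^sup>2) (at z)"
      using z by (auto intro!: derivative_eq_intros der simp: power2_eq_square)
    moreover have "f' z - K / z\<^sup>2 \<le> 0" using bound[OF z(1)] by linarith
    ultimately show "\<exists>d. ((\<lambda>z. f z + K / z) has_real_derivative d) (at z) \<and> d \<le> 0" by blast
  qed
  have "K / z0\<^sup>2 \<ge> 0" using bound[of z0] by auto
  then have "K \<ge> 0" using \<open>z0 > 0\<close> by (simp add: zero_le_divide_iff)
  have cross: "f x - K / x \<le> f y + K / y" if "z0 \<le> x" "z0 \<le> y" for x y
  proof (cases "x \<le> y")
    case True
    have "K / y \<ge> 0" using that \<open>K \<ge> 0\<close> \<open>z0 > 0\<close> by auto
    then show ?thesis using up[OF that(1) True] by linarith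
  next
    case False
    have "K / x \<ge> 0" using that \<open>K \<ge> 0\<close> \<open>z0 > 0\<close> by auto
    then show ?thesis using down[OF that(2), of x] False by linarith
  qed
  define L where "L = (SUP x\<in>{z0..}. f x - K / x)"
  show thesis
  proof (rule that)
    fix z assume z: "z \<ge> z0"
    have "bdd_above ((\<lambda>x. f x - K / x) ` {z0..})"
      using cross[OF _ z] by (auto intro!: bdd_aboveI)
    then have "f z - K / z \<le> L" unfolding L_def using z by (intro cSUP_upper) auto
    moreover have "L \<le> f z + K / z"
      unfolding L_def using z cross by (intro cSUP_least) auto
    ultimately show "\<bar>f z - L\<bar> \<le> K / z" by linarith
  qed
qed

text \<open>Gronwall for the energy \<open>u\<^sup>2 + u1\<^sup>2\<close>: its relative growth rate
  is at most \<open>\<bar>k\<bar> / z\<^sup>2\<close>, and the factor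
  \<open>exp (\<bar>k\<bar> / z)\<close> has the opposite logarithmic derivative, so the product
  \<open>H\<close> cannot increase.\<close>

lemma perturbed_oscillator_bounded:
  fixes u u1 u2 :: "real \<Rightarrow> real"
  assumes "z0 > 0"
    and du: "\<And>z. z \<ge> z0 \<Longrightarrow> (u has_real_derivative u1 z) (at z)"
    and du1: "\<And>z. z \<ge> z0 \<Longrightarrow> (u1 has_real_derivative u2 z) (at z)"
    and ode: "\<And>z. z \<ge> z0 \<Longrightarrow> u2 z + u z = k / z\<^sup>2 * u z"
  obtains M where "\<And>z. z \<ge> z0 \<Longrightarrow> \<bar>u z\<bar> \<le> M"
proof -
  define H where "H z = ((u z)\<^sup>2 + (u1 z)\<^sup>2) * exp (\<bar>k\<bar> / z)" for z
  have mono: "H z \<le> H z0" if "z0 \<le> z" for z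
  proof (rule DERIV_nonpos_imp_nonincreasing[OF that])
    fix x assume "z0 \<le> x" "x \<le> z"
    then have x: "x \<ge> z0" "x > 0" using \<open>z0 > 0\<close> by auto
    define d where "d = (2 * u1 x * (u x + u2 x) - \<bar>k\<bar> / x\<^sup>2 * ((u x)\<^sup>2 + (u1 x)\<^sup>2)) * exp (\<bar>k\<bar> / x)"
    have "(H has_real_derivative d) (at x)"
      unfolding H_def[abs_def] d_def using x
      by (auto intro!: derivative_eq_intros du du1 simp: power2_eq_square algebra_simps)
    moreover have "d \<le> 0"
    proof -
      have "2 * u1 x * (u x + u2 x) = k / x\<^sup>2 * (2 * u x * u1 x)"
        using ode[OF x(1)] by (simp add: algebra_simps)
      also have "\<dots> \<le> \<bar>k / x\<^sup>2 * (2 * u x * u1 x)\<bar>" by (rule abs_ge_self)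
      also have "\<dots> = \<bar>k\<bar> / x\<^sup>2 * \<bar>2 * u x * u1 x\<bar>" by (simp add: abs_mult)
      also have "\<dots> \<le> \<bar>k\<bar> / x\<^sup>2 * ((u x)\<^sup>2 + (u1 x)\<^sup>2)"
        using sum_squares_bound[of "\<bar>u x\<bar>" "\<bar>u1 x\<bar>"]
        by (intro mult_left_mono) (auto simp: abs_mult)
      finally show ?thesis unfolding d_def by (simp add: mult_le_0_iff)
    qed
    ultimately show "\<exists>d. (H has_real_derivative d) (at x) \<and> d \<le> 0" by blast
  qed
  have H: "(u z)\<^sup>2 \<le> H z0" if "z0 \<le> z" for z
  proof -
    have "(u z)\<^sup>2 * 1 \<le> H z" unfolding H_def
      by (rule mult_mono) (use that \<open>z0 > 0\<close> in auto)
    then show ?thesis using mono[OF that] by simp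
  qed
  show thesis
  proof (rule that)
    fix z assume "z \<ge> z0"
    then show "\<bar>u z\<bar> \<le> sqrt (H z0)" using real_sqrt_le_mono[OF H, of z] by simp
  qed
qed

text \<open>Variation of constants: \<open>u cos - u' sin\<close> and \<open>u sin + u' cos\<close> are constant for the
  unperturbed equation and have derivative \<open>O(z\<^sup>-\<^sup>2)\<close> for the perturbed one.\<close>

lemma perturbed_oscillator_asymptotics:
  fixes u u1 u2 :: "real \<Rightarrow> real"
  assumes "z0 > 0"
    and du: "\<And>z. z \<ge> z0 \<Longrightarrow> (u has_real_derivative u1 z) (at z)"
    and du1: "\<And>z. z \<ge> z0 \<Longrightarrow> (u1 has_real_derivative u2 z) (at z)"
    and ode: "\<And>z. z \<ge> z0 \<Longrightarrow> u2 z + u z = k / z\<^sup>2 * u z"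
  obtains A B C where "\<And>z. z \<ge> z0 \<Longrightarrow> \<bar>u z - (A * cos z + B * sin z)\<bar> \<le> C / z"
proof -
  obtain M where M: "\<And>z. z \<ge> z0 \<Longrightarrow> \<bar>u z\<bar> \<le> M"
    using perturbed_oscillator_bounded[OF assms] by metis
  define K where "K = \<bar>k\<bar> * M"
  have res: "\<bar>(u2 z + u z) * r\<bar> \<le> K / z\<^sup>2" if "z \<ge> z0" "\<bar>r\<bar> \<le> 1" for z r
  proof -
    have "\<bar>(u2 z + u z) * r\<bar> = \<bar>k\<bar> / z\<^sup>2 * (\<bar>u z\<bar> * \<bar>r\<bar>)"
      by (simp add: ode[OF that(1)] abs_mult)
    also have "\<dots> \<le> \<bar>k\<bar> / z\<^sup>2 * (M * 1)"
      using M[OF that(1)] that(2) by (intro mult_left_mono mult_mono) auto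
    finally show ?thesis by (simp add: K_def)
  qed
  define a where "a z = u z * cos z - u1 z * sin z" for z
  define b where "b z = u z * sin z + u1 z * cos z" for z
  have "(a has_real_derivative (u2 z + u z) * (- sin z)) (at z)" if "z \<ge> z0" for z
    unfolding a_def[abs_def] using that
    by (auto intro!: derivative_eq_intros du du1 simp: algebra_simps)
  then obtain A where A: "\<And>z. z \<ge> z0 \<Longrightarrow> \<bar>a z - A\<bar> \<le> K / z"
    using res by (rule limit_at_rate_inverse[OF \<open>z0 > 0\<close>]) auto
  have "(b has_real_derivative (u2 z + u z) * cos z) (at z)" if "z \<ge> z0" for z
    unfolding b_def[abs_def] using that
    by (auto intro!: derivative_eq_intros du du1 simp: algebra_simps)
  then obtain B where B: "\<And>z. z \<ge> z0 \<Longrightarrow> \<bar>b z - B\<bar> \<le> K / z"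
    using res by (rule limit_at_rate_inverse[OF \<open>z0 > 0\<close>]) auto
  show thesis
  proof (rule that)
    fix z assume z: "z \<ge> z0"
    have "a z * cos z + b z * sin z = u z * ((sin z)\<^sup>2 + (cos z)\<^sup>2)"
      unfolding a_def b_def by algebra
    then have "u z - (A * cos z + B * sin z) = (a z - A) * cos z + (b z - B) * sin z"
      by (simp add: algebra_simps)
    moreover have "\<bar>(a z - A) * cos z\<bar> \<le> K / z * 1" "\<bar>(b z - B) * sin z\<bar> \<le> K / z * 1"
      unfolding abs_mult using A[OF z] B[OF z] by (intro mult_mono; auto)+
    ultimately show "\<bar>u z - (A * cos z + B * sin z)\<bar> \<le> 2 * K / z" by simp
  qed
qed

text \<open>The exponent \<open>m = \<mu> + 1/2\<close> is the one that removes the first-order term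
  of Bessel's equation: \<open>u = z\<^sup>m P(z\<^sup>2)\<close> satisfies the perturbed oscillator
  equation with \<open>k = m (m - 1)\<close>. Only the shape of the main term matters later, so
  \<open>A\<close> and \<open>B\<close> stay implicit.\<close>

lemma bessel_norm_asymptotics:
  assumes "\<mu> \<ge> 0" "z0 > 0"
  defines "m \<equiv> \<mu> + 1/2"
  obtains A B C where
    "\<And>z. z \<ge> z0 \<Longrightarrow> \<bar>bessel_norm \<mu> z - z powr (- m) * (A * cos z + B * sin z)\<bar> \<le> C * z powr (- m - 1)"
proof -
  obtain P' P'' where
    dP: "\<And>x. (bessel_series \<mu> has_real_derivative P' x) (at x)" and
    dP': "\<And>x. (P' has_real_derivative P'' x) (at x)" and
    ode: "\<And>x. x * P'' x + (\<mu> + 1) * P' x + bessel_series \<mu> x / 4 = 0"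
    using bessel_series_ode[OF assms(1)] by metis
  define P where "P = bessel_series \<mu>"
  define u where "u z = z powr m * P (z\<^sup>2)" for z
  define u1 where "u1 z = m * z powr (m - 1) * P (z\<^sup>2) + 2 * z powr (m + 1) * P' (z\<^sup>2)" for z
  \<comment> \<open>The common factor \<open>z powr (m - 2)\<close> is pulled out of all
    derivatives, so that checking them reduces to identities between polynomials in
    \<open>z\<close>.\<close>
  define u2 where "u2 z = z powr (m - 2) * (m * (m - 1) * P (z\<^sup>2) + (4 * m + 2) * z\<^sup>2 * P' (z\<^sup>2) + 4 * z ^ 4 * P'' (z\<^sup>2))" for z
  have dP2: "((\<lambda>z. P (z\<^sup>2)) has_real_derivative P' (z\<^sup>2) * (2 * z)) (at z)" for z
    unfolding P_def by (rule DERIV_chain2[OF dP]) (auto intro!: derivative_eq_intros)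
  have dP2': "((\<lambda>z. P' (z\<^sup>2)) has_real_derivative P'' (z\<^sup>2) * (2 * z)) (at z)" for z
    by (rule DERIV_chain2[OF dP']) (auto intro!: derivative_eq_intros)
  have shift: "z powr (r + 1) = z powr r * z" "z powr (r - 1) = z powr r / z" if "z > 0" for z r :: real
    using that by (simp_all add: powr_add powr_diff)
  have shift2: "z powr m = z powr (m - 2) * z\<^sup>2" "z powr (m - 1) = z powr (m - 2) * z"
      "z powr (m + 1) = z powr (m - 2) * z ^ 3" if "z > 0" for z :: real
    using that shift(1)[OF that, of "m - 2"] shift(1)[OF that, of "m - 1"] shift(1)[OF that, of m]
    by (simp_all add: power2_eq_square power3_eq_cube)
  have du: "(u has_real_derivative u1 z) (at z)" if "z > 0" for z
  proof -
    have "(u has_real_derivative m * z powr (m - 1) * P (z\<^sup>2) + z powr m * (P' (z\<^sup>2) * (2 * z))) (at z)"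
      unfolding u_def[abs_def] using that by (auto intro!: derivative_eq_intros dP2 simp: algebra_simps)
    then show ?thesis unfolding u1_def using that by (simp only: shift mult_ac)
  qed
  have du1: "(u1 has_real_derivative u2 z) (at z)" if "z > 0" for z
  proof -
    have "(u1 has_real_derivative
        m * ((m - 1) * z powr (m - 1 - 1)) * P (z\<^sup>2) + m * z powr (m - 1) * (P' (z\<^sup>2) * (2 * z))
        + (2 * ((m + 1) * z powr (m + 1 - 1)) * P' (z\<^sup>2) + 2 * z powr (m + 1) * (P'' (z\<^sup>2) * (2 * z)))) (at z)"
      unfolding u1_def[abs_def] using that
      by (auto intro!: derivative_eq_intros dP2 dP2' simp: algebra_simps)
    also have "m * ((m - 1) * z powr (m - 1 - 1)) * P (z\<^sup>2) + m * z powr (m - 1) * (P' (z\<^sup>2) * (2 * z))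
        + (2 * ((m + 1) * z powr (m + 1 - 1)) * P' (z\<^sup>2) + 2 * z powr (m + 1) * (P'' (z\<^sup>2) * (2 * z))) = u2 z"
    proof -
      have e: "m - 1 - 1 = m - 2" "m + 1 - 1 = m" by auto
      show ?thesis unfolding u2_def e shift2[OF that]
        by (simp add: power2_eq_square power3_eq_cube power4_eq_xxxx algebra_simps)
    qed
    finally show ?thesis .
  qed
  have "u2 z + u z = m * (m - 1) / z\<^sup>2 * u z" if "z > 0" for z
  proof -
    \<comment> \<open>The series equation at \<open>x = z\<^sup>2\<close> eliminates
      \<open>P''\<close>. Its \<open>P'\<close> term cancels against the one in \<open>u2\<close>,
      which is where \<open>m = \<mu> + 1/2\<close> is used.\<close>
    have o: "4 * z\<^sup>2 * (z\<^sup>2 * P'' (z\<^sup>2)) = - (4 * m + 2) * z\<^sup>2 * P' (z\<^sup>2) - z\<^sup>2 * P (z\<^sup>2)"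
    proof -
      have Y: "z\<^sup>2 * P'' (z\<^sup>2) = - (m + 1/2) * P' (z\<^sup>2) - P (z\<^sup>2) / 4"
        using ode[of "z\<^sup>2"] by (simp add: m_def P_def algebra_simps)
      show ?thesis by (simp only: Y) (simp add: field_simps)
    qed
    have "u2 z = z powr (m - 2) * (m * (m - 1) * P (z\<^sup>2) + (4 * m + 2) * z\<^sup>2 * P' (z\<^sup>2) + 4 * z\<^sup>2 * (z\<^sup>2 * P'' (z\<^sup>2)))"
      unfolding u2_def by (simp add: power2_eq_square power4_eq_xxxx)
    also have "\<dots> = z powr (m - 2) * (m * (m - 1) * P (z\<^sup>2) - z\<^sup>2 * P (z\<^sup>2))"
      unfolding o by (simp add: algebra_simps)
    moreover have "m * (m - 1) / z\<^sup>2 * u z = z powr (m - 2) * (m * (m - 1) * P (z\<^sup>2))"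
      using that by (simp add: u_def shift2)
    moreover have "u z = z powr (m - 2) * (z\<^sup>2 * P (z\<^sup>2))"
      using that by (simp add: u_def shift2)
    ultimately show ?thesis by (simp add: algebra_simps)
  qed
  with du du1 obtain A B C where
    *: "\<And>z. z \<ge> z0 \<Longrightarrow> \<bar>u z - (A * cos z + B * sin z)\<bar> \<le> C / z"
    using assms(2) by (rule_tac perturbed_oscillator_asymptotics[of z0 u u1 u2 "m * (m - 1)"]) auto
  define c where "c = sqrt pi * Gamma (\<mu> + 1/2)"
  show thesis
  proof (rule that)
    fix z assume z: "z \<ge> z0"
    then have "z > 0" using assms by auto
    have b: "bessel_norm \<mu> z = c * (z powr (- m) * u z)"
    proof -
      have "bessel_norm \<mu> z = c * P (z\<^sup>2)"
        using bessel_norm_series[OF \<open>\<mu> \<ge> 0\<close>, of z] \<open>z > 0\<close> by (simp add: c_def P_def)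
      moreover have "z powr (- m) * z powr m = 1"
        using \<open>z > 0\<close> by (simp add: powr_minus)
      ultimately show ?thesis by (simp add: u_def mult.assoc[symmetric])
    qed
    have "bessel_norm \<mu> z - z powr (- m) * (c * A * cos z + c * B * sin z)
        = (c * z powr (- m)) * (u z - (A * cos z + B * sin z))"
      unfolding b by (simp add: algebra_simps)
    then have "\<bar>bessel_norm \<mu> z - z powr (- m) * (c * A * cos z + c * B * sin z)\<bar>
        = (\<bar>c\<bar> * z powr (- m)) * \<bar>u z - (A * cos z + B * sin z)\<bar>"
      by (simp add: abs_mult)
    also have "\<dots> \<le> (\<bar>c\<bar> * z powr (- m)) * (C / z)"
      by (intro mult_left_mono *[OF z]) simp
    also have "\<dots> = \<bar>c\<bar> * C * z powr (- m - 1)"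
      using shift(2)[OF \<open>z > 0\<close>, of "- m"] by simp
    finally show "\<bar>bessel_norm \<mu> z - z powr (- m) * (c * A * cos z + c * B * sin z)\<bar> \<le> \<bar>c\<bar> * C * z powr (- m - 1)" .
  qed
qed

section \<open>Oscillatory integrals with quadratic phase\<close>

text \<open>In the kernel, \<open>a\<close> will be a difference of signed radii and
  \<open>b\<close> a difference of times. The derivative of the phase is affine in \<open>x\<close>,
  so monotonicity comes for free in the van der Corput estimates.\<close>

definition chirp :: "real \<Rightarrow> real \<Rightarrow> real \<Rightarrow> complex" where
  "chirp a b x = cis (a * x + b * x\<^sup>2)"

lemma norm_chirp [simp]: "norm (chirp a b x) = 1"
  by (simp add: chirp_def)

lemma continuous_on_chirp [continuous_intros]: "continuous_on S (chirp a b)"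
  unfolding chirp_def[abs_def] by (intro continuous_intros)

lemma has_vector_derivative_chirp:
  "(chirp a b has_vector_derivative (a + 2 * b * x) *\<^sub>R (\<i> * chirp a b x)) (at x within S)"
  unfolding chirp_def[abs_def] has_vector_derivative_def
  by (auto intro!: derivative_eq_intros simp: algebra_simps)

lemma chirp_integrable_on [simp, intro]: "chirp a b integrable_on {p..q}"
  by (intro integrable_continuous_interval continuous_intros)

text \<open>Integration by parts against \<open>1 / \<phi>'\<close>, which is monotone because
  \<open>\<phi>'\<close> is affine without zeros on the interval. The two boundary terms cost
  \<open>1 / d\<close> each and the total variation of \<open>1 / \<phi>'\<close> costs
  \<open>2 / d\<close>.\<close>

lemma chirp_nonstationary:
  assumes "p \<le> q" "d > 0" and ge: "\<And>x. x \<in> {p..q} \<Longrightarrow> \<bar>a + 2 * b * x\<bar> \<ge> d"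
  shows "norm (integral {p..q} (chirp a b)) \<le> 4 / d"
proof -
  define \<phi>' where "\<phi>' x = a + 2 * b * x" for x
  have nz: "\<phi>' x \<noteq> 0" if "x \<in> {p..q}" for x using ge[OF that] \<open>d > 0\<close> by (auto simp: \<phi>'_def)
  have inv: "norm (1 / \<phi>' x) \<le> 1 / d" if "x \<in> {p..q}" for x
    using ge[OF that] \<open>d > 0\<close> by (auto simp: \<phi>'_def intro!: divide_left_mono)
  have cont: "continuous_on {p..q} (\<lambda>x. 2 * b / (\<phi>' x)\<^sup>2)"
    unfolding \<phi>'_def using nz by (intro continuous_intros) (auto simp: \<phi>'_def)
  have dinv: "((\<lambda>x. 1 / \<phi>' x) has_real_derivative - (2 * b / (\<phi>' x)\<^sup>2)) (at x within {p..q})" if "x \<in> {p..q}" for x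
    unfolding \<phi>'_def using nz[OF that] by (auto intro!: derivative_eq_intros simp: \<phi>'_def power2_eq_square)
  \<comment> \<open>The derivative of \<open>- \<i> * chirp / \<phi>'\<close> is
    \<open>chirp + G\<close>, with \<open>G\<close> coming from the derivative of
    \<open>1 / \<phi>'\<close>.\<close>
  define G where "G x = (2 * b / (\<phi>' x)\<^sup>2) *\<^sub>R (\<i> * chirp a b x)" for x
  have G: "G integrable_on {p..q}"
    unfolding G_def[abs_def] by (intro integrable_continuous_interval continuous_intros cont)
  have "((\<lambda>x. chirp a b x + G x) has_integral
      ((1 / \<phi>' q) *\<^sub>R (- \<i> * chirp a b q) - (1 / \<phi>' p) *\<^sub>R (- \<i> * chirp a b p))) {p..q}"
  proof (rule fundamental_theorem_of_calculus[OF \<open>p \<le> q\<close>])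
    fix x assume x: "x \<in> {p..q}"
    have "((\<lambda>x. (1 / \<phi>' x) *\<^sub>R (- \<i> * chirp a b x)) has_vector_derivative
      (1 / \<phi>' x) *\<^sub>R (- \<i> * (\<phi>' x *\<^sub>R (\<i> * chirp a b x))) + (- (2 * b / (\<phi>' x)\<^sup>2)) *\<^sub>R (- \<i> * chirp a b x)) (at x within {p..q})"
      by (intro has_vector_derivative_scaleR has_vector_derivative_mult_right dinv x
          has_vector_derivative_chirp[of a b, folded \<phi>'_def])
    moreover have "(1 / \<phi>' x) *\<^sub>R (- \<i> * (\<phi>' x *\<^sub>R (\<i> * chirp a b x))) = chirp a b x"
      using nz[OF x] by simp
    ultimately show "((\<lambda>x. (1 / \<phi>' x) *\<^sub>R (- \<i> * chirp a b x)) has_vector_derivative chirp a b x + G x) (at x within {p..q})"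
      by (simp add: G_def)
  qed
  then have "integral {p..q} (\<lambda>x. chirp a b x + G x) =
      (1 / \<phi>' q) *\<^sub>R (- \<i> * chirp a b q) - (1 / \<phi>' p) *\<^sub>R (- \<i> * chirp a b p)"
    by (rule integral_unique)
  then have eq: "integral {p..q} (chirp a b) =
      (1 / \<phi>' q) *\<^sub>R (- \<i> * chirp a b q) - (1 / \<phi>' p) *\<^sub>R (- \<i> * chirp a b p) - integral {p..q} G"
    using G by (simp add: integral_add algebra_simps)
  have "((\<lambda>x. 2 * b / (\<phi>' x)\<^sup>2) has_integral (- (1 / \<phi>' q) - - (1 / \<phi>' p))) {p..q}"
  proof (rule fundamental_theorem_of_calculus[OF \<open>p \<le> q\<close>])
    fix x assume "x \<in> {p..q}"
    from DERIV_minus[OF dinv[OF this]]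
    show "((\<lambda>x. - (1 / \<phi>' x)) has_vector_derivative 2 * b / (\<phi>' x)\<^sup>2) (at x within {p..q})"
      by (simp add: has_real_derivative_iff_has_vector_derivative)
  qed
  \<comment> \<open>The factor \<open>sgn b\<close> turns the integrand into its absolute value, so
    the total variation of \<open>1 / \<phi>'\<close> telescopes to a difference of endpoint
    values.\<close>
  from has_integral_mult_right[OF this, of "sgn b"]
  have I: "((\<lambda>x. 2 * \<bar>b\<bar> / (\<phi>' x)\<^sup>2) has_integral sgn b * (1 / \<phi>' p - 1 / \<phi>' q)) {p..q}"
    by (simp add: sgn_mult_self_eq abs_sgn mult_ac)
  have "norm (integral {p..q} G) \<le> integral {p..q} (\<lambda>x. 2 * \<bar>b\<bar> / (\<phi>' x)\<^sup>2)"
    using I by (intro integral_norm_bound_integral[OF G]) (auto simp: G_def norm_mult)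
  also have "\<dots> = sgn b * (1 / \<phi>' p - 1 / \<phi>' q)" using I by (rule integral_unique)
  also have "\<dots> \<le> \<bar>1 / \<phi>' p - 1 / \<phi>' q\<bar>" by (cases "b = 0") (auto simp: sgn_if)
  also have "\<dots> \<le> 2 / d" using inv[of p] inv[of q] \<open>p \<le> q\<close> abs_triangle_ineq4[of "1 / \<phi>' p" "1 / \<phi>' q"] by simp
  finally have 1: "norm (integral {p..q} G) \<le> 2 / d" .
  have 2: "norm ((1 / \<phi>' x) *\<^sub>R (- \<i> * chirp a b x)) \<le> 1 / d" if "x \<in> {p..q}" for x
    using inv[OF that] by (simp add: norm_mult)
  have "norm (integral {p..q} (chirp a b)) \<le> 1 / d + 1 / d + 2 / d"
    unfolding eq using \<open>p \<le> q\<close>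
    by (intro order_trans[OF norm_triangle_ineq4] add_mono 1 2) auto
  then show ?thesis by simp
qed

text \<open>Around the stationary point \<open>x0\<close> an interval of radius \<open>r\<close> is
  cut out, with \<open>r\<close> such that \<open>\<bar>\<phi>'\<bar>\<close> equals
  \<open>sqrt \<bar>b\<bar>\<close> at distance \<open>r\<close>. The inner part costs its length
  \<open>2 r\<close>, each outer part costs \<open>4 / sqrt \<bar>b\<bar>\<close>, whence
  \<open>9 = 4 + 1 + 4\<close>.\<close>

lemma chirp_second_derivative:
  assumes "p \<le> q" "b \<noteq> 0"
  shows "norm (integral {p..q} (chirp a b)) \<le> 9 / sqrt \<bar>b\<bar>"
proof -
  define r where "r = 1 / (2 * sqrt \<bar>b\<bar>)"
  define x0 where "x0 = - a / (2 * b)"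
  have "r > 0" using assms by (simp add: r_def)
  have far: "\<bar>a + 2 * b * x\<bar> \<ge> sqrt \<bar>b\<bar>" if "\<bar>x - x0\<bar> \<ge> r" for x
  proof -
    have "\<bar>a + 2 * b * x\<bar> = 2 * \<bar>b\<bar> * \<bar>x - x0\<bar>"
    proof -
      have "a + 2 * b * x = 2 * b * (x - x0)" using assms by (simp add: x0_def field_simps)
      then show ?thesis by (simp add: abs_mult)
    qed
    also have "\<dots> \<ge> 2 * \<bar>b\<bar> * r" using that by (intro mult_left_mono) auto
    also have "2 * \<bar>b\<bar> * r = sqrt \<bar>b\<bar>" by (simp add: r_def real_div_sqrt)
    finally show ?thesis .
  qed
  \<comment> \<open>Clamping to the interval treats all positions of \<open>x0\<close> at once; an
    outer piece that would lie on the wrong side degenerates to a point.\<close>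
  define c1 where "c1 = max p (min q (x0 - r))"
  define c2 where "c2 = max p (min q (x0 + r))"
  have c: "p \<le> c1" "c1 \<le> c2" "c2 \<le> q" using assms \<open>r > 0\<close> by (auto simp: c1_def c2_def)
  have "integral {p..q} (chirp a b) = integral {p..c1} (chirp a b) + integral {c1..q} (chirp a b)"
    using c by (simp add: Henstock_Kurzweil_Integration.integral_combine)
  also have "integral {c1..q} (chirp a b) = integral {c1..c2} (chirp a b) + integral {c2..q} (chirp a b)"
    using c by (simp add: Henstock_Kurzweil_Integration.integral_combine)
  finally have eq: "integral {p..q} (chirp a b) =
    integral {p..c1} (chirp a b) + (integral {c1..c2} (chirp a b) + integral {c2..q} (chirp a b))" .
  have "norm (integral {p..c1} (chirp a b)) \<le> 4 / sqrt \<bar>b\<bar>"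
  proof (cases "p = c1")
    case False
    then have "c1 \<le> x0 - r" using c by (auto simp: c1_def max_def min_def split: if_splits)
    then show ?thesis using c assms by (intro chirp_nonstationary far) auto
  qed simp
  moreover have "norm (integral {c2..q} (chirp a b)) \<le> 4 / sqrt \<bar>b\<bar>"
  proof (cases "c2 = q")
    case False
    then have "c2 \<ge> x0 + r" using c by (auto simp: c2_def max_def min_def split: if_splits)
    then show ?thesis using c assms by (intro chirp_nonstationary far) auto
  qed simp
  moreover have "norm (integral {c1..c2} (chirp a b)) \<le> 1 / sqrt \<bar>b\<bar>"
  proof -
    have "norm (integral {c1..c2} (chirp a b)) \<le> 1 * (c2 - c1)"
      using c by (intro integral_bound continuous_intros) auto
    also have "\<dots> \<le> 2 * r" using \<open>r > 0\<close> assms by (auto simp: c1_def c2_def)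
    finally show ?thesis by (simp add: r_def)
  qed
  ultimately have "norm (integral {p..q} (chirp a b)) \<le> 4 / sqrt \<bar>b\<bar> + (1 / sqrt \<bar>b\<bar> + 4 / sqrt \<bar>b\<bar>)"
    unfolding eq by (intro order_trans[OF norm_triangle_ineq] add_mono)
  then show ?thesis by simp
qed

section \<open>Oscillatory integrals with the amplitude of the kernel\<close>

text \<open>The amplitude \<open>1 / sqrt x\<close> is the product of two factors
  \<open>x powr (- 1 / 4)\<close>, one from the operator and one from its adjoint.\<close>

definition chirp_weighted :: "real \<Rightarrow> real \<Rightarrow> real \<Rightarrow> real \<Rightarrow> complex" where
  "chirp_weighted a b p q = integral {p..q} (\<lambda>x. (1 / sqrt x) *\<^sub>R chirp a b x)"

lemma chirp_weighted_integrable_on: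
  "p > 0 \<Longrightarrow> (\<lambda>x. (1 / sqrt x) *\<^sub>R chirp a b x) integrable_on {p..q}"
  by (intro integrable_continuous_interval continuous_intros) auto

lemma chirp_weighted_combine:
  "0 < p \<Longrightarrow> p \<le> c \<Longrightarrow> c \<le> q \<Longrightarrow>
    chirp_weighted a b p q = chirp_weighted a b p c + chirp_weighted a b c q"
  unfolding chirp_weighted_def
  by (simp add: Henstock_Kurzweil_Integration.integral_combine chirp_weighted_integrable_on)

lemma has_real_derivative_inverse_sqrt:
  "x > 0 \<Longrightarrow> ((\<lambda>x. 1 / sqrt x) has_real_derivative - (1 / (2 * x * sqrt x))) (at x within S)"
  by (auto intro!: derivative_eq_intros simp: field_simps)

lemma has_integral_inverse_sqrt:
  assumes "0 < p" "p \<le> q"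
  shows "((\<lambda>x. 1 / sqrt x) has_integral 2 * sqrt q - 2 * sqrt p) {p..q}"
proof (rule fundamental_theorem_of_calculus[OF \<open>p \<le> q\<close>])
  fix x assume "x \<in> {p..q}"
  then show "((\<lambda>x. 2 * sqrt x) has_vector_derivative 1 / sqrt x) (at x within {p..q})"
    using \<open>p > 0\<close> unfolding has_real_derivative_iff_has_vector_derivative[symmetric]
    by (auto intro!: derivative_eq_intros simp: field_simps)
qed

lemma chirp_weighted_trivial:
  assumes "0 < p" "p \<le> q"
  shows "norm (chirp_weighted a b p q) \<le> 2 * sqrt q"
proof -
  have "norm (chirp_weighted a b p q) \<le> integral {p..q} (\<lambda>x. 1 / sqrt x)"
    unfolding chirp_weighted_def using assms has_integral_inverse_sqrt[OF assms]
    by (intro integral_norm_bound_integral chirp_weighted_integrable_on) auto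
  also have "\<dots> = 2 * sqrt q - 2 * sqrt p"
    using has_integral_inverse_sqrt[OF assms] by (rule integral_unique)
  also have "\<dots> \<le> 2 * sqrt q" using assms by simp
  finally show ?thesis .
qed

text \<open>Integration by parts with the primitive \<open>\<Phi>\<close> of the chirp: since the
  weight decreases, its value at \<open>q\<close> plus its variation is its value at
  \<open>p\<close>. Hence only the bound \<open>M\<close> and the weight at the lower end
  count.\<close>

lemma chirp_weighted_le:
  assumes "0 < P" "P \<le> p" "p \<le> q"
    and M: "\<And>y. y \<in> {p..q} \<Longrightarrow> norm (integral {p..y} (chirp a b)) \<le> M"
  shows "norm (chirp_weighted a b p q) \<le> M / sqrt P"
proof -
  have "p > 0" using assms by auto
  have "M \<ge> 0" using M[of p] \<open>p \<le> q\<close> by simp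
  define \<Phi> where "\<Phi> y = integral {p..y} (chirp a b)" for y
  define w' where "w' x = 1 / (2 * x * sqrt x)" for x
  have d\<Phi>: "(\<Phi> has_vector_derivative chirp a b x) (at x within {p..q})" if "x \<in> {p..q}" for x
    unfolding \<Phi>_def[abs_def] using that by (intro integral_has_vector_derivative continuous_intros)
  have dw: "((\<lambda>x. 1 / sqrt x) has_real_derivative - w' x) (at x within {p..q})" if "x \<in> {p..q}" for x
    unfolding w'_def using that \<open>p > 0\<close> by (intro has_real_derivative_inverse_sqrt) auto
  have cont: "continuous_on {p..q} w'" unfolding w'_def[abs_def] using \<open>p > 0\<close> by (intro continuous_intros) auto
  have cont\<Phi>: "continuous_on {p..q} \<Phi>"
    using d\<Phi> by (meson continuous_on_eq_continuous_within has_vector_derivative_continuous)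
  have int: "(\<lambda>x. w' x *\<^sub>R \<Phi> x) integrable_on {p..q}"
    by (intro integrable_continuous_interval continuous_intros cont cont\<Phi>)
  have "((\<lambda>x. (1 / sqrt x) *\<^sub>R chirp a b x + (- w' x) *\<^sub>R \<Phi> x) has_integral ((1 / sqrt q) *\<^sub>R \<Phi> q - (1 / sqrt p) *\<^sub>R \<Phi> p)) {p..q}"
    by (intro fundamental_theorem_of_calculus[OF \<open>p \<le> q\<close>] has_vector_derivative_scaleR d\<Phi> dw)
  then have "integral {p..q} (\<lambda>x. (1 / sqrt x) *\<^sub>R chirp a b x + (- w' x) *\<^sub>R \<Phi> x) = (1 / sqrt q) *\<^sub>R \<Phi> q"
    by (simp add: integral_unique \<Phi>_def)
  then have eq: "chirp_weighted a b p q = (1 / sqrt q) *\<^sub>R \<Phi> q + integral {p..q} (\<lambda>x. w' x *\<^sub>R \<Phi> x)"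
    unfolding chirp_weighted_def using int chirp_weighted_integrable_on[OF \<open>p > 0\<close>, of a b q]
    by (simp add: integral_diff algebra_simps)
  have "((\<lambda>x. w' x) has_integral (- (1 / sqrt q) - - (1 / sqrt p))) {p..q}"
  proof (rule fundamental_theorem_of_calculus[OF \<open>p \<le> q\<close>])
    fix x assume "x \<in> {p..q}"
    from DERIV_minus[OF dw[OF this]]
    show "((\<lambda>x. - (1 / sqrt x)) has_vector_derivative w' x) (at x within {p..q})"
      by (simp add: has_real_derivative_iff_has_vector_derivative)
  qed
  from has_integral_mult_left[OF this, of M]
  have I: "((\<lambda>x. w' x * M) has_integral (1 / sqrt p - 1 / sqrt q) * M) {p..q}" by simp
  have "norm (integral {p..q} (\<lambda>x. w' x *\<^sub>R \<Phi> x)) \<le> integral {p..q} (\<lambda>x. w' x * M)"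
  proof (rule integral_norm_bound_integral[OF int])
    show "(\<lambda>x. w' x * M) integrable_on {p..q}" using I by blast
    fix x assume x: "x \<in> {p..q}"
    then have "w' x \<ge> 0" using \<open>p > 0\<close> by (simp add: w'_def)
    then show "norm (w' x *\<^sub>R \<Phi> x) \<le> w' x * M"
      using M[OF x] by (simp add: \<Phi>_def mult_left_mono)
  qed
  also have "\<dots> = (1 / sqrt p - 1 / sqrt q) * M" using I by (rule integral_unique)
  finally have "norm (chirp_weighted a b p q) \<le> 1 / sqrt q * M + (1 / sqrt p - 1 / sqrt q) * M"
    unfolding eq using M[of q] assms
    by (intro order_trans[OF norm_triangle_ineq] add_mono) (auto simp: \<Phi>_def divide_right_mono)
  also have "\<dots> = M / sqrt p" by (simp add: algebra_simps)
  also have "\<dots> \<le> M / sqrt P" using assms \<open>M \<ge> 0\<close> by (intro divide_left_mono) auto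
  finally show ?thesis .
qed

text \<open>Below \<open>c\<close> oscillation is ignored and the integrable weight costs
  \<open>2 * sqrt c\<close>. The point \<open>c\<close> is later placed where this balances the
  oscillatory bound \<open>M\<close>.\<close>

lemma chirp_weighted_split:
  assumes "0 < c" "0 < p" "p \<le> q"
    and M: "\<And>p q. c \<le> p \<Longrightarrow> p \<le> q \<Longrightarrow> norm (chirp_weighted a b p q) \<le> M"
  shows "norm (chirp_weighted a b p q) \<le> 2 * sqrt c + M"
proof -
  have "0 \<le> M" using M[of c c] norm_ge_zero order_trans by blast
  consider "q \<le> c" | "c \<le> p" | "p \<le> c" "c \<le> q" by linarith
  then show ?thesis
  proof cases
    case 1
    then have "sqrt q \<le> sqrt c" by simp
    then show ?thesis using chirp_weighted_trivial[OF assms(2,3), of a b] \<open>0 \<le> M\<close> by linarith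
  next
    case 2
    then show ?thesis using M[OF 2 \<open>p \<le> q\<close>] \<open>0 < c\<close> by (simp add: add_increasing)
  next
    case 3
    then show ?thesis
      unfolding chirp_weighted_combine[OF \<open>0 < p\<close> 3]
      by (intro order_trans[OF norm_triangle_ineq] add_mono chirp_weighted_trivial M) (use assms in auto)
  qed
qed

text \<open>Splitting at \<open>1 / sqrt \<bar>b\<bar>\<close> balances the two contributions, which
  are \<open>2\<close> and \<open>9\<close> times the power \<open>-1/4\<close> of
  \<open>\<bar>b\<bar>\<close>.\<close>

lemma chirp_weighted_bound_quadratic:
  assumes "0 < p" "p \<le> q" "b \<noteq> 0"
  shows "norm (chirp_weighted a b p q) \<le> 11 / sqrt (sqrt \<bar>b\<bar>)"
proof -
  define k where "k = sqrt (sqrt \<bar>b\<bar>)"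
  have k: "k > 0" "sqrt \<bar>b\<bar> = k\<^sup>2" using assms by (simp_all add: k_def)
  have "norm (chirp_weighted a b p q) \<le> 2 * sqrt (1 / k\<^sup>2) + (9 / sqrt \<bar>b\<bar>) / sqrt (1 / k\<^sup>2)"
    using assms k
    by (intro chirp_weighted_split chirp_weighted_le chirp_second_derivative) auto
  also have "\<dots> = 11 / k"
    using k by (simp add: k(2) real_sqrt_divide) (simp add: field_simps power2_eq_square)
  finally show ?thesis by (simp add: k_def)
qed

text \<open>To be uniform in \<open>b\<close>, three ranges are separated. Below
  \<open>1 / \<bar>a\<bar>\<close> the trivial bound gives \<open>2\<close>. Up to
  \<open>\<bar>a\<bar> / (4 * \<bar>b\<bar>)\<close> the linear term dominates,
  \<open>\<bar>\<phi>'\<bar> \<ge> \<bar>a\<bar> / 2\<close>, and the first-derivative test gives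
  \<open>8\<close>. Beyond that point a stationary point may occur, but the weight is so small that
  the second-derivative test gives \<open>18\<close>. The sum is \<open>28\<close>.\<close>

lemma chirp_weighted_bound_linear:
  assumes "0 < p" "p \<le> q" "a \<noteq> 0"
  shows "norm (chirp_weighted a b p q) \<le> 28 / sqrt \<bar>a\<bar>"
proof -
  define k where "k = sqrt \<bar>a\<bar>"
  have k: "k > 0" "\<bar>a\<bar> = k\<^sup>2" using assms by (simp_all add: k_def)
  have low: "norm (chirp_weighted a b p q) \<le> 8 / k"
    if "1 / \<bar>a\<bar> \<le> p" "p \<le> q" "4 * \<bar>b\<bar> * q \<le> \<bar>a\<bar>" for p q
  proof -
    have "0 < 1 / \<bar>a\<bar>" using assms by simp
    have "norm (chirp_weighted a b p q) \<le> (4 / (\<bar>a\<bar> / 2)) / sqrt (1 / \<bar>a\<bar>)"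
    proof (rule chirp_weighted_le[OF \<open>0 < 1 / \<bar>a\<bar>\<close> that(1,2)])
      fix y assume y: "y \<in> {p..q}"
      show "norm (integral {p..y} (chirp a b)) \<le> 4 / (\<bar>a\<bar> / 2)"
      proof (rule chirp_nonstationary)
        fix x assume x: "x \<in> {p..y}"
        then have "x \<ge> 0" using that(1) \<open>0 < 1 / \<bar>a\<bar>\<close> unfolding atLeastAtMost_iff by linarith
        have "\<bar>2 * b * x\<bar> = 2 * \<bar>b\<bar> * x" using \<open>x \<ge> 0\<close> by (simp add: abs_mult)
        moreover have "\<bar>b\<bar> * x \<le> \<bar>b\<bar> * q" using x y by (intro mult_left_mono) auto
        ultimately show "\<bar>a\<bar> / 2 \<le> \<bar>a + 2 * b * x\<bar>" using that(3) by linarith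
      qed (use y assms in auto)
    qed
    also have "\<dots> = 8 / k" using k by (simp add: k(2) real_sqrt_divide power2_eq_square)
    finally show ?thesis .
  qed
  have high: "norm (chirp_weighted a b p q) \<le> 18 / k"
    if "0 < p" "p \<le> q" "\<bar>a\<bar> \<le> 4 * \<bar>b\<bar> * p" for p q
  proof -
    have b: "b \<noteq> 0" using that assms by auto
    then have "norm (chirp_weighted a b p q) \<le> (9 / sqrt \<bar>b\<bar>) / sqrt (\<bar>a\<bar> / (4 * \<bar>b\<bar>))"
      using that assms by (intro chirp_weighted_le chirp_second_derivative) (auto simp: field_simps)
    also have "sqrt (\<bar>a\<bar> / (4 * \<bar>b\<bar>)) = k / (2 * sqrt \<bar>b\<bar>)"
      by (simp add: k_def real_sqrt_divide real_sqrt_mult)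
    also have "(9 / sqrt \<bar>b\<bar>) / (k / (2 * sqrt \<bar>b\<bar>)) = 18 / k" using b by simp
    finally show ?thesis .
  qed
  have "norm (chirp_weighted a b p q) \<le> 2 * sqrt (1 / \<bar>a\<bar>) + 26 / k"
  proof (rule chirp_weighted_split[OF _ assms(1,2)])
    show "0 < 1 / \<bar>a\<bar>" using assms by simp
    fix p q assume pq: "1 / \<bar>a\<bar> \<le> p" "p \<le> q"
    then have "0 < p" using \<open>0 < 1 / \<bar>a\<bar>\<close> by linarith
    consider "4 * \<bar>b\<bar> * q \<le> \<bar>a\<bar>" | "\<bar>a\<bar> \<le> 4 * \<bar>b\<bar> * p" | "4 * \<bar>b\<bar> * p < \<bar>a\<bar>" "\<bar>a\<bar> < 4 * \<bar>b\<bar> * q" by linarith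
    then show "norm (chirp_weighted a b p q) \<le> 26 / k"
    proof cases
      case 1
      then show ?thesis using low[OF pq] k by (smt (verit) divide_right_mono)
    next
      case 2
      then show ?thesis using high[OF \<open>0 < p\<close> pq(2)] k by (smt (verit) divide_right_mono)
    next
      case 3
      \<comment> \<open>The crossover point satisfies the hypotheses of \<open>low\<close> on its
        left and of \<open>high\<close> on its right.\<close>
      define e where "e = \<bar>a\<bar> / (4 * \<bar>b\<bar>)"
      have "b \<noteq> 0" using 3 by auto
      then have e: "4 * \<bar>b\<bar> * e = \<bar>a\<bar>" by (simp add: e_def)
      have "p \<le> e" "e \<le> q" using 3 \<open>b \<noteq> 0\<close> by (simp_all add: e_def field_simps)
      then have "norm (chirp_weighted a b p q) \<le> 8 / k + 18 / k"
        unfolding chirp_weighted_combine[OF \<open>0 < p\<close> \<open>p \<le> e\<close> \<open>e \<le> q\<close>] using \<open>0 < p\<close> pq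
        by (intro order_trans[OF norm_triangle_ineq] add_mono low high) (auto simp: e)
      then show ?thesis by simp
    qed
  qed
  also have "\<dots> = 28 / k" using k by (simp add: k(2) real_sqrt_divide)
  finally show ?thesis by (simp add: k_def)
qed

section \<open>The TT* method\<close>

lemma measurable_cnj [measurable]: "cnj \<in> borel_measurable borel"
  by (intro borel_measurable_continuous_onI continuous_intros)

text \<open>Without integrability the Bochner integral is \<open>0\<close>, so the inequality can be
  applied with no side condition.\<close>

lemma norm_integral_le_nn_integral:
  fixes f :: "'a \<Rightarrow> 'b::{banach, second_countable_topology}"
  shows "ennreal (norm (integral\<^sup>L M f)) \<le> (\<integral>\<^sup>+x. ennreal (norm (f x)) \<partial>M)"
  using integral_norm_bound_ennreal[of M f] by (cases "integrable M f") (auto simp: not_integrable_integral_eq)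

lemma integral_swap_dominated:
  fixes F :: "'a \<Rightarrow> 'b \<Rightarrow> complex" and \<phi> :: "'b \<Rightarrow> real"
  assumes "finite_measure M" "finite_measure N"
    and meas: "(\<lambda>(s, l). F s l) \<in> borel_measurable (M \<Otimes>\<^sub>M N)"
    and \<phi>: "integrable N \<phi>"
    and bound: "\<And>s l. s \<in> space M \<Longrightarrow> l \<in> space N \<Longrightarrow> norm (F s l) \<le> \<phi> l"
  shows "(\<integral>s. \<integral>l. F s l \<partial>N \<partial>M) = (\<integral>l. \<integral>s. F s l \<partial>M \<partial>N)"
proof -
  interpret M: finite_measure M by fact
  interpret N: finite_measure N by fact
  interpret pair_sigma_finite M N ..
  have "integrable (M \<Otimes>\<^sub>M N) (\<lambda>(s, l). F s l)"
  proof (rule integrableI_bounded[OF meas])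
    have "(\<integral>\<^sup>+p. ennreal (norm (case p of (s, l) \<Rightarrow> F s l)) \<partial>(M \<Otimes>\<^sub>M N)) =
        (\<integral>\<^sup>+s. \<integral>\<^sup>+l. ennreal (norm (F s l)) \<partial>N \<partial>M)"
      using meas by (subst N.nn_integral_fst[symmetric]) auto
    also have "\<dots> \<le> (\<integral>\<^sup>+s. \<integral>\<^sup>+l. ennreal (norm (\<phi> l)) \<partial>N \<partial>M)"
      by (intro nn_integral_mono ennreal_leI) (use bound in force)
    also have "\<dots> = (\<integral>\<^sup>+l. ennreal (norm (\<phi> l)) \<partial>N) * emeasure M (space M)"
      by simp
    also have "\<dots> < \<infinity>"
    proof -
      have "(\<integral>\<^sup>+l. ennreal (norm (\<phi> l)) \<partial>N) < \<infinity>"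
        using \<phi> unfolding integrable_iff_bounded by auto
      moreover have "emeasure M (space M) < \<infinity>"
        unfolding infinity_ennreal_def less_top[symmetric] by simp
      ultimately show ?thesis by (simp add: ennreal_mult_less_top)
    qed
    finally show "(\<integral>\<^sup>+p. ennreal (norm (case p of (s, l) \<Rightarrow> F s l)) \<partial>(M \<Otimes>\<^sub>M N)) < \<infinity>" .
  qed
  from Fubini_integral[OF this] show ?thesis by simp
qed

text \<open>By \<open>2 x y \<le> x\<^sup>2 + y\<^sup>2\<close> the double integral is dominated by
  two row integrals, which agree by symmetry of \<open>\<kappa>\<close>. The kernel has values in
  \<open>ennreal\<close> so that it may be infinite on the diagonal.\<close>

lemma schur_test:
  fixes h :: "'a \<Rightarrow> real" and \<kappa> :: "'a \<Rightarrow> 'a \<Rightarrow> ennreal"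
  assumes "finite_measure M" and h [measurable]: "h \<in> borel_measurable M"
    and \<kappa> [measurable]: "(\<lambda>(s, s'). \<kappa> s s') \<in> borel_measurable (M \<Otimes>\<^sub>M M)"
    and sym: "\<And>s s'. \<kappa> s s' = \<kappa> s' s"
    and row: "\<And>s. s \<in> space M \<Longrightarrow> (\<integral>\<^sup>+s'. \<kappa> s s' \<partial>M) \<le> A"
  shows "(\<integral>\<^sup>+s. \<integral>\<^sup>+s'. ennreal \<bar>h s\<bar> * ennreal \<bar>h s'\<bar> * \<kappa> s s' \<partial>M \<partial>M) \<le> A * (\<integral>\<^sup>+s. ennreal ((h s)\<^sup>2) \<partial>M)"
proof -
  interpret M: finite_measure M by fact
  interpret pair_sigma_finite M M ..
  define X where "X = (\<integral>\<^sup>+s. \<integral>\<^sup>+s'. ennreal ((h s)\<^sup>2) * \<kappa> s s' \<partial>M \<partial>M)"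
  have X: "X \<le> A * (\<integral>\<^sup>+s. ennreal ((h s)\<^sup>2) \<partial>M)"
  proof -
    have "X = (\<integral>\<^sup>+s. ennreal ((h s)\<^sup>2) * (\<integral>\<^sup>+s'. \<kappa> s s' \<partial>M) \<partial>M)"
      unfolding X_def by (intro nn_integral_cong nn_integral_cmult) measurable
    also have "\<dots> \<le> (\<integral>\<^sup>+s. ennreal ((h s)\<^sup>2) * A \<partial>M)"
      by (intro nn_integral_mono mult_left_mono row) auto
    also have "\<dots> = A * (\<integral>\<^sup>+s. ennreal ((h s)\<^sup>2) \<partial>M)"
      by (subst nn_integral_multc) (auto simp: mult.commute)
    finally show ?thesis .
  qed
  have X': "(\<integral>\<^sup>+s. \<integral>\<^sup>+s'. ennreal ((h s')\<^sup>2) * \<kappa> s s' \<partial>M \<partial>M) = X"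
    unfolding X_def by (subst Fubini') (auto simp: sym)
  have "2 * (\<integral>\<^sup>+s. \<integral>\<^sup>+s'. ennreal \<bar>h s\<bar> * ennreal \<bar>h s'\<bar> * \<kappa> s s' \<partial>M \<partial>M)
      = (\<integral>\<^sup>+s. \<integral>\<^sup>+s'. 2 * (ennreal \<bar>h s\<bar> * ennreal \<bar>h s'\<bar> * \<kappa> s s') \<partial>M \<partial>M)"
  proof -
    have "(\<integral>\<^sup>+s'. 2 * (ennreal \<bar>h s\<bar> * ennreal \<bar>h s'\<bar> * \<kappa> s s') \<partial>M)
      = 2 * (\<integral>\<^sup>+s'. ennreal \<bar>h s\<bar> * ennreal \<bar>h s'\<bar> * \<kappa> s s' \<partial>M)" if "s \<in> space M" for s
      using that by (intro nn_integral_cmult) measurable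
    then have "(\<integral>\<^sup>+s. \<integral>\<^sup>+s'. 2 * (ennreal \<bar>h s\<bar> * ennreal \<bar>h s'\<bar> * \<kappa> s s') \<partial>M \<partial>M)
      = (\<integral>\<^sup>+s. 2 * (\<integral>\<^sup>+s'. ennreal \<bar>h s\<bar> * ennreal \<bar>h s'\<bar> * \<kappa> s s' \<partial>M) \<partial>M)"
      by (intro nn_integral_cong)
    also have "\<dots> = 2 * (\<integral>\<^sup>+s. \<integral>\<^sup>+s'. ennreal \<bar>h s\<bar> * ennreal \<bar>h s'\<bar> * \<kappa> s s' \<partial>M \<partial>M)"
      by (intro nn_integral_cmult) measurable
    finally show ?thesis ..
  qed
  also have "\<dots> \<le> (\<integral>\<^sup>+s. \<integral>\<^sup>+s'. ennreal ((h s)\<^sup>2) * \<kappa> s s' + ennreal ((h s')\<^sup>2) * \<kappa> s s' \<partial>M \<partial>M)"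
  proof (intro nn_integral_mono)
    fix s s'
    have "2 * \<bar>h s\<bar> * \<bar>h s'\<bar> \<le> (h s)\<^sup>2 + (h s')\<^sup>2"
      using sum_squares_bound[of "\<bar>h s\<bar>" "\<bar>h s'\<bar>"] by simp
    then have "ennreal (2 * \<bar>h s\<bar> * \<bar>h s'\<bar>) \<le> ennreal ((h s)\<^sup>2 + (h s')\<^sup>2)" by (rule ennreal_leI)
    then have "ennreal (2 * \<bar>h s\<bar> * \<bar>h s'\<bar>) * \<kappa> s s' \<le> ennreal ((h s)\<^sup>2 + (h s')\<^sup>2) * \<kappa> s s'"
      by (rule mult_right_mono) simp
    then show "2 * (ennreal \<bar>h s\<bar> * ennreal \<bar>h s'\<bar> * \<kappa> s s') \<le> ennreal ((h s)\<^sup>2) * \<kappa> s s' + ennreal ((h s')\<^sup>2) * \<kappa> s s'"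
      by (simp add: ennreal_mult ennreal_plus distrib_right mult.assoc)
  qed
  also have "\<dots> = X + X"
  proof -
    have "(\<integral>\<^sup>+s'. ennreal ((h s)\<^sup>2) * \<kappa> s s' + ennreal ((h s')\<^sup>2) * \<kappa> s s' \<partial>M)
      = (\<integral>\<^sup>+s'. ennreal ((h s)\<^sup>2) * \<kappa> s s' \<partial>M) + (\<integral>\<^sup>+s'. ennreal ((h s')\<^sup>2) * \<kappa> s s' \<partial>M)" if "s \<in> space M" for s
      using that by (intro nn_integral_add) measurable
    then have "(\<integral>\<^sup>+s. \<integral>\<^sup>+s'. ennreal ((h s)\<^sup>2) * \<kappa> s s' + ennreal ((h s')\<^sup>2) * \<kappa> s s' \<partial>M \<partial>M)
      = (\<integral>\<^sup>+s. (\<integral>\<^sup>+s'. ennreal ((h s)\<^sup>2) * \<kappa> s s' \<partial>M) + (\<integral>\<^sup>+s'. ennreal ((h s')\<^sup>2) * \<kappa> s s' \<partial>M) \<partial>M)"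
      by (intro nn_integral_cong)
    also have "\<dots> = (\<integral>\<^sup>+s. \<integral>\<^sup>+s'. ennreal ((h s)\<^sup>2) * \<kappa> s s' \<partial>M \<partial>M) + (\<integral>\<^sup>+s. \<integral>\<^sup>+s'. ennreal ((h s')\<^sup>2) * \<kappa> s s' \<partial>M \<partial>M)"
      by (intro nn_integral_add) measurable
    finally show ?thesis unfolding X' X_def[symmetric] .
  qed
  also have "\<dots> = 2 * X" by (simp add: mult_2)
  also have "\<dots> \<le> 2 * (A * (\<integral>\<^sup>+s. ennreal ((h s)\<^sup>2) \<partial>M))"
    using X by (intro mult_left_mono) auto
  finally show ?thesis by (subst (asm) ennreal_mult_le_mult_iff) auto
qed

text \<open>Here \<open>h\<close> is the image of \<open>g\<close>, and \<open>S\<close> is the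
  conjugate of the adjoint applied to \<open>h\<close>. Pairing gives
  \<open>X\<^sup>2 \<le> G * Y\<close> by Cauchy-Schwarz, and Schur's test for the composed kernel
  gives \<open>Y \<le> A * X\<close>; cancelling \<open>X\<close> yields the claim. The bound
  \<open>B\<close> and the finiteness of the measures justify the exchanges of integrals and do not
  enter the final constant.\<close>

lemma TT_star_schur:
  fixes e :: "'a \<Rightarrow> 'b \<Rightarrow> complex" and g :: "'b \<Rightarrow> complex" and \<kappa> :: "'a \<Rightarrow> 'a \<Rightarrow> ennreal"
  assumes "finite_measure M" "finite_measure N"
    and e [measurable]: "(\<lambda>(s, l). e s l) \<in> borel_measurable (M \<Otimes>\<^sub>M N)"
    and bound: "\<And>s l. s \<in> space M \<Longrightarrow> l \<in> space N \<Longrightarrow> norm (e s l) \<le> B"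
    and g [measurable]: "g \<in> borel_measurable N"
    and g2: "integrable N (\<lambda>l. (norm (g l))\<^sup>2)"
    and \<kappa> [measurable]: "(\<lambda>(s, s'). \<kappa> s s') \<in> borel_measurable (M \<Otimes>\<^sub>M M)"
    and sym: "\<And>s s'. \<kappa> s s' = \<kappa> s' s"
    and row: "\<And>s. s \<in> space M \<Longrightarrow> (\<integral>\<^sup>+s'. \<kappa> s s' \<partial>M) \<le> A"
    and ker: "\<And>s s'. s \<in> space M \<Longrightarrow> s' \<in> space M \<Longrightarrow>
      ennreal (norm (\<integral>l. e s l * cnj (e s' l) \<partial>N)) \<le> \<kappa> s s'"
  shows "(\<integral>\<^sup>+s. ennreal ((norm (\<integral>l. e s l * g l \<partial>N))\<^sup>2) \<partial>M)
    \<le> A * (\<integral>\<^sup>+l. ennreal ((norm (g l))\<^sup>2) \<partial>N)"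
proof (cases "space M = {} \<or> space N = {}")
  case True
  then show ?thesis by (auto simp: nn_integral_empty Bochner_Integration.integral_empty)
next
  case False
  interpret M: finite_measure M by fact
  interpret N: finite_measure N by fact
  interpret MN: pair_sigma_finite M N ..
  obtain s0 l0 where "s0 \<in> space M" "l0 \<in> space N" using False by auto
  then have "B \<ge> 0" using bound norm_ge_zero order_trans by blast
  have g1: "integrable N g"
  proof (rule N.square_integrable_imp_integrable[OF g])
    show "integrable N (\<lambda>l. (g l)\<^sup>2)"
      using g2 by (intro integrable_norm_cancel[of N "\<lambda>l. (g l)\<^sup>2"]) (auto simp: norm_power)
  qed
  define h where "h s = (\<integral>l. e s l * g l \<partial>N)" for s
  define K where "K = B * (\<integral>l. norm (g l) \<partial>N)"
  have h [measurable]: "h \<in> borel_measurable M" unfolding h_def[abs_def] by measurable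
  have hK: "norm (h s) \<le> K" if "s \<in> space M" for s
  proof -
    have "norm (h s) \<le> (\<integral>l. norm (e s l * g l) \<partial>N)" unfolding h_def by (rule integral_norm_bound)
    also have "\<dots> \<le> (\<integral>l. B * norm (g l) \<partial>N)"
      using g1 bound that \<open>B \<ge> 0\<close> by (intro integral_mono') (auto simp: norm_mult intro!: mult_mono)
    finally show ?thesis by (simp add: K_def)
  qed
  have "K \<ge> 0" using hK[OF \<open>s0 \<in> space M\<close>] norm_ge_zero order_trans by blast
  define S where "S l = (\<integral>s. e s l * cnj (h s) \<partial>M)" for l
  have S [measurable]: "S \<in> borel_measurable N" unfolding S_def[abs_def] by measurable
  have "integrable M (\<lambda>s. (norm (h s))\<^sup>2)"
    using hK by (intro M.integrable_const_bound[where B = "K\<^sup>2"]) (auto intro!: power_mono)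
  define X where "X = (\<integral>\<^sup>+s. ennreal ((norm (h s))\<^sup>2) \<partial>M)"
  have X: "X = ennreal (norm (\<integral>s. h s * cnj (h s) \<partial>M))" "X < \<infinity>"
  proof -
    have 1: "X = ennreal (\<integral>s. (norm (h s))\<^sup>2 \<partial>M)" 
      unfolding X_def using \<open>integrable M (\<lambda>s. (norm (h s))\<^sup>2)\<close> by (subst nn_integral_eq_integral) auto
    have "(\<integral>s. h s * cnj (h s) \<partial>M) = of_real (\<integral>s. (norm (h s))\<^sup>2 \<partial>M)"
      unfolding complex_norm_square[symmetric] of_real_power[symmetric] by (rule integral_complex_of_real)
    with 1 show "X = ennreal (norm (\<integral>s. h s * cnj (h s) \<partial>M))" by simp
    show "X < \<infinity>" using 1 by simp
  qed
  define G where "G = (\<integral>\<^sup>+l. ennreal ((norm (g l))\<^sup>2) \<partial>N)"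
  define Y where "Y = (\<integral>\<^sup>+l. ennreal ((norm (S l))\<^sup>2) \<partial>N)"
  have SB: "norm (S l) \<le> B * K * measure M (space M)" if "l \<in> space N" for l
  proof -
    have "norm (S l) \<le> (\<integral>s. norm (e s l * cnj (h s)) \<partial>M)" unfolding S_def by (rule integral_norm_bound)
    also have "\<dots> \<le> (\<integral>s. B * K \<partial>M)"
      using hK bound that \<open>B \<ge> 0\<close> \<open>K \<ge> 0\<close> by (intro integral_mono') (auto simp: norm_mult intro!: mult_mono)
    finally show ?thesis by (simp add: mult_ac)
  qed
  have "X\<^sup>2 \<le> G * Y"
  proof -
    have "(\<integral>s. h s * cnj (h s) \<partial>M) = (\<integral>s. \<integral>l. (e s l * g l) * cnj (h s) \<partial>N \<partial>M)"
      unfolding h_def by simp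
    also have "\<dots> = (\<integral>l. \<integral>s. (e s l * g l) * cnj (h s) \<partial>M \<partial>N)"
    proof (rule integral_swap_dominated[OF assms(1,2), where \<phi> = "\<lambda>l. B * norm (g l) * K"])
      fix s l assume "s \<in> space M" "l \<in> space N"
      then show "norm (e s l * g l * cnj (h s)) \<le> B * norm (g l) * K"
        using bound hK \<open>B \<ge> 0\<close> by (auto simp: norm_mult intro!: mult_mono)
    qed (use g1 in auto)
    also have "\<dots> = (\<integral>l. g l * S l \<partial>N)"
      unfolding S_def by (intro Bochner_Integration.integral_cong refl) (simp add: mult_ac flip: integral_mult_right_zero)
    finally have "X \<le> (\<integral>\<^sup>+l. ennreal (norm (g l * S l)) \<partial>N)"
      using X(1) norm_integral_le_nn_integral by metis
    also have "\<dots> = (\<integral>\<^sup>+l. ennreal (norm (g l)) * ennreal (norm (S l)) \<partial>N)"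
      by (simp add: norm_mult ennreal_mult)
    finally have "X\<^sup>2 \<le> (\<integral>\<^sup>+l. ennreal (norm (g l)) * ennreal (norm (S l)) \<partial>N)\<^sup>2"
      by (rule power_mono_ennreal)
    also have "\<dots> \<le> (\<integral>\<^sup>+l. (ennreal (norm (g l)))\<^sup>2 \<partial>N) * (\<integral>\<^sup>+l. (ennreal (norm (S l)))\<^sup>2 \<partial>N)"
      by (rule Cauchy_Schwarz_nn_integral) auto
    finally show ?thesis by (simp add: G_def Y_def ennreal_power)
  qed
  moreover have "Y \<le> A * X"
  proof -
    have intS: "integrable N (\<lambda>l. (norm (S l))\<^sup>2)"
      using SB by (intro N.integrable_const_bound[where B = "(B * K * measure M (space M))\<^sup>2"]) (auto intro!: power_mono)
    have 1: "Y = ennreal (\<integral>l. (norm (S l))\<^sup>2 \<partial>N)" 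
      unfolding Y_def using intS by (subst nn_integral_eq_integral) auto
    have 2: "(\<integral>l. S l * cnj (S l) \<partial>N) = of_real (\<integral>l. (norm (S l))\<^sup>2 \<partial>N)"
      unfolding complex_norm_square[symmetric] of_real_power[symmetric] by (rule integral_complex_of_real)
    have Y: "Y = ennreal (norm (\<integral>l. S l * cnj (S l) \<partial>N))"
      unfolding 1 2 by simp
    \<comment> \<open>Exchanging the integrals here exhibits the kernel of the operator composed
      with its adjoint.\<close>
    have inner: "(\<integral>l. e s l * cnj (S l) \<partial>N) = (\<integral>s'. h s' * (\<integral>l. e s l * cnj (e s' l) \<partial>N) \<partial>M)" if s: "s \<in> space M" for s
    proof -
      have "(\<integral>l. e s l * cnj (S l) \<partial>N) = (\<integral>l. \<integral>s'. e s l * cnj (e s' l) * h s' \<partial>M \<partial>N)"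
      proof (intro Bochner_Integration.integral_cong refl)
        fix l
        have "cnj (S l) = (\<integral>s'. cnj (e s' l * cnj (h s')) \<partial>M)"
          unfolding S_def by (rule Bochner_Integration.integral_cnj[symmetric])
        then show "e s l * cnj (S l) = (\<integral>s'. e s l * cnj (e s' l) * h s' \<partial>M)"
          by (simp add: mult.assoc del: Bochner_Integration.integral_cnj)
      qed
      also have "\<dots> = (\<integral>s'. \<integral>l. e s l * cnj (e s' l) * h s' \<partial>N \<partial>M)"
      proof (rule integral_swap_dominated[OF assms(1,2), where \<phi> = "\<lambda>l. B * B * K", symmetric])
        fix s' l assume "s' \<in> space M" "l \<in> space N"
        then show "norm (e s l * cnj (e s' l) * h s') \<le> B * B * K"
          using bound hK \<open>B \<ge> 0\<close> s by (auto simp: norm_mult intro!: mult_mono)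
      next
        show "(\<lambda>(s', l). e s l * cnj (e s' l) * h s') \<in> borel_measurable (M \<Otimes>\<^sub>M N)"
          using s by measurable
      qed simp
      finally show ?thesis by (simp add: mult.commute)
    qed
    have "(\<integral>l. S l * cnj (S l) \<partial>N) = (\<integral>l. \<integral>s. e s l * cnj (h s) * cnj (S l) \<partial>M \<partial>N)"
      unfolding S_def by simp
    also have "\<dots> = (\<integral>s. \<integral>l. e s l * cnj (h s) * cnj (S l) \<partial>N \<partial>M)"
    proof (rule integral_swap_dominated[OF assms(1,2), where \<phi> = "\<lambda>l. B * K * (B * K * measure M (space M))", symmetric])
      fix s l assume "s \<in> space M" "l \<in> space N"
      then show "norm (e s l * cnj (h s) * cnj (S l)) \<le> B * K * (B * K * measure M (space M))"
        using bound hK SB \<open>B \<ge> 0\<close> \<open>K \<ge> 0\<close> unfolding norm_mult complex_mod_cnj by (intro mult_mono) auto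
    qed auto
    also have "\<dots> = (\<integral>s. cnj (h s) * (\<integral>s'. h s' * (\<integral>l. e s l * cnj (e s' l) \<partial>N) \<partial>M) \<partial>M)"
    proof (intro Bochner_Integration.integral_cong refl)
      fix s assume s: "s \<in> space M"
      have "(\<integral>l. e s l * cnj (h s) * cnj (S l) \<partial>N) = (\<integral>l. cnj (h s) * (e s l * cnj (S l)) \<partial>N)"
        by (simp only: mult_ac)
      also have "\<dots> = cnj (h s) * (\<integral>l. e s l * cnj (S l) \<partial>N)"
        by (rule integral_mult_right_zero)
      finally show "(\<integral>l. e s l * cnj (h s) * cnj (S l) \<partial>N)
          = cnj (h s) * (\<integral>s'. h s' * (\<integral>l. e s l * cnj (e s' l) \<partial>N) \<partial>M)"
        unfolding inner[OF s] .
    qed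
    finally have "Y = ennreal (norm (\<integral>s. cnj (h s) * (\<integral>s'. h s' * (\<integral>l. e s l * cnj (e s' l) \<partial>N) \<partial>M) \<partial>M))"
      using Y by (simp only:)
    also have "\<dots> \<le> (\<integral>\<^sup>+s. ennreal (norm (cnj (h s) * (\<integral>s'. h s' * (\<integral>l. e s l * cnj (e s' l) \<partial>N) \<partial>M))) \<partial>M)"
      by (rule norm_integral_le_nn_integral)
    also have "\<dots> \<le> (\<integral>\<^sup>+s. \<integral>\<^sup>+s'. ennreal \<bar>norm (h s)\<bar> * ennreal \<bar>norm (h s')\<bar> * \<kappa> s s' \<partial>M \<partial>M)"
    proof (intro nn_integral_mono)
      fix s assume s: "s \<in> space M"
      have "ennreal (norm (\<integral>s'. h s' * (\<integral>l. e s l * cnj (e s' l) \<partial>N) \<partial>M))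
         \<le> (\<integral>\<^sup>+s'. ennreal (norm (h s' * (\<integral>l. e s l * cnj (e s' l) \<partial>N))) \<partial>M)"
        by (rule norm_integral_le_nn_integral)
      also have "\<dots> \<le> (\<integral>\<^sup>+s'. ennreal (norm (h s')) * \<kappa> s s' \<partial>M)"
        using ker[OF s] by (intro nn_integral_mono) (auto simp: norm_mult ennreal_mult intro!: mult_left_mono)
      finally have "ennreal (norm (h s)) * ennreal (norm (\<integral>s'. h s' * (\<integral>l. e s l * cnj (e s' l) \<partial>N) \<partial>M))
         \<le> ennreal (norm (h s)) * (\<integral>\<^sup>+s'. ennreal (norm (h s')) * \<kappa> s s' \<partial>M)"
        by (rule mult_left_mono) simp
      also have "\<dots> = (\<integral>\<^sup>+s'. ennreal (norm (h s)) * (ennreal (norm (h s')) * \<kappa> s s') \<partial>M)"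
        using s by (subst nn_integral_cmult) auto
      finally show "ennreal (norm (cnj (h s) * (\<integral>s'. h s' * (\<integral>l. e s l * cnj (e s' l) \<partial>N) \<partial>M)))
         \<le> (\<integral>\<^sup>+s'. ennreal \<bar>norm (h s)\<bar> * ennreal \<bar>norm (h s')\<bar> * \<kappa> s s' \<partial>M)"
        by (simp add: norm_mult ennreal_mult mult.assoc)
    qed
    also have "\<dots> \<le> A * (\<integral>\<^sup>+s. ennreal ((norm (h s))\<^sup>2) \<partial>M)"
      by (rule schur_test[OF assms(1) _ \<kappa> sym row]) auto
    finally show ?thesis by (simp add: X_def)
  qed
  ultimately have "X * X \<le> X * (A * G)"
    using mult_left_mono[of Y "A * X" G] by (auto simp: power2_eq_square mult_ac intro: order_trans)
  \<comment> \<open>Cancelling needs \<open>X\<close> finite, which holds because \<open>h\<close>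
    is bounded on a finite measure space.\<close>
  then have "X \<le> A * G"
    using X(2) by (cases "X = 0") (auto simp: ennreal_mult_le_mult_iff)
  then show ?thesis by (simp add: X_def G_def h_def)
qed

section \<open>The maximal operator\<close>

lemma measurable_chirp [measurable]:
  assumes [measurable]: "f \<in> borel_measurable M" "g \<in> borel_measurable M" "h \<in> borel_measurable M"
  shows "(\<lambda>x. chirp (f x) (g x) (h x)) \<in> borel_measurable M"
proof -
  have [measurable]: "cis \<in> borel_measurable borel"
    by (intro borel_measurable_continuous_onI continuous_intros)
  show ?thesis unfolding chirp_def by measurable
qed

lemma chirp_mult_cnj: "chirp a b x * cnj (chirp a' b' x) = chirp (a - a') (b - b') x"
  by (simp add: chirp_def cis_cnj cis_mult algebra_simps)

lemma nn_integral_inverse_sqrt_dist: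
  fixes u s v :: real
  assumes "u \<le> s" "s \<le> v"
  shows "(\<integral>\<^sup>+x. ennreal (1 / sqrt \<bar>s - x\<bar>) * indicator {u..<v} x \<partial>lborel) \<le> ennreal (4 * sqrt (v - u))"
proof -
  \<comment> \<open>The interior form of the fundamental theorem asks for the derivative only inside
    the interval, so the singularity may sit at the endpoint \<open>s\<close>.\<close>
  have 1: "((\<lambda>x. 1 / sqrt \<bar>s - x\<bar>) has_integral (- (2 * sqrt (s - s)) - - (2 * sqrt (s - u)))) {u..s}"
    by (rule fundamental_theorem_of_calculus_interior[OF assms(1)])
      (auto intro!: continuous_intros derivative_eq_intros simp: has_real_derivative_iff_has_vector_derivative[symmetric] field_simps)
  have 2: "((\<lambda>x. 1 / sqrt \<bar>s - x\<bar>) has_integral (2 * sqrt (v - s) - 2 * sqrt (s - s))) {s..v}"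
    by (rule fundamental_theorem_of_calculus_interior[OF assms(2)])
      (auto intro!: continuous_intros derivative_eq_intros simp: has_real_derivative_iff_has_vector_derivative[symmetric] field_simps)
  have "(\<integral>\<^sup>+x. ennreal (1 / sqrt \<bar>s - x\<bar>) * indicator {u..<v} x \<partial>lborel)
     \<le> (\<integral>\<^sup>+x. ennreal (1 / sqrt \<bar>s - x\<bar>) * indicator {u..s} x + ennreal (1 / sqrt \<bar>s - x\<bar>) * indicator {s..v} x \<partial>lborel)"
    by (intro nn_integral_mono) (auto split: split_indicator)
  also have "\<dots> = (\<integral>\<^sup>+x. ennreal (1 / sqrt \<bar>s - x\<bar>) * indicator {u..s} x \<partial>lborel)
      + (\<integral>\<^sup>+x. ennreal (1 / sqrt \<bar>s - x\<bar>) * indicator {s..v} x \<partial>lborel)"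
    by (rule nn_integral_add) measurable
  also have "\<dots> = ennreal (2 * sqrt (s - u)) + ennreal (2 * sqrt (v - s))"
    using nn_integral_has_integral_lebesgue'[OF _ 1] nn_integral_has_integral_lebesgue'[OF _ 2] by simp
  also have "\<dots> = ennreal (2 * sqrt (s - u) + 2 * sqrt (v - s))"
    using assms by (simp add: ennreal_plus)
  also have "\<dots> \<le> ennreal (4 * sqrt (v - u))"
    using assms real_sqrt_le_mono[of "s - u" "v - u"] real_sqrt_le_mono[of "v - s" "v - u"]
    by (intro ennreal_leI) linarith
  finally show ?thesis .
qed

text \<open>The model operator at one radius \<open>a\<close> and one time \<open>b\<close>. Its
  input \<open>g\<close> has absorbed the Sobolev weight, which leaves the factor
  \<open>l powr (- 1 / 4)\<close>.\<close>

definition chirp_transform :: "real \<Rightarrow> (real \<Rightarrow> complex) \<Rightarrow> real \<Rightarrow> real \<Rightarrow> complex" where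
  "chirp_transform R g a b =
    (LINT l:{1..R}|lborel. of_real (l powr (- 1 / 4)) * chirp a b l * g l)"

definition chirp_const :: "real \<Rightarrow> real" where
  "chirp_const c = 28 / sqrt c + 11 / sqrt (sqrt c)"

text \<open>Separation of order \<open>d\<close> in \<open>a\<close> and of order
  \<open>d\<^sup>2\<close> in \<open>b\<close> give the same power of \<open>d\<close>, so the sum
  of the two constants covers both alternatives.\<close>

lemma chirp_weighted_separated:
  assumes "c > 0" "d > 0" "R \<ge> 1" and sep: "c * d \<le> \<bar>a\<bar> \<or> c * d\<^sup>2 \<le> \<bar>b\<bar>"
  shows "norm (chirp_weighted a b 1 R) \<le> chirp_const c * (1 / sqrt d)"
proof -
  have pos: "28 / sqrt c / sqrt d \<ge> 0" "11 / sqrt (sqrt c) / sqrt d \<ge> 0" using assms by auto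
  have "norm (chirp_weighted a b 1 R) \<le> 28 / sqrt c / sqrt d + 11 / sqrt (sqrt c) / sqrt d"
    using sep
  proof
    assume *: "c * d \<le> \<bar>a\<bar>"
    have "0 < c * d" using assms by simp
    have "0 < \<bar>a\<bar>" using * \<open>0 < c * d\<close> by linarith
    then have "norm (chirp_weighted a b 1 R) \<le> 28 / sqrt \<bar>a\<bar>"
      using assms by (intro chirp_weighted_bound_linear) auto
    also have "\<dots> \<le> 28 / sqrt (c * d)"
      using assms * \<open>0 < c * d\<close> \<open>0 < \<bar>a\<bar>\<close> by (intro divide_left_mono mult_pos_pos real_sqrt_le_mono real_sqrt_gt_zero) auto
    also have "\<dots> = 28 / sqrt c / sqrt d" by (simp add: real_sqrt_mult)
    finally show ?thesis using pos by linarith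
  next
    assume *: "c * d\<^sup>2 \<le> \<bar>b\<bar>"
    have "0 < c * d\<^sup>2" using assms by simp
    have "0 < \<bar>b\<bar>" using * \<open>0 < c * d\<^sup>2\<close> by linarith
    then have "norm (chirp_weighted a b 1 R) \<le> 11 / sqrt (sqrt \<bar>b\<bar>)"
      using assms by (intro chirp_weighted_bound_quadratic) auto
    also have "\<dots> \<le> 11 / sqrt (sqrt (c * d\<^sup>2))"
      using assms * \<open>0 < c * d\<^sup>2\<close> \<open>0 < \<bar>b\<bar>\<close> by (intro divide_left_mono mult_pos_pos real_sqrt_le_mono real_sqrt_gt_zero) auto
    also have "\<dots> = 11 / sqrt (sqrt c) / sqrt d" using assms by (simp add: real_sqrt_mult)
    finally show ?thesis using pos by linarith
  qed
  then show ?thesis by (simp add: chirp_const_def algebra_simps)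
qed

lemma chirp_kernel:
  assumes "R \<ge> 1"
  shows "(LINT l:{1..R}|lborel. (of_real (l powr (- 1 / 4)) * chirp a b l) * cnj (of_real (l powr (- 1 / 4)) * chirp a' b' l))
    = chirp_weighted (a - a') (b - b') 1 R"
proof -
  have "(LINT l:{1..R}|lborel. (of_real (l powr (- 1 / 4)) * chirp a b l) * cnj (of_real (l powr (- 1 / 4)) * chirp a' b' l))
    = (LINT l:{1..R}|lborel. (1 / sqrt l) *\<^sub>R chirp (a - a') (b - b') l)"
  proof (rule set_lebesgue_integral_cong)
    show "\<forall>l. l \<in> {1..R} \<longrightarrow> (of_real (l powr (- 1 / 4)) * chirp a b l) * cnj (of_real (l powr (- 1 / 4)) * chirp a' b' l)
      = (1 / sqrt l) *\<^sub>R chirp (a - a') (b - b') l"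
    proof (intro allI impI)
      fix l assume "l \<in> {1..R}"
      then have "l powr (- 1 / 4) * l powr (- 1 / 4) = 1 / sqrt l"
        by (simp add: powr_add[symmetric] powr_minus powr_half_sqrt inverse_eq_divide)
      then show "(of_real (l powr (- 1 / 4)) * chirp a b l) * cnj (of_real (l powr (- 1 / 4)) * chirp a' b' l)
      = (1 / sqrt l) *\<^sub>R chirp (a - a') (b - b') l"
        unfolding chirp_mult_cnj[symmetric] scaleR_conv_of_real
        by (simp only: complex_cnj_mult complex_cnj_complex_of_real mult_ac flip: of_real_mult)
    qed
  qed simp
  also have "\<dots> = chirp_weighted (a - a') (b - b') 1 R"
    unfolding chirp_weighted_def
    by (intro set_borel_integral_eq_integral borel_integrable_atLeastAtMost' continuous_intros) auto
  finally show ?thesis .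
qed

text \<open>With the time frozen to a measurable function of \<open>s\<close>, only the separation
  of the points \<open>(r s, \<tau> s)\<close> matters. The constant involves neither
  \<open>R\<close> nor the choice of times.\<close>

lemma chirp_transform_linearized:
  fixes r \<tau> :: "real \<Rightarrow> real" and g :: "real \<Rightarrow> complex"
  assumes [measurable]: "r \<in> borel_measurable borel" "\<tau> \<in> borel_measurable borel" "g \<in> borel_measurable borel"
    and "c > 0" "R \<ge> 1"
    and sep: "\<And>s s'. s \<in> {u..<v} \<Longrightarrow> s' \<in> {u..<v} \<Longrightarrow>
        c * \<bar>s - s'\<bar> \<le> \<bar>r s - r s'\<bar> \<or> c * \<bar>s - s'\<bar>\<^sup>2 \<le> \<bar>\<tau> s - \<tau> s'\<bar>"
    and fin: "(\<integral>\<^sup>+l. ennreal ((norm (g l))\<^sup>2) * indicator {1..R} l \<partial>lborel) < \<infinity>"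
  shows "(\<integral>\<^sup>+s. ennreal ((norm (chirp_transform R g (r s) (\<tau> s)))\<^sup>2) * indicator {u..<v} s \<partial>lborel)
    \<le> ennreal (chirp_const c * (4 * sqrt (v - u))) * (\<integral>\<^sup>+l. ennreal ((norm (g l))\<^sup>2) * indicator {1..R} l \<partial>lborel)"
proof -
  define M where "M = restrict_space lborel {u..<v}"
  define N where "N = restrict_space lborel {1..R}"
  define e where "e s l = of_real (l powr (- 1 / 4)) * chirp (r s) (\<tau> s) l" for s l :: real
  \<comment> \<open>On the diagonal the separation says nothing, and \<open>1 / sqrt 0\<close> would
    be \<open>0\<close> and not bound the kernel. The value infinity is safe there and is invisible
    to the row integrals.\<close>
  define \<kappa> where "\<kappa> s s' = (if s = s' then \<infinity> else ennreal (chirp_const c * (1 / sqrt \<bar>s - s'\<bar>)))" for s s' :: real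
  have fM: "finite_measure M" and fN: "finite_measure N"
    unfolding M_def N_def
    using emeasure_bounded_finite[of "{u..<v}"] emeasure_bounded_finite[of "{1..R}"]
    by (auto intro!: finite_measureI simp: emeasure_restrict_space space_restrict_space)
  have sp: "space M = {u..<v}" "space N = {1..R}" by (simp_all add: M_def N_def space_restrict_space)
  have idM: "(\<lambda>x. x) \<in> M \<rightarrow>\<^sub>M borel" and idN: "(\<lambda>x. x) \<in> N \<rightarrow>\<^sub>M borel"
    unfolding M_def N_def by (auto intro!: measurable_restrict_space1)
  have f [measurable]: "fst \<in> M \<Otimes>\<^sub>M A \<rightarrow>\<^sub>M borel" for A :: "real measure"
    by (rule measurable_compose[OF measurable_fst idM])
  have g1 [measurable]: "snd \<in> A \<Otimes>\<^sub>M N \<rightarrow>\<^sub>M borel" for A :: "real measure"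
    by (rule measurable_compose[OF measurable_snd idN])
  have g2 [measurable]: "snd \<in> A \<Otimes>\<^sub>M M \<rightarrow>\<^sub>M borel" for A :: "real measure"
    by (rule measurable_compose[OF measurable_snd idM])
  have c0: "chirp_const c \<ge> 0" using \<open>c > 0\<close> by (simp add: chirp_const_def)
  have "(\<integral>\<^sup>+s. ennreal ((norm (\<integral>l. e s l * g l \<partial>N))\<^sup>2) \<partial>M)
    \<le> ennreal (chirp_const c * (4 * sqrt (v - u))) * (\<integral>\<^sup>+l. ennreal ((norm (g l))\<^sup>2) \<partial>N)"
  proof (rule TT_star_schur[OF fM fN])
    show "(\<lambda>(s, l). e s l) \<in> borel_measurable (M \<Otimes>\<^sub>M N)"
      unfolding e_def by measurable
    show "norm (e s l) \<le> 1" if "s \<in> space M" "l \<in> space N" for s l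
    proof -
      have "l powr (- 1 / 4) \<le> l powr 0" using that by (intro powr_mono) (auto simp: sp)
      then show ?thesis using that by (simp add: e_def norm_mult sp)
    qed
    show "g \<in> borel_measurable N" unfolding N_def by (auto intro!: measurable_restrict_space1)
    show "integrable N (\<lambda>l. (norm (g l))\<^sup>2)"
      unfolding integrable_iff_bounded using fin
      by (auto simp: N_def nn_integral_restrict_space intro!: measurable_restrict_space1)
    show "(\<lambda>(s, s'). \<kappa> s s') \<in> borel_measurable (M \<Otimes>\<^sub>M M)" unfolding \<kappa>_def by measurable
    show "\<kappa> s s' = \<kappa> s' s" for s s' by (simp add: \<kappa>_def abs_minus_commute)
    show "(\<integral>\<^sup>+s'. \<kappa> s s' \<partial>M) \<le> ennreal (chirp_const c * (4 * sqrt (v - u)))" if s: "s \<in> space M" for s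
    proof -
      have "(\<integral>\<^sup>+s'. \<kappa> s s' \<partial>M) = (\<integral>\<^sup>+s'. \<kappa> s s' * indicator {u..<v} s' \<partial>lborel)"
        unfolding M_def by (simp add: nn_integral_restrict_space)
      also have "\<dots> = (\<integral>\<^sup>+s'. ennreal (chirp_const c) * (ennreal (1 / sqrt \<bar>s - s'\<bar>) * indicator {u..<v} s') \<partial>lborel)"
      proof (rule nn_integral_cong_AE)
        show "AE s' in lborel. \<kappa> s s' * indicator {u..<v} s' = ennreal (chirp_const c) * (ennreal (1 / sqrt \<bar>s - s'\<bar>) * indicator {u..<v} s')"
          using AE_lborel_singleton[of s]
          by eventually_elim (auto simp: \<kappa>_def ennreal_mult'[OF c0, symmetric] split: split_indicator)
      qed
      also have "\<dots> = ennreal (chirp_const c) * (\<integral>\<^sup>+s'. ennreal (1 / sqrt \<bar>s - s'\<bar>) * indicator {u..<v} s' \<partial>lborel)"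
        by (rule nn_integral_cmult) measurable
      also have "\<dots> \<le> ennreal (chirp_const c) * ennreal (4 * sqrt (v - u))"
        using s by (intro mult_left_mono nn_integral_inverse_sqrt_dist) (auto simp: sp)
      also have "\<dots> = ennreal (chirp_const c * (4 * sqrt (v - u)))" using c0 s by (simp add: ennreal_mult sp)
      finally show ?thesis .
    qed
    show "ennreal (norm (\<integral>l. e s l * cnj (e s' l) \<partial>N)) \<le> \<kappa> s s'" if "s \<in> space M" "s' \<in> space M" for s s'
    proof (cases "s = s'")
      case False
      have "(\<integral>l. e s l * cnj (e s' l) \<partial>N) = chirp_weighted (r s - r s') (\<tau> s - \<tau> s') 1 R"
        unfolding chirp_kernel[OF \<open>R \<ge> 1\<close>, symmetric] e_def N_def set_lebesgue_integral_def
        by (rule integral_restrict_space) simp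
      then show ?thesis
        using chirp_weighted_separated[OF \<open>c > 0\<close> _ \<open>R \<ge> 1\<close> sep, of s s'] that False
        by (auto simp: \<kappa>_def sp intro!: ennreal_leI)
    qed (simp add: \<kappa>_def)
  qed
  moreover have "(\<integral>l. e s l * g l \<partial>N) = chirp_transform R g (r s) (\<tau> s)" for s
    unfolding chirp_transform_def e_def N_def set_lebesgue_integral_def
    by (rule integral_restrict_space) simp
  ultimately show ?thesis by (simp add: M_def N_def nn_integral_restrict_space)
qed

section \<open>From measurable choices of times to the supremum\<close>

text \<open>\<open>\<tau> N s\<close> is a best time among \<open>d 0, ..., d N\<close>, replaced
  only on strict improvement. A finite selection of this kind is measurable in \<open>s\<close>, and
  monotone convergence in \<open>N\<close> then reaches the supremum over the whole
  sequence.\<close>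

lemma measurable_running_maximizer:
  fixes \<Phi> :: "real \<Rightarrow> real \<Rightarrow> real" and d :: "nat \<Rightarrow> real"
  assumes [measurable]: "(\<lambda>(s, t). \<Phi> s t) \<in> borel_measurable (borel \<Otimes>\<^sub>M borel)"
  obtains \<tau> where "\<And>N. \<tau> N \<in> borel_measurable borel" "\<And>N s. \<tau> N s \<in> range d"
    "\<And>N s. \<Phi> s (d N) \<le> \<Phi> s (\<tau> N s)" "\<And>s. incseq (\<lambda>N. \<Phi> s (\<tau> N s))"
proof -
  define \<tau> where "\<tau> = rec_nat (\<lambda>_. d 0) (\<lambda>N \<sigma> s. if \<Phi> s (\<sigma> s) < \<Phi> s (d (Suc N)) then d (Suc N) else \<sigma> s)"
  have \<tau>0: "\<tau> 0 = (\<lambda>_. d 0)" by (simp add: \<tau>_def)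
  have \<tau>S: "\<tau> (Suc N) = (\<lambda>s. if \<Phi> s (\<tau> N s) < \<Phi> s (d (Suc N)) then d (Suc N) else \<tau> N s)" for N
    unfolding \<tau>_def nat.rec(2) by (rule refl)
  have 1: "\<tau> N \<in> borel_measurable borel" for N
  proof (induction N)
    case (Suc N)
    note Suc [measurable]
    show ?case unfolding \<tau>S by measurable
  qed (simp add: \<tau>0)
  have 2: "\<tau> N s \<in> range d" for N s
    by (induction N) (auto simp: \<tau>0 \<tau>S)
  have 3: "\<Phi> s (d N) \<le> \<Phi> s (\<tau> N s)" for N s
    by (cases N) (auto simp: \<tau>0 \<tau>S)
  have 4: "incseq (\<lambda>N. \<Phi> s (\<tau> N s))" for s
    by (rule incseq_SucI) (auto simp: \<tau>S)
  show thesis using that 1 2 3 4 by blast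
qed

text \<open>Square integrable functions are integrable on a set of finite measure; this is what the
  cut-off \<open>R\<close> provides.\<close>

lemma set_integrable_of_square:
  fixes g :: "real \<Rightarrow> complex"
  assumes [measurable]: "g \<in> borel_measurable borel"
    and fin: "(\<integral>\<^sup>+l. ennreal ((norm (g l))\<^sup>2) * indicator {1..R} l \<partial>lborel) < \<infinity>"
  shows "set_integrable lborel {1..R} g"
proof -
  define N where "N = restrict_space lborel {1..R}"
  interpret N: finite_measure N
    unfolding N_def using emeasure_bounded_finite[of "{1..R}"]
    by (auto intro!: finite_measureI simp: emeasure_restrict_space space_restrict_space)
  have g: "g \<in> borel_measurable N" unfolding N_def by (auto intro!: measurable_restrict_space1)
  then have "integrable N (\<lambda>l. (g l)\<^sup>2)"
    unfolding integrable_iff_bounded using fin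
    by (auto simp: N_def nn_integral_restrict_space norm_power)
  from N.square_integrable_imp_integrable[OF g this]
  show ?thesis unfolding N_def set_integrable_def by (subst (asm) integrable_restrict_space) auto
qed

text \<open>Dominated convergence, with \<open>g\<close> itself as majorant because the weight is at
  most \<open>1\<close> for \<open>l \<ge> 1\<close>. Continuity in radius and time lets a countable
  dense set of times stand for all of them.\<close>

lemma tendsto_chirp_transform:
  fixes g :: "real \<Rightarrow> complex"
  assumes [measurable]: "g \<in> borel_measurable borel"
    and g: "set_integrable lborel {1..R} g"
    and a: "a \<longlonglongrightarrow> a0" and b: "b \<longlonglongrightarrow> b0"
  shows "(\<lambda>k. chirp_transform R g (a k) (b k)) \<longlonglongrightarrow> chirp_transform R g a0 b0"
  unfolding chirp_transform_def set_lebesgue_integral_def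
proof (rule integral_dominated_convergence)
  show "integrable lborel (\<lambda>l. norm (indicator {1..R} l *\<^sub>R g l))"
    using g unfolding set_integrable_def by (rule integrable_norm)
  show "AE l in lborel. (\<lambda>k. indicator {1..R} l *\<^sub>R (of_real (l powr (- 1 / 4)) * chirp (a k) (b k) l * g l))
      \<longlonglongrightarrow> indicator {1..R} l *\<^sub>R (of_real (l powr (- 1 / 4)) * chirp a0 b0 l * g l)"
    unfolding chirp_def by (intro always_eventually allI tendsto_intros a b)
  show "AE l in lborel. norm (indicator {1..R} l *\<^sub>R (of_real (l powr (- 1 / 4)) * chirp (a k) (b k) l * g l))
      \<le> norm (indicator {1..R} l *\<^sub>R g l)" for k
  proof (intro always_eventually allI)
    fix l :: real
    have "l powr (- 1 / 4) \<le> l powr 0" if "l \<in> {1..R}" using that by (intro powr_mono) auto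
    then show "norm (indicator {1..R} l *\<^sub>R (of_real (l powr (- 1 / 4)) * chirp (a k) (b k) l * g l))
      \<le> norm (indicator {1..R} l *\<^sub>R g l)"
      by (auto simp: norm_mult mult_left_le_one_le split: split_indicator)
  qed
qed measurable

text \<open>A maximal estimate over a possibly non-measurable supremum is phrased through a
  measurable majorant \<open>W\<close> of the square.\<close>

lemma chirp_transform_maximal:
  fixes \<rho> :: "real \<Rightarrow> real \<Rightarrow> real" and g :: "real \<Rightarrow> complex"
  assumes cont: "continuous_on ({u..<v} \<times> {- T..T}) (\<lambda>(s, t). \<rho> s t)"
    and [measurable]: "g \<in> borel_measurable borel"
    and "c > 0" "R \<ge> 1" "T \<ge> 0"
    and sep: "\<And>s s' t t'. s \<in> {u..<v} \<Longrightarrow> s' \<in> {u..<v} \<Longrightarrow> t \<in> {- T..T} \<Longrightarrow> t' \<in> {- T..T} \<Longrightarrow>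
        c * \<bar>s - s'\<bar> \<le> \<bar>\<rho> s t - \<rho> s' t'\<bar> \<or> c * \<bar>s - s'\<bar>\<^sup>2 \<le> \<bar>t - t'\<bar>"
    and fin: "(\<integral>\<^sup>+l. ennreal ((norm (g l))\<^sup>2) * indicator {1..R} l \<partial>lborel) < \<infinity>"
  obtains W where "W \<in> borel_measurable borel"
    "\<And>s t. s \<in> {u..<v} \<Longrightarrow> t \<in> {- T..T} \<Longrightarrow> ennreal ((norm (chirp_transform R g (\<rho> s t) t))\<^sup>2) \<le> W s"
    "(\<integral>\<^sup>+s. W s * indicator {u..<v} s \<partial>lborel) \<le>
      ennreal (chirp_const c * (4 * sqrt (v - u))) * (\<integral>\<^sup>+l. ennreal ((norm (g l))\<^sup>2) * indicator {1..R} l \<partial>lborel)"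
proof -
  define A where "A = ennreal (chirp_const c * (4 * sqrt (v - u))) * (\<integral>\<^sup>+l. ennreal ((norm (g l))\<^sup>2) * indicator {1..R} l \<partial>lborel)"
  \<comment> \<open>Extension by \<open>0\<close> makes the radius a Borel function on the whole
    plane, as measurability on the product space requires.\<close>
  define \<rho>' where "\<rho>' s t = (if (s, t) \<in> {u..<v} \<times> {- T..T} then \<rho> s t else 0)" for s t
  have "(\<lambda>p. if p \<in> {u..<v} \<times> {- T..T} then (\<lambda>(s, t). \<rho> s t) p else 0) \<in> borel_measurable borel"
  proof (rule borel_measurable_continuous_on_if[OF _ cont])
    have "{u..<v} \<times> {- T..T} \<in> sets (borel \<Otimes>\<^sub>M borel)" by (rule pair_measureI) auto
    then show "{u..<v} \<times> {- T..T} \<in> sets borel" unfolding borel_prod .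
  qed simp
  then have [measurable]: "(\<lambda>(s, t). \<rho>' s t) \<in> borel_measurable (borel \<Otimes>\<^sub>M borel)"
    unfolding borel_prod by (rule back_subst[of "\<lambda>f. f \<in> borel_measurable borel"]) (auto simp: \<rho>'_def fun_eq_iff)
  define \<Phi> where "\<Phi> s t = (norm (chirp_transform R g (\<rho>' s t) t))\<^sup>2" for s t
  have \<Phi> [measurable]: "(\<lambda>(s, t). \<Phi> s t) \<in> borel_measurable (borel \<Otimes>\<^sub>M borel)"
    unfolding \<Phi>_def chirp_transform_def set_lebesgue_integral_def by measurable
  obtain D where D: "countable D" "D \<subseteq> {- T..T}" "{- T..T} \<subseteq> closure D"
    by (rule separable)
  have "D \<noteq> {}" using D \<open>T \<ge> 0\<close> by auto
  define d where "d = from_nat_into D"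
  have d: "range d = D" using D \<open>D \<noteq> {}\<close> by (simp add: d_def range_from_nat_into)
  obtain \<tau> where \<tau>: "\<And>N. \<tau> N \<in> borel_measurable borel" "\<And>N s. \<tau> N s \<in> range d"
    "\<And>N s. \<Phi> s (d N) \<le> \<Phi> s (\<tau> N s)" "\<And>s. incseq (\<lambda>N. \<Phi> s (\<tau> N s))"
    using measurable_running_maximizer[OF \<Phi>, of d] by metis
  note \<tau>(1) [measurable]
  have \<tau>T: "\<tau> N s \<in> {- T..T}" for N s using \<tau>(2)[of N s] D d by blast
  define W where "W s = (SUP N. ennreal (\<Phi> s (\<tau> N s)))" for s
  have "W \<in> borel_measurable borel" unfolding W_def by measurable
  moreover have "ennreal ((norm (chirp_transform R g (\<rho> s t) t))\<^sup>2) \<le> W s"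
    if s: "s \<in> {u..<v}" and t: "t \<in> {- T..T}" for s t
  proof -
    \<comment> \<open>\<open>W\<close> controls the times in \<open>D\<close> only; an arbitrary
      \<open>t\<close> is reached as a limit from \<open>D\<close>.\<close>
    obtain x where x: "\<And>k. x k \<in> D" "x \<longlonglongrightarrow> t"
      using D(3) t closure_sequential[of t D] by auto
    have xT: "x k \<in> {- T..T}" for k using x D by blast
    have "continuous_on {- T..T} (\<lambda>t. (\<lambda>(s, t). \<rho> s t) (s, t))"
      by (rule continuous_on_compose2[OF cont]) (use s in \<open>auto intro!: continuous_intros\<close>)
    then have "(\<lambda>k. \<rho> s (x k)) \<longlonglongrightarrow> \<rho> s t"
      using continuous_on_tendsto_compose[OF _ x(2) t] xT by fastforce
    then have "(\<lambda>k. chirp_transform R g (\<rho> s (x k)) (x k)) \<longlonglongrightarrow> chirp_transform R g (\<rho> s t) t"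
      by (intro tendsto_chirp_transform set_integrable_of_square fin x) auto
    then have lim: "(\<lambda>k. ennreal ((norm (chirp_transform R g (\<rho> s (x k)) (x k)))\<^sup>2)) \<longlonglongrightarrow> ennreal ((norm (chirp_transform R g (\<rho> s t) t))\<^sup>2)"
      by (intro tendsto_intros)
    show ?thesis
    proof (rule LIMSEQ_le_const2[OF lim], intro exI allI impI)
      fix k
      obtain n where n: "x k = d n" using x(1)[of k] d by auto
      have "ennreal ((norm (chirp_transform R g (\<rho> s (x k)) (x k)))\<^sup>2) = ennreal (\<Phi> s (d n))"
        using s xT[of k] by (simp add: \<Phi>_def \<rho>'_def n)
      also have "\<dots> \<le> ennreal (\<Phi> s (\<tau> n s))" by (intro ennreal_leI \<tau>)
      also have "\<dots> \<le> W s" unfolding W_def by (rule SUP_upper) simp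
      finally show "ennreal ((norm (chirp_transform R g (\<rho> s (x k)) (x k)))\<^sup>2) \<le> W s" .
    qed
  qed
  moreover have "(\<integral>\<^sup>+s. W s * indicator {u..<v} s \<partial>lborel) \<le> A"
  proof -
    have "(\<integral>\<^sup>+s. W s * indicator {u..<v} s \<partial>lborel)
        = (\<integral>\<^sup>+s. (SUP N. ennreal (\<Phi> s (\<tau> N s)) * indicator {u..<v} s) \<partial>lborel)"
      unfolding W_def by (intro nn_integral_cong) (simp split: split_indicator)
    also have "\<dots> = (SUP N. \<integral>\<^sup>+s. ennreal (\<Phi> s (\<tau> N s)) * indicator {u..<v} s \<partial>lborel)"
    proof (rule nn_integral_monotone_convergence_SUP)
      show "incseq (\<lambda>N s. ennreal (\<Phi> s (\<tau> N s)) * indicator {u..<v} s)"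
        using \<tau>(4) by (auto simp: incseq_def le_fun_def intro!: mult_right_mono ennreal_leI)
    qed measurable
    also have "\<dots> \<le> A"
    proof (rule SUP_least)
      fix N
      show "(\<integral>\<^sup>+s. ennreal (\<Phi> s (\<tau> N s)) * indicator {u..<v} s \<partial>lborel) \<le> A"
        unfolding \<Phi>_def A_def
      proof (rule chirp_transform_linearized)
        show "(\<lambda>s. \<rho>' s (\<tau> N s)) \<in> borel_measurable borel" by measurable
        fix s s' assume "s \<in> {u..<v}" "s' \<in> {u..<v}"
        then show "c * \<bar>s - s'\<bar> \<le> \<bar>\<rho>' s (\<tau> N s) - \<rho>' s' (\<tau> N s')\<bar> \<or> c * \<bar>s - s'\<bar>\<^sup>2 \<le> \<bar>\<tau> N s - \<tau> N s'\<bar>"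
          using sep[of s s' "\<tau> N s" "\<tau> N s'"] \<tau>T by (simp add: \<rho>'_def)
      qed (use assms in auto)
    qed
    finally show ?thesis .
  qed
  ultimately show thesis using that unfolding A_def by blast
qed

section \<open>From the propagator to the maximal operator\<close>

lemma measurable_bessel_norm [measurable]: "bessel_norm \<mu> \<in> borel_measurable borel"
  unfolding bessel_norm_def[abs_def] bessel_J_def by measurable

lemma measurable_spherical_fourier:
  fixes f :: "'a::euclidean_space \<Rightarrow> complex"
  assumes "schwartz f"
  shows "spherical_fourier f \<in> borel_measurable borel"
proof -
  have "f differentiable (at x)" for x
    using assms unfolding schwartz_def by (auto dest: spec[of _ "[]"])
  then have f [measurable]: "f \<in> borel_measurable borel"
    by (intro borel_measurable_continuous_onI continuous_at_imp_continuous_on ballI differentiable_imp_continuous_within)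
  have [measurable]: "radial_profile f \<in> borel_measurable borel"
    unfolding radial_profile_def[abs_def] by measurable
  show ?thesis unfolding spherical_fourier_def[abs_def] set_lebesgue_integral_def by measurable
qed

text \<open>For \<open>x\<close> between \<open>x0\<close> and \<open>X\<close>, a frequency
  \<open>l \<ge> 1\<close> puts the argument beyond \<open>x0\<close>, where the asymptotics hold,
  and a frequency \<open>l \<le> 1\<close> puts it in the compact set \<open>{0..X}\<close>. One
  constant \<open>C\<close> therefore serves all radii in the range.\<close>

lemma bessel_norm_main_term:
  fixes x0 X :: real
  assumes "\<mu> \<ge> 0" "0 < x0"
  defines "m \<equiv> \<mu> + 1/2"
  obtains A B C where "C \<ge> 0"
    "\<And>x l. x0 \<le> x \<Longrightarrow> x \<le> X \<Longrightarrow> 1 \<le> l \<Longrightarrow>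
      \<bar>bessel_norm \<mu> (l * x) - (l * x) powr (- m) * (A * cos (l * x) + B * sin (l * x))\<bar> \<le> C * l powr (- m - 1)"
    "\<And>x l. x0 \<le> x \<Longrightarrow> x \<le> X \<Longrightarrow> 0 \<le> l \<Longrightarrow> l \<le> 1 \<Longrightarrow> \<bar>bessel_norm \<mu> (l * x)\<bar> \<le> C"
proof -
  obtain A B C where C: "\<And>z. z \<ge> x0 \<Longrightarrow> \<bar>bessel_norm \<mu> z - z powr (- m) * (A * cos z + B * sin z)\<bar> \<le> C * z powr (- m - 1)"
    using bessel_norm_asymptotics[OF assms(1,2)] unfolding m_def by metis
  have "compact (bessel_norm \<mu> ` {0..X})"
    by (intro compact_continuous_image continuous_on_subset[OF continuous_on_bessel_norm[OF assms(1)]]) auto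
  then obtain C' where "\<forall>y \<in> bessel_norm \<mu> ` {0..X}. norm y \<le> C'"
    using compact_imp_bounded[of "bessel_norm \<mu> ` {0..X}"] unfolding bounded_iff by blast
  then have C': "\<bar>bessel_norm \<mu> z\<bar> \<le> C'" if "z \<in> {0..X}" for z
    using that by auto
  define D where "D = \<bar>C\<bar> * x0 powr (- m - 1) + \<bar>C'\<bar>"
  show thesis
  proof (rule that[of D A B])
    show "D \<ge> 0" by (simp add: D_def)
  next
    fix x l :: real assume x: "x0 \<le> x" "x \<le> X" "1 \<le> l"
    have "x0 * 1 \<le> l * x" using x assms by (subst mult.commute, intro mult_mono) auto
    then have "\<bar>bessel_norm \<mu> (l * x) - (l * x) powr (- m) * (A * cos (l * x) + B * sin (l * x))\<bar> \<le> C * (l * x) powr (- m - 1)"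
      by (intro C) simp
    also have "\<dots> \<le> \<bar>C\<bar> * (l powr (- m - 1) * x powr (- m - 1))"
      using x assms by (simp add: powr_mult mult_right_mono)
    also have "\<dots> \<le> \<bar>C\<bar> * (l powr (- m - 1) * x0 powr (- m - 1))"
      using x assms by (intro mult_left_mono powr_mono2') auto
    also have "\<dots> \<le> D * l powr (- m - 1)"
      by (simp add: D_def algebra_simps)
    finally show "\<bar>bessel_norm \<mu> (l * x) - (l * x) powr (- m) * (A * cos (l * x) + B * sin (l * x))\<bar> \<le> D * l powr (- m - 1)" .
  next
    fix x l :: real assume x: "x0 \<le> x" "x \<le> X" "0 \<le> l" "l \<le> 1"
    have "l * x \<le> 1 * X" using x assms by (intro mult_mono) auto
    then have "\<bar>bessel_norm \<mu> (l * x)\<bar> \<le> C'" using x assms by (intro C') auto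
    also have "\<dots> \<le> D" by (simp add: D_def add_increasing)
    finally show "\<bar>bessel_norm \<mu> (l * x)\<bar> \<le> D" .
  qed
qed

text \<open>The dimension and the transform are plain arguments here, so the estimates hold for a
  general measurable \<open>F\<close>, with constants chosen before \<open>F\<close>.\<close>

definition schroedinger_integrand ::
  "nat \<Rightarrow> (real \<Rightarrow> complex) \<Rightarrow> real \<Rightarrow> real \<Rightarrow> real \<Rightarrow> complex" where
  "schroedinger_integrand n F x t l =
    of_real (bessel_norm ((real n - 2) / 2) (l * x)) * exp (\<i> * of_real (t * l\<^sup>2)) * F l * of_real (l ^ (n - 1))"

definition hdot_integral :: "nat \<Rightarrow> (real \<Rightarrow> complex) \<Rightarrow> ennreal" where
  "hdot_integral n F = (\<integral>\<^sup>+ l \<in> {0..}. ennreal (l powr (1/2) * (cmod (F l))\<^sup>2 * l ^ (n - 1)) \<partial>lborel)"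

text \<open>The power is half of \<open>(n - 1) + 1/2\<close>, which makes the squared
  \<open>L\<^sup>2\<close> norm on the half-line equal to \<open>hdot_integral n F\<close>.\<close>

definition chirp_data :: "nat \<Rightarrow> (real \<Rightarrow> complex) \<Rightarrow> real \<Rightarrow> complex" where
  "chirp_data n F l = of_real (l powr (real (n - 1) / 2 + 1 / 4)) * F l"

lemma chirp_data_square:
  assumes "l \<ge> 0" "n \<ge> 2"
  shows "(norm (chirp_data n F l))\<^sup>2 = l powr (1/2) * (cmod (F l))\<^sup>2 * l ^ (n - 1)"
proof (cases "l = 0")
  case False
  then have l: "l > 0" using assms by simp
  have "(l powr (real (n - 1) / 2 + 1 / 4))\<^sup>2 = l powr (1/2) * l powr real (n - 1)"
    using l by (simp add: powr_add[symmetric] power2_eq_square add.commute)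
  then show ?thesis using l by (simp add: chirp_data_def norm_mult power_mult_distrib powr_realpow)
qed (use assms in \<open>simp add: chirp_data_def\<close>)

lemma chirp_data_integral_le:
  assumes "n \<ge> 2"
  shows "(\<integral>\<^sup>+l. ennreal ((norm (chirp_data n F l))\<^sup>2) * indicator {1..R} l \<partial>lborel) \<le> hdot_integral n F"
  unfolding hdot_integral_def using chirp_data_square[OF _ assms, of _ F]
  by (intro nn_integral_mono) (auto split: split_indicator)

lemma cos_sin_cis:
  "complex_of_real (A * cos z + B * sin z) = Complex (A / 2) (- B / 2) * cis z + Complex (A / 2) (B / 2) * cis (- z)"
  by (simp add: complex_eq_iff algebra_simps)

text \<open>Relative to \<open>chirp_data\<close>, low frequencies and the Bessel error together
  carry at most a constant times this weight; Cauchy-Schwarz uses its square integral, at most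
  \<open>1 + 1\<close>.\<close>

lemma error_weight_integral:
  "(\<integral>\<^sup>+l. (ennreal (if l \<ge> 1 then 1 / l else 1))\<^sup>2 * indicator {0..} l \<partial>lborel) \<le> 2"
proof -
  have "(\<integral>\<^sup>+l. (ennreal (if l \<ge> 1 then 1 / l else 1))\<^sup>2 * indicator {0..} l \<partial>lborel)
      \<le> (\<integral>\<^sup>+l. indicator {0..1} l + ennreal (1 / l\<^sup>2) * indicator {1..} l \<partial>(lborel :: real measure))"
    by (intro nn_integral_mono) (auto simp: ennreal_power power_divide split: split_indicator)
  also have "\<dots> = (\<integral>\<^sup>+l. indicator {0..1} l \<partial>(lborel :: real measure)) + (\<integral>\<^sup>+l. ennreal (1 / l\<^sup>2) * indicator {1..} l \<partial>(lborel :: real measure))"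
    by (subst nn_integral_add) auto
  also have "(\<integral>\<^sup>+l. ennreal (1 / l\<^sup>2) * indicator {1..} l \<partial>(lborel :: real measure)) = ennreal (0 - (- 1 / 1))"
  proof (rule nn_integral_FTC_atLeast[where F = "\<lambda>l. - 1 / l"])
    show "((\<lambda>l::real. - 1 / l) \<longlongrightarrow> 0) at_top"
      by (intro tendsto_divide_0[OF tendsto_const] filterlim_at_top_imp_at_infinity filterlim_ident)
    show "((\<lambda>l. - 1 / l) has_real_derivative 1 / x\<^sup>2) (at x)" if "1 \<le> x" for x :: real
      using that by (auto intro!: derivative_eq_intros simp: power2_eq_square)
  qed auto
  also have "(\<integral>\<^sup>+l. indicator {0..1} l \<partial>(lborel :: real measure)) = 1" by simp
  finally show ?thesis by (simp add: one_add_one)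
qed

lemma chirp_transform_set_integrable:
  assumes [measurable]: "g \<in> borel_measurable borel" and g: "set_integrable lborel {1..R} g"
  shows "set_integrable lborel {1..R} (\<lambda>l. of_real (l powr (- 1 / 4)) * chirp a b l * g l)"
  unfolding set_integrable_def
proof (rule Bochner_Integration.integrable_bound)
  show "integrable lborel (\<lambda>l. indicator {1..R} l *\<^sub>R g l)" using g unfolding set_integrable_def .
  show "AE l in lborel. norm (indicator {1..R} l *\<^sub>R (of_real (l powr (- 1 / 4)) * chirp a b l * g l))
      \<le> norm (indicator {1..R} l *\<^sub>R g l)"
  proof (intro always_eventually allI)
    fix l :: real
    have "l powr (- 1 / 4) \<le> l powr 0" if "l \<in> {1..R}" using that by (intro powr_mono) auto
    then show "norm (indicator {1..R} l *\<^sub>R (of_real (l powr (- 1 / 4)) * chirp a b l * g l))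
      \<le> norm (indicator {1..R} l *\<^sub>R g l)"
      by (auto simp: norm_mult mult_left_le_one_le split: split_indicator)
  qed
qed measurable

text \<open>With \<open>m = (n - 1) / 2\<close>, the power \<open>- m\<close> from Bessel decay and
  \<open>2 m\<close> from the volume element leave \<open>l powr m\<close>, which splits into the
  weight \<open>l powr (- 1 / 4)\<close> and the factor inside \<open>chirp_data\<close>. Writing
  cosine and sine as exponentials produces the two signs of the radius.\<close>

lemma schroedinger_main_term:
  fixes l x :: real
  assumes "l > 0" "x > 0" "n \<ge> 2"
  defines "m \<equiv> real (n - 1) / 2"
  shows "of_real ((l * x) powr (- m) * (A * cos (l * x) + B * sin (l * x))) * exp (\<i> * of_real (t * l\<^sup>2)) * F l * of_real (l ^ (n - 1))
    = of_real (x powr (- m)) * (Complex (A / 2) (- B / 2) * (of_real (l powr (- 1 / 4)) * chirp x t l * chirp_data n F l)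
      + Complex (A / 2) (B / 2) * (of_real (l powr (- 1 / 4)) * chirp (- x) t l * chirp_data n F l))"
proof -
  have 1: "exp (\<i> * of_real (t * l\<^sup>2)) = cis (t * l\<^sup>2)" by (simp add: cis_conv_exp)
  have 2: "chirp x t l = cis (l * x) * cis (t * l\<^sup>2)" "chirp (- x) t l = cis (- (l * x)) * cis (t * l\<^sup>2)"
    by (simp_all add: chirp_def cis_mult mult.commute)
  have 3: "(l * x) powr (- m) * l ^ (n - 1) = x powr (- m) * (l powr (- 1 / 4) * l powr (m + 1 / 4))"
  proof -
    have "l ^ (n - 1) = l powr (2 * m)"
      using powr_realpow[OF \<open>l > 0\<close>, of "n - 1"] by (simp only: m_def) simp
    moreover have "l powr (- m) * l powr (2 * m) = l powr (- 1 / 4) * l powr (m + 1 / 4)"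
      by (simp add: powr_add[symmetric])
    ultimately show ?thesis using assms by (simp add: powr_mult mult_ac)
  qed
  have "of_real ((l * x) powr (- m) * (A * cos (l * x) + B * sin (l * x))) * exp (\<i> * of_real (t * l\<^sup>2)) * F l * of_real (l ^ (n - 1))
    = of_real ((l * x) powr (- m) * l ^ (n - 1)) * of_real (A * cos (l * x) + B * sin (l * x)) * cis (t * l\<^sup>2) * F l"
    unfolding 1 by (simp only: of_real_mult mult_ac)
  also have "\<dots> = of_real (x powr (- m)) * of_real (l powr (- 1 / 4)) * of_real (l powr (m + 1 / 4)) *
     (Complex (A / 2) (- B / 2) * cis (l * x) + Complex (A / 2) (B / 2) * cis (- (l * x))) * cis (t * l\<^sup>2) * F l"
    unfolding 3 cos_sin_cis by (simp only: of_real_mult mult_ac)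
  finally show ?thesis unfolding 2 chirp_data_def m_def[symmetric] by (simp only: distrib_left distrib_right mult_ac)
qed

text \<open>Everything except the main term on \<open>{1..R}\<close> is bounded pointwise in
  \<open>x\<close> and \<open>t\<close> by the Sobolev integral, so only the two chirp transforms
  remain for the maximal estimate.\<close>

lemma schroedinger_truncated:
  fixes n :: nat and x0 X :: real
  assumes n: "n \<ge> 2" and "x0 > 0"
  obtains K where "K \<ge> 0" "\<And>F R x t. F \<in> borel_measurable borel \<Longrightarrow> hdot_integral n F < \<infinity> \<Longrightarrow>
     set_integrable lborel {0..R} (schroedinger_integrand n F x t) \<Longrightarrow> R \<ge> 1 \<Longrightarrow> x0 \<le> x \<Longrightarrow> x \<le> X \<Longrightarrow>
     ennreal ((norm (LINT l:{0..R}|lborel. schroedinger_integrand n F x t l))\<^sup>2) \<le>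
     ennreal K * (hdot_integral n F + ennreal ((norm (chirp_transform R (chirp_data n F) x t))\<^sup>2)
       + ennreal ((norm (chirp_transform R (chirp_data n F) (- x) t))\<^sup>2))"
proof -
  define \<mu> where "\<mu> = (real n - 2) / 2"
  define m where "m = real (n - 1) / 2"
  have \<mu>: "\<mu> \<ge> 0" "\<mu> + 1/2 = m" using n by (auto simp: \<mu>_def m_def of_nat_diff field_simps)
  have m: "m \<ge> 1/2" using n by (simp add: m_def)
  obtain A B C where C: "C \<ge> 0"
    "\<And>x l. x0 \<le> x \<Longrightarrow> x \<le> X \<Longrightarrow> 1 \<le> l \<Longrightarrow>
      \<bar>bessel_norm \<mu> (l * x) - (l * x) powr (- m) * (A * cos (l * x) + B * sin (l * x))\<bar> \<le> C * l powr (- m - 1)"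
    "\<And>x l. x0 \<le> x \<Longrightarrow> x \<le> X \<Longrightarrow> 0 \<le> l \<Longrightarrow> l \<le> 1 \<Longrightarrow> \<bar>bessel_norm \<mu> (l * x)\<bar> \<le> C"
    using bessel_norm_main_term[OF \<mu>(1) \<open>x0 > 0\<close>, of X] unfolding \<mu>(2) by metis
  define w where "w = Complex (A / 2) (- B / 2)"
  define w' where "w' = Complex (A / 2) (B / 2)"
  have w': "norm w' = norm w" by (simp add: w_def w'_def cmod_def)
  define p where "p = x0 powr (- m) * norm w"
  have "p \<ge> 0" by (simp add: p_def)
  \<comment> \<open>The \<open>3\<close> comes from squaring a sum of three terms,
    \<open>2 * C\<^sup>2\<close> from the error with its weight integral \<open>2\<close>, and
    \<open>p\<^sup>2\<close> from the amplitude of either main term.\<close>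
  define K where "K = 3 * (2 * C\<^sup>2 + p\<^sup>2)"
  show thesis
  proof (rule that[of K])
    show "K \<ge> 0" by (simp add: K_def)
    fix F :: "real \<Rightarrow> complex" and R x t :: real
    assume F [measurable]: "F \<in> borel_measurable borel" and fin: "hdot_integral n F < \<infinity>"
      and H: "set_integrable lborel {0..R} (schroedinger_integrand n F x t)"
      and R: "R \<ge> 1" and x: "x0 \<le> x" "x \<le> X"
    define H where "H = schroedinger_integrand n F x t"
    define g where "g = chirp_data n F"
    have "x > 0" using x \<open>x0 > 0\<close> by simp
    have g [measurable]: "g \<in> borel_measurable borel" unfolding g_def chirp_data_def[abs_def] by measurable
    have gfin: "(\<integral>\<^sup>+l. ennreal ((norm (g l))\<^sup>2) * indicator {1..R} l \<partial>lborel) < \<infinity>"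
      unfolding g_def using chirp_data_integral_le[OF n, of F R] fin by (rule le_less_trans)
    define T1 where "T1 l = of_real (l powr (- 1 / 4)) * chirp x t l * g l" for l
    define T2 where "T2 l = of_real (l powr (- 1 / 4)) * chirp (- x) t l * g l" for l
    have T: "set_integrable lborel {1..R} T1" "set_integrable lborel {1..R} T2"
      unfolding T1_def[abs_def] T2_def[abs_def]
      by (intro chirp_transform_set_integrable g set_integrable_of_square gfin)+
    define c1 where "c1 = chirp_transform R g x t"
    define c2 where "c2 = chirp_transform R g (- x) t"
    have c: "c1 = (LINT l:{1..R}|lborel. T1 l)" "c2 = (LINT l:{1..R}|lborel. T2 l)"
      by (simp_all add: c1_def c2_def chirp_transform_def T1_def T2_def)
    define main where "main l = of_real (x powr (- m)) * (w * T1 l + w' * T2 l)" for l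
    have main: "set_integrable lborel {1..R} main"
      unfolding main_def[abs_def] using T by (intro set_integrable_mult_right set_integral_add) auto
    have main_int: "(LINT l:{1..R}|lborel. main l) = of_real (x powr (- m)) * (w * c1 + w' * c2)"
      unfolding main_def[abs_def] c using T by (simp add: set_integral_add)
    \<comment> \<open>The main term is subtracted on \<open>{1..R}\<close> only, so \<open>E\<close>
      contains the low frequencies untouched.\<close>
    define E where "E l = indicator {0..R} l *\<^sub>R H l - indicator {1..R} l *\<^sub>R main l" for l
    have eq: "(LINT l:{0..R}|lborel. H l) = (\<integral>l. E l \<partial>lborel) + of_real (x powr (- m)) * (w * c1 + w' * c2)"
      unfolding main_int[symmetric] E_def[abs_def] set_lebesgue_integral_def using H main
      by (subst Bochner_Integration.integral_diff) (auto simp: set_integrable_def H_def)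
    define k :: "real \<Rightarrow> real" where "k l = (if l \<ge> 1 then 1 / l else 1)" for l
    have ng: "norm (g l) = l powr (m + 1/4) * norm (F l)" if "l > 0" for l
      using that by (simp add: g_def chirp_data_def m_def norm_mult)
    have pw: "l ^ (n - 1) = l powr (2 * m)" if "l > 0" for l :: real
      using that by (simp add: m_def powr_realpow)
    have Ele: "norm (E l) \<le> C * (k l * norm (g l))" if "l \<ge> 0" for l
    proof -
      consider "l = 0" | "0 < l" "l < 1" | "1 \<le> l" "l \<le> R" | "R < l" using \<open>l \<ge> 0\<close> by linarith
      then show ?thesis
      proof cases
        case 1
        then have "E l = 0" using n by (simp add: E_def H_def schroedinger_integrand_def)
        then show ?thesis using C(1) 1 by (simp add: k_def)
      next
        case 2
        have "norm (E l) = \<bar>bessel_norm \<mu> (l * x)\<bar> * (norm (F l) * l powr (2 * m))"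
          using 2 R by (simp add: E_def H_def schroedinger_integrand_def norm_mult \<mu>_def pw[symmetric] norm_power)
        \<comment> \<open>For \<open>l < 1\<close> the larger exponent gives the smaller power, and
          \<open>2 m \<ge> m + 1/4\<close> since \<open>m \<ge> 1/2\<close>.\<close>
        also have "\<dots> \<le> C * (norm (F l) * l powr (m + 1/4))"
          using 2 C(3)[OF x, of l] C(1) m
          by (intro mult_mono powr_mono') auto
        finally show ?thesis using 2 by (simp add: k_def ng mult.commute)
      next
        case 3
        define \<delta> where "\<delta> = bessel_norm \<mu> (l * x) - (l * x) powr (- m) * (A * cos (l * x) + B * sin (l * x))"
        have "E l = of_real \<delta>
           * exp (\<i> * of_real (t * l\<^sup>2)) * F l * of_real (l ^ (n - 1))"
          using 3 schroedinger_main_term[of l x n A B t F] \<open>x > 0\<close> n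
          by (simp add: E_def H_def schroedinger_integrand_def main_def T1_def T2_def g_def w_def w'_def m_def \<mu>_def \<delta>_def algebra_simps)
        then have "norm (E l) = \<bar>\<delta>\<bar> * (norm (F l) * l powr (2 * m))"
          using 3 by (simp add: norm_mult norm_power pw[symmetric])
        also have "\<dots> \<le> (C * l powr (- m - 1)) * (norm (F l) * l powr (2 * m))"
          using C(2)[OF x 3(1)] by (intro mult_right_mono) (auto simp: \<delta>_def)
        also have "\<dots> = C * (norm (F l) * (l powr (m - 1)))"
        proof -
          have "l powr (- m - 1) * l powr (2 * m) = l powr (m - 1)" by (simp add: powr_add[symmetric])
          then show ?thesis by (simp add: mult_ac)
        qed
        \<comment> \<open>Giving away a factor \<open>l powr (1/4)\<close> brings the bound into the
          form weight times \<open>g\<close>.\<close>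
        also have "\<dots> \<le> C * (norm (F l) * (1 / l * l powr (m + 1/4)))"
        proof -
          have "l powr (m - 1) = 1 / l * l powr m" using 3 by (simp add: powr_diff)
          also have "\<dots> \<le> 1 / l * l powr (m + 1/4)"
            using 3 by (intro mult_left_mono powr_mono) auto
          finally show ?thesis using C(1) by (intro mult_left_mono) auto
        qed
        finally show ?thesis using 3 by (simp add: k_def ng mult_ac)
      next
        case 4
        then have "E l = 0" by (simp add: E_def)
        then show ?thesis using C(1) 4 R by (simp add: k_def)
      qed
    qed
    define Q where "Q = hdot_integral n F"
    have k [measurable]: "k \<in> borel_measurable borel" unfolding k_def[abs_def] by measurable
    have "ennreal (norm (\<integral>l. E l \<partial>lborel)) \<le> (\<integral>\<^sup>+l. ennreal (norm (E l)) \<partial>lborel)"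
      by (rule norm_integral_le_nn_integral)
    also have "\<dots> \<le> (\<integral>\<^sup>+l. ennreal C * ((ennreal (k l) * indicator {0..} l) * (ennreal (norm (g l)) * indicator {0..} l)) \<partial>lborel)"
    proof (intro nn_integral_mono)
      fix l :: real
      have "k l \<ge> 0" by (simp add: k_def)
      then show "ennreal (norm (E l)) \<le> ennreal C * ((ennreal (k l) * indicator {0..} l) * (ennreal (norm (g l)) * indicator {0..} l))"
        using Ele[of l] C(1) R by (cases "l \<ge> 0") (auto simp: E_def ennreal_mult[symmetric])
    qed
    also have "\<dots> = ennreal C * (\<integral>\<^sup>+l. (ennreal (k l) * indicator {0..} l) * (ennreal (norm (g l)) * indicator {0..} l) \<partial>lborel)"
      by (rule nn_integral_cmult) measurable
    finally have "(ennreal (norm (\<integral>l. E l \<partial>lborel)))\<^sup>2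
      \<le> (ennreal C * (\<integral>\<^sup>+l. (ennreal (k l) * indicator {0..} l) * (ennreal (norm (g l)) * indicator {0..} l) \<partial>lborel))\<^sup>2"
      by (rule power_mono_ennreal)
    also have "\<dots> = (ennreal C)\<^sup>2 * (\<integral>\<^sup>+l. (ennreal (k l) * indicator {0..} l) * (ennreal (norm (g l)) * indicator {0..} l) \<partial>lborel)\<^sup>2"
      by (rule power_mult_distrib)
    also have "\<dots> \<le> (ennreal C)\<^sup>2 * (2 * Q)"
    proof (rule mult_left_mono)
      have "(\<integral>\<^sup>+l. (ennreal (k l) * indicator {0..} l) * (ennreal (norm (g l)) * indicator {0..} l) \<partial>lborel)\<^sup>2
        \<le> (\<integral>\<^sup>+l. (ennreal (k l) * indicator {0..} l)\<^sup>2 \<partial>lborel) * (\<integral>\<^sup>+l. (ennreal (norm (g l)) * indicator {0..} l)\<^sup>2 \<partial>lborel)"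
        by (rule Cauchy_Schwarz_nn_integral) measurable
      also have "\<dots> \<le> 2 * Q"
      proof (rule mult_mono)
        show "(\<integral>\<^sup>+l. (ennreal (k l) * indicator {0..} l)\<^sup>2 \<partial>lborel) \<le> 2"
          by (rule order_trans[OF nn_integral_mono error_weight_integral]) (simp add: k_def split: split_indicator)
        show "(\<integral>\<^sup>+l. (ennreal (norm (g l)) * indicator {0..} l)\<^sup>2 \<partial>lborel) \<le> Q"
          unfolding Q_def hdot_integral_def using chirp_data_square[OF _ n, of _ F]
          by (intro nn_integral_mono) (auto simp: g_def ennreal_power split: split_indicator)
      qed auto
      finally show "(\<integral>\<^sup>+l. (ennreal (k l) * indicator {0..} l) * (ennreal (norm (g l)) * indicator {0..} l) \<partial>lborel)\<^sup>2 \<le> 2 * Q" .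
    qed simp
    finally have err: "ennreal ((norm (\<integral>l. E l \<partial>lborel))\<^sup>2) \<le> ennreal (2 * C\<^sup>2) * Q"
      using C(1) by (simp add: ennreal_power ennreal_mult mult_ac)
    have "norm (LINT l:{0..R}|lborel. H l) \<le> norm (\<integral>l. E l \<partial>lborel) + x powr (- m) * (norm w * norm c1 + norm w * norm c2)"
      unfolding eq using norm_triangle_ineq[of "w * c1" "w' * c2"]
      by (intro order_trans[OF norm_triangle_ineq] add_left_mono) (simp add: norm_mult w' mult_left_mono)
    also have "\<dots> \<le> norm (\<integral>l. E l \<partial>lborel) + x0 powr (- m) * (norm w * norm c1 + norm w * norm c2)"
      using x \<open>x0 > 0\<close> m by (intro add_left_mono mult_right_mono powr_mono2') auto
    finally have le: "norm (LINT l:{0..R}|lborel. H l) \<le> norm (\<integral>l. E l \<partial>lborel) + p * norm c1 + p * norm c2"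
      by (simp add: p_def algebra_simps)
    have sq3: "(a + b + c)\<^sup>2 \<le> 3 * (a\<^sup>2 + b\<^sup>2 + c\<^sup>2)" for a b c :: real
      using sum_squares_bound[of a b] sum_squares_bound[of a c] sum_squares_bound[of b c]
      by (simp add: power2_eq_square algebra_simps)
    have "(norm (LINT l:{0..R}|lborel. H l))\<^sup>2 \<le> (norm (\<integral>l. E l \<partial>lborel) + p * norm c1 + p * norm c2)\<^sup>2"
      by (rule power_mono[OF le]) simp
    also have "\<dots> \<le> 3 * ((norm (\<integral>l. E l \<partial>lborel))\<^sup>2 + (p * norm c1)\<^sup>2 + (p * norm c2)\<^sup>2)" by (rule sq3)
    finally have "ennreal ((norm (LINT l:{0..R}|lborel. H l))\<^sup>2) \<le> ennreal (3 * ((norm (\<integral>l. E l \<partial>lborel))\<^sup>2 + (p * norm c1)\<^sup>2 + (p * norm c2)\<^sup>2))"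
      by (rule ennreal_leI)
    also have "\<dots> = 3 * (ennreal ((norm (\<integral>l. E l \<partial>lborel))\<^sup>2) + ennreal (p\<^sup>2) * ennreal ((norm c1)\<^sup>2) + ennreal (p\<^sup>2) * ennreal ((norm c2)\<^sup>2))"
      by (simp add: ennreal_mult ennreal_plus power_mult_distrib)
    also have "\<dots> \<le> 3 * (ennreal (2 * C\<^sup>2 + p\<^sup>2) * Q + ennreal (2 * C\<^sup>2 + p\<^sup>2) * ennreal ((norm c1)\<^sup>2) + ennreal (2 * C\<^sup>2 + p\<^sup>2) * ennreal ((norm c2)\<^sup>2))"
      by (intro mult_left_mono add_mono order_trans[OF err] mult_right_mono ennreal_leI) auto
    also have "\<dots> = ennreal K * (Q + ennreal ((norm c1)\<^sup>2) + ennreal ((norm c2)\<^sup>2))"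
    proof -
      have "ennreal K = 3 * ennreal (2 * C\<^sup>2 + p\<^sup>2)"
        unfolding K_def by (subst ennreal_mult) auto
      then show ?thesis by (simp only: distrib_left mult.assoc)
    qed
    finally show "ennreal ((norm (LINT l:{0..R}|lborel. schroedinger_integrand n F x t l))\<^sup>2) \<le>
     ennreal K * (hdot_integral n F + ennreal ((norm (chirp_transform R (chirp_data n F) x t))\<^sup>2)
       + ennreal ((norm (chirp_transform R (chirp_data n F) (- x) t))\<^sup>2))"
      unfolding H_def Q_def c1_def c2_def g_def .
  qed
qed

section \<open>Passage to the full propagator\<close>

text \<open>For finite \<open>Z\<close> the bound is moved to \<open>f t\<close> by a real square
  root, passes through the supremum, and is squared again.\<close>

lemma SUP_power2_le:
  fixes f :: "'a \<Rightarrow> ennreal"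
  assumes "\<And>t. t \<in> I \<Longrightarrow> (f t)\<^sup>2 \<le> Z"
  shows "(SUP t\<in>I. f t)\<^sup>2 \<le> Z"
proof (cases Z)
  case (real z)
  have "f t \<le> ennreal (sqrt z)" if "t \<in> I" for t
  proof (cases "f t")
    case (real y)
    then have "ennreal (y\<^sup>2) \<le> ennreal z" using assms[OF that] \<open>Z = ennreal z\<close> by (simp add: ennreal_power)
    then have "y\<^sup>2 \<le> z" using \<open>0 \<le> z\<close> by (simp add: ennreal_le_iff)
    then have "y \<le> sqrt z" by (rule real_le_rsqrt)
    then show ?thesis using real by (simp add: ennreal_leI)
  next
    case top
    then show ?thesis using assms[OF that] \<open>Z = ennreal z\<close> by (simp add: power2_eq_square ennreal_top_mult top_unique)
  qed
  then have "(SUP t\<in>I. f t)\<^sup>2 \<le> (ennreal (sqrt z))\<^sup>2"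
    by (intro power_mono_ennreal SUP_least)
  then show ?thesis using real by (simp add: ennreal_power)
qed simp

lemma ennreal_sqrt_mono: "x \<le> y \<Longrightarrow> ennreal_sqrt x \<le> ennreal_sqrt y"
  by (auto simp: ennreal_sqrt_def top_unique less_top intro!: ennreal_leI enn2real_mono)

lemma ennreal_sqrt_cmult:
  assumes "k \<ge> 0" "x < \<infinity>"
  shows "ennreal_sqrt (ennreal k * x) = ennreal (sqrt k) * ennreal_sqrt x"
  using assms
  by (cases x) (auto simp: ennreal_sqrt_def real_sqrt_mult ennreal_mult[symmetric] enn2real_mult)

lemma hdot_quarter_norm_eq:
  "hdot_quarter_norm (f :: 'a::euclidean_space \<Rightarrow> complex) = ennreal_sqrt (hdot_integral DIM('a) (spherical_fourier f))"
  by (simp add: hdot_quarter_norm_def hdot_integral_def)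

lemma schroedinger_eq:
  "schroedinger t (f :: 'a::euclidean_space \<Rightarrow> complex) x =
    (LINT l:{0..}|lborel. schroedinger_integrand DIM('a) (spherical_fourier f) x t l)"
  by (simp add: schroedinger_def schroedinger_integrand_def)

text \<open>The measurable majorants depend on the cut-off, but their integrals do not grow with it.
  Their lower limit dominates the untruncated propagator at every time, and Fatou's lemma integrates
  it.\<close>

lemma schroedinger_maximal:
  fixes n :: nat and x0 X c u v :: real
  assumes n: "n \<ge> 2" and "x0 > 0" "c > 0" "u < v"
  obtains K where "K \<ge> 0"
    "\<And>F \<rho> T. F \<in> borel_measurable borel \<Longrightarrow> hdot_integral n F < \<infinity> \<Longrightarrow> T \<ge> 0 \<Longrightarrow>
      continuous_on ({u..<v} \<times> {- T..T}) (\<lambda>(s, t). \<rho> s t) \<Longrightarrow>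
      (\<And>s t. s \<in> {u..<v} \<Longrightarrow> t \<in> {- T..T} \<Longrightarrow> \<rho> s t \<in> {x0..X}) \<Longrightarrow>
      (\<And>s s' t t'. s \<in> {u..<v} \<Longrightarrow> s' \<in> {u..<v} \<Longrightarrow> t \<in> {- T..T} \<Longrightarrow> t' \<in> {- T..T} \<Longrightarrow>
        c * \<bar>s - s'\<bar> \<le> \<bar>\<rho> s t - \<rho> s' t'\<bar> \<or> c * \<bar>s - s'\<bar>\<^sup>2 \<le> \<bar>t - t'\<bar>) \<Longrightarrow>
      (\<integral>\<^sup>+s. (SUP t\<in>{- T..T}. ennreal (cmod (LINT l:{0..}|lborel. schroedinger_integrand n F (\<rho> s t) t l)))\<^sup>2 * indicator {u..<v} s \<partial>lborel)
        \<le> ennreal K * hdot_integral n F"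
proof -
  obtain K1 where K1: "K1 \<ge> 0" "\<And>F R x t. F \<in> borel_measurable borel \<Longrightarrow> hdot_integral n F < \<infinity> \<Longrightarrow>
     set_integrable lborel {0..R} (schroedinger_integrand n F x t) \<Longrightarrow> R \<ge> 1 \<Longrightarrow> x0 \<le> x \<Longrightarrow> x \<le> X \<Longrightarrow>
     ennreal ((norm (LINT l:{0..R}|lborel. schroedinger_integrand n F x t l))\<^sup>2) \<le>
     ennreal K1 * (hdot_integral n F + ennreal ((norm (chirp_transform R (chirp_data n F) x t))\<^sup>2)
       + ennreal ((norm (chirp_transform R (chirp_data n F) (- x) t))\<^sup>2))"
    using schroedinger_truncated[OF n \<open>x0 > 0\<close>, of X] by metis
  define A where "A = chirp_const c * (4 * sqrt (v - u))"
  have "A \<ge> 0" using assms by (simp add: A_def chirp_const_def)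
  \<comment> \<open>The length \<open>v - u\<close> stems from integrating the error bound, which is
    constant in \<open>s\<close>; \<open>A\<close> enters once for each sign of the radius.\<close>
  define K where "K = K1 * ((v - u) + 2 * A)"
  show thesis
  proof (rule that[of K])
    show "K \<ge> 0" using K1(1) \<open>A \<ge> 0\<close> \<open>u < v\<close> by (simp add: K_def)
    fix F :: "real \<Rightarrow> complex" and \<rho> :: "real \<Rightarrow> real \<Rightarrow> real" and T :: real
    assume F [measurable]: "F \<in> borel_measurable borel" and fin: "hdot_integral n F < \<infinity>" and "T \<ge> 0"
      and cont: "continuous_on ({u..<v} \<times> {- T..T}) (\<lambda>(s, t). \<rho> s t)"
      and \<rho>: "\<And>s t. s \<in> {u..<v} \<Longrightarrow> t \<in> {- T..T} \<Longrightarrow> \<rho> s t \<in> {x0..X}"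
      and sep: "\<And>s s' t t'. s \<in> {u..<v} \<Longrightarrow> s' \<in> {u..<v} \<Longrightarrow> t \<in> {- T..T} \<Longrightarrow> t' \<in> {- T..T} \<Longrightarrow>
        c * \<bar>s - s'\<bar> \<le> \<bar>\<rho> s t - \<rho> s' t'\<bar> \<or> c * \<bar>s - s'\<bar>\<^sup>2 \<le> \<bar>t - t'\<bar>"
    define g where "g = chirp_data n F"
    define Q where "Q = hdot_integral n F"
    have g [measurable]: "g \<in> borel_measurable borel" unfolding g_def chirp_data_def[abs_def] by measurable
    have gQ: "(\<integral>\<^sup>+l. ennreal ((norm (g l))\<^sup>2) * indicator {1..R} l \<partial>lborel) \<le> Q" for R
      unfolding g_def Q_def by (rule chirp_data_integral_le[OF n])
    have majorant: "\<exists>W. W \<in> borel_measurable borel \<and>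
      (\<forall>s\<in>{u..<v}. \<forall>t\<in>{- T..T}. ennreal ((norm (chirp_transform R g (r s t) t))\<^sup>2) \<le> W s) \<and>
      (\<integral>\<^sup>+s. W s * indicator {u..<v} s \<partial>lborel) \<le> ennreal A * Q"
      if "R \<ge> 1" and r: "r = \<rho> \<or> r = (\<lambda>s t. - \<rho> s t)" for R and r :: "real \<Rightarrow> real \<Rightarrow> real"
    proof -
      have 1: "continuous_on ({u..<v} \<times> {- T..T}) (\<lambda>(s, t). r s t)"
        using r cont continuous_on_minus[OF cont] by (auto simp: case_prod_unfold)
      have 2: "c * \<bar>s - s'\<bar> \<le> \<bar>r s t - r s' t'\<bar> \<or> c * \<bar>s - s'\<bar>\<^sup>2 \<le> \<bar>t - t'\<bar>"
        if "s \<in> {u..<v}" "s' \<in> {u..<v}" "t \<in> {- T..T}" "t' \<in> {- T..T}" for s s' t t'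
        using r sep[OF that] by (auto simp: abs_minus_commute)
      have 3: "(\<integral>\<^sup>+l. ennreal ((norm (g l))\<^sup>2) * indicator {1..R} l \<partial>lborel) < \<infinity>"
        using gQ fin unfolding Q_def by (rule le_less_trans)
      have 4: "ennreal A * (\<integral>\<^sup>+l. ennreal ((norm (g l))\<^sup>2) * indicator {1..R} l \<partial>lborel) \<le> ennreal A * Q"
        by (intro mult_left_mono gQ) simp
      show ?thesis
      proof (rule chirp_transform_maximal[OF 1 g \<open>c > 0\<close> \<open>R \<ge> 1\<close> \<open>T \<ge> 0\<close> 2 3, folded A_def])
        fix W :: "real \<Rightarrow> ennreal"
        assume W: "W \<in> borel_measurable borel"
          "\<And>s t. s \<in> {u..<v} \<Longrightarrow> t \<in> {- T..T} \<Longrightarrow> ennreal ((norm (chirp_transform R g (r s t) t))\<^sup>2) \<le> W s"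
          "(\<integral>\<^sup>+s. W s * indicator {u..<v} s \<partial>lborel) \<le> ennreal A * (\<integral>\<^sup>+l. ennreal ((norm (g l))\<^sup>2) * indicator {1..R} l \<partial>lborel)"
        show ?thesis using W(1,2) order_trans[OF W(3) 4] by blast
      qed
    qed
    \<comment> \<open>Cut-offs run through \<open>real (Suc N)\<close>, so that
      \<open>R \<ge> 1\<close> holds from the start; one majorant is chosen for each.\<close>
    define W1 where "W1 N = (SOME W. W \<in> borel_measurable borel \<and>
      (\<forall>s\<in>{u..<v}. \<forall>t\<in>{- T..T}. ennreal ((norm (chirp_transform (real (Suc N)) g (\<rho> s t) t))\<^sup>2) \<le> W s) \<and>
      (\<integral>\<^sup>+s. W s * indicator {u..<v} s \<partial>lborel) \<le> ennreal A * Q)" for N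
    have W1: "W1 N \<in> borel_measurable borel"
      "\<And>s t. s\<in>{u..<v} \<Longrightarrow> t\<in>{- T..T} \<Longrightarrow> ennreal ((norm (chirp_transform (real (Suc N)) g (\<rho> s t) t))\<^sup>2) \<le> W1 N s"
      "(\<integral>\<^sup>+s. W1 N s * indicator {u..<v} s \<partial>lborel) \<le> ennreal A * Q" for N
      using someI_ex[OF majorant[of "real (Suc N)" "\<rho>"], folded W1_def] by auto
    define W2 where "W2 N = (SOME W. W \<in> borel_measurable borel \<and>
      (\<forall>s\<in>{u..<v}. \<forall>t\<in>{- T..T}. ennreal ((norm (chirp_transform (real (Suc N)) g (- \<rho> s t) t))\<^sup>2) \<le> W s) \<and>
      (\<integral>\<^sup>+s. W s * indicator {u..<v} s \<partial>lborel) \<le> ennreal A * Q)" for N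
    have W2: "W2 N \<in> borel_measurable borel"
      "\<And>s t. s\<in>{u..<v} \<Longrightarrow> t\<in>{- T..T} \<Longrightarrow> ennreal ((norm (chirp_transform (real (Suc N)) g (- \<rho> s t) t))\<^sup>2) \<le> W2 N s"
      "(\<integral>\<^sup>+s. W2 N s * indicator {u..<v} s \<partial>lborel) \<le> ennreal A * Q" for N
      using someI_ex[OF majorant[of "real (Suc N)" "\<lambda>s t. - \<rho> s t"], folded W2_def] by auto
    note W1(1) [measurable] W2(1) [measurable]
    define Z where "Z N s = ennreal K1 * (Q + W1 N s + W2 N s)" for N s
    have Z [measurable]: "Z N \<in> borel_measurable borel" for N unfolding Z_def[abs_def] by measurable
    have pointwise: "(ennreal (cmod (LINT l:{0..}|lborel. schroedinger_integrand n F (\<rho> s t) t l)))\<^sup>2 \<le> liminf (\<lambda>N. Z N s)"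
      if s: "s \<in> {u..<v}" and t: "t \<in> {- T..T}" for s t
    proof (cases "set_integrable lborel {0..} (schroedinger_integrand n F (\<rho> s t) t)")
      case False
      \<comment> \<open>A divergent propagator integral has the default value \<open>0\<close>, for
        which the bound is trivial.\<close>
      then have "(LINT l:{0..}|lborel. schroedinger_integrand n F (\<rho> s t) t l) = 0"
        unfolding set_integrable_def set_lebesgue_integral_def by (rule not_integrable_integral_eq)
      then show ?thesis by simp
    next
      case True
      define J where "J R = (LINT l:{0..R}|lborel. schroedinger_integrand n F (\<rho> s t) t l)" for R
      have "(J \<longlongrightarrow> (LINT l:{0..}|lborel. schroedinger_integrand n F (\<rho> s t) t l)) at_top"
        unfolding J_def[abs_def] by (rule tendsto_set_lebesgue_integral_at_top[OF _ True]) simp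
      moreover have "filterlim (\<lambda>N. real (Suc N)) at_top sequentially"
        by (rule filterlim_compose[OF filterlim_real_sequentially filterlim_Suc])
      ultimately have "(\<lambda>N. J (real (Suc N))) \<longlonglongrightarrow> (LINT l:{0..}|lborel. schroedinger_integrand n F (\<rho> s t) t l)"
        by (rule filterlim_compose)
      then have lim: "(\<lambda>N. ennreal ((cmod (J (real (Suc N))))\<^sup>2)) \<longlonglongrightarrow> ennreal ((cmod (LINT l:{0..}|lborel. schroedinger_integrand n F (\<rho> s t) t l))\<^sup>2)"
        by (intro tendsto_intros)
      have "ennreal ((cmod (J (real (Suc N))))\<^sup>2) \<le> Z N s" for N
      proof -
        have "set_integrable lborel {0..real (Suc N)} (schroedinger_integrand n F (\<rho> s t) t)"
          by (rule set_integrable_subset[OF True]) auto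
        then have "ennreal ((cmod (J (real (Suc N))))\<^sup>2) \<le> ennreal K1 * (hdot_integral n F
            + ennreal ((norm (chirp_transform (real (Suc N)) (chirp_data n F) (\<rho> s t) t))\<^sup>2)
            + ennreal ((norm (chirp_transform (real (Suc N)) (chirp_data n F) (- \<rho> s t) t))\<^sup>2))"
          unfolding J_def using \<rho>[OF s t] by (intro K1(2) F fin) auto
        also have "\<dots> \<le> Z N s"
          unfolding Z_def Q_def g_def[symmetric]
          by (intro mult_left_mono add_mono order_refl W1(2)[OF s t] W2(2)[OF s t]) simp
        finally show ?thesis .
      qed
      then have "liminf (\<lambda>N. ennreal ((cmod (J (real (Suc N))))\<^sup>2)) \<le> liminf (\<lambda>N. Z N s)"
        by (intro Liminf_mono always_eventually allI)
      then show ?thesis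
        using lim_imp_Liminf[OF _ lim] by (simp add: ennreal_power)
    qed
    have "(\<integral>\<^sup>+s. (SUP t\<in>{- T..T}. ennreal (cmod (LINT l:{0..}|lborel. schroedinger_integrand n F (\<rho> s t) t l)))\<^sup>2 * indicator {u..<v} s \<partial>lborel)
      \<le> (\<integral>\<^sup>+s. liminf (\<lambda>N. Z N s * indicator {u..<v} s) \<partial>lborel)"
    \<comment> \<open>Monotonicity of the nonnegative integral does not ask for measurability, so
      the supremum over times may be bounded directly.\<close>
    proof (rule nn_integral_mono)
      fix s :: real
      show "(SUP t\<in>{- T..T}. ennreal (cmod (LINT l:{0..}|lborel. schroedinger_integrand n F (\<rho> s t) t l)))\<^sup>2 * indicator {u..<v} s
        \<le> liminf (\<lambda>N. Z N s * indicator {u..<v} s)"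
      proof (cases "s \<in> {u..<v}")
        case True
        then have "(SUP t\<in>{- T..T}. ennreal (cmod (LINT l:{0..}|lborel. schroedinger_integrand n F (\<rho> s t) t l)))\<^sup>2
            \<le> liminf (\<lambda>N. Z N s)"
          by (intro SUP_power2_le pointwise)
        then show ?thesis using True by simp
      qed (simp add: Liminf_const)
    qed
    also have "\<dots> \<le> liminf (\<lambda>N. \<integral>\<^sup>+s. Z N s * indicator {u..<v} s \<partial>lborel)"
      by (rule nn_integral_liminf) measurable
    also have "\<dots> \<le> liminf (\<lambda>N::nat. ennreal K * Q)"
    proof (intro Liminf_mono always_eventually allI)
      fix N
      have "(\<integral>\<^sup>+s. Z N s * indicator {u..<v} s \<partial>lborel)
        = (\<integral>\<^sup>+s. ennreal K1 * ((Q * indicator {u..<v} s + W1 N s * indicator {u..<v} s) + W2 N s * indicator {u..<v} s) \<partial>lborel)"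
        unfolding Z_def by (intro nn_integral_cong) (simp add: distrib_right mult.assoc)
      also have "\<dots> = ennreal K1 * (\<integral>\<^sup>+s. (Q * indicator {u..<v} s + W1 N s * indicator {u..<v} s) + W2 N s * indicator {u..<v} s \<partial>lborel)"
        by (rule nn_integral_cmult) measurable
      also have "\<dots> = ennreal K1 * ((\<integral>\<^sup>+s. Q * indicator {u..<v} s \<partial>lborel) + (\<integral>\<^sup>+s. W1 N s * indicator {u..<v} s \<partial>lborel)
          + (\<integral>\<^sup>+s. W2 N s * indicator {u..<v} s \<partial>lborel))"
        by (simp add: nn_integral_add)
      also have "\<dots> \<le> ennreal K1 * (Q * ennreal (v - u) + ennreal A * Q + ennreal A * Q)"
        using \<open>u < v\<close> by (intro mult_left_mono add_mono W1(3) W2(3)) (auto simp: nn_integral_cmult_indicator)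
      also have "\<dots> = ennreal K * Q"
      proof -
        have "ennreal K = ennreal K1 * (ennreal (v - u) + ennreal A + ennreal A)"
          unfolding K_def using \<open>A \<ge> 0\<close> \<open>u < v\<close> K1(1)
          by (simp add: ennreal_mult[symmetric] ennreal_plus[symmetric] del: ennreal_plus)
        then show ?thesis by (simp only: distrib_left distrib_right mult_ac)
      qed
      finally show "(\<integral>\<^sup>+s. Z N s * indicator {u..<v} s \<partial>lborel) \<le> ennreal K * Q" .
    qed
    also have "\<dots> = ennreal K * Q" by (simp add: Liminf_const)
    finally show "(\<integral>\<^sup>+s. (SUP t\<in>{- T..T}. ennreal (cmod (LINT l:{0..}|lborel. schroedinger_integrand n F (\<rho> s t) t l)))\<^sup>2 * indicator {u..<v} s \<partial>lborel)
        \<le> ennreal K * hdot_integral n F" unfolding Q_def .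
  qed
qed

section \<open>Curves\<close>

text \<open>If two times are too close to separate the curves by the Hoelder bound, they are at
  least quadratically apart in \<open>\<bar>s - s'\<bar>\<close>; this is where \<open>\<alpha> \<ge> 1/2\<close> enters.\<close>

lemma curve_separation:
  fixes \<rho> :: "real \<Rightarrow> real \<Rightarrow> real"
  assumes "C4 > 0" "C5 > 0" "\<alpha> \<in> {1/2..1}" "\<bar>s - s'\<bar> \<le> 1"
    and hoelder: "\<bar>\<rho> s' t - \<rho> s' t'\<bar> \<le> C4 * \<bar>t - t'\<bar> powr \<alpha>"
    and lower: "C5 * \<bar>s - s'\<bar> \<le> \<bar>\<rho> s t - \<rho> s' t\<bar>"
    and c: "c \<le> C5 / 2" "c \<le> (min 1 (C5 / (2 * C4)))\<^sup>2"
  shows "c * \<bar>s - s'\<bar> \<le> \<bar>\<rho> s t - \<rho> s' t'\<bar> \<or> c * \<bar>s - s'\<bar>\<^sup>2 \<le> \<bar>t - t'\<bar>"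
proof (cases "C4 * \<bar>t - t'\<bar> powr \<alpha> \<le> C5 / 2 * \<bar>s - s'\<bar>")
  case True
  \<comment> \<open>The motion in time uses up at most half of the lower bound for the distance of
    radii at equal times.\<close>
  have "c * \<bar>s - s'\<bar> \<le> C5 / 2 * \<bar>s - s'\<bar>" using c(1) by (rule mult_right_mono) simp
  also have "\<dots> \<le> \<bar>\<rho> s t - \<rho> s' t'\<bar>" using True hoelder lower by (simp add: abs_if split: if_splits)
  finally show ?thesis ..
next
  case False
  \<comment> \<open>The cap at \<open>1\<close> keeps \<open>k * d\<close> at most \<open>1\<close>,
    so that raising the exponent from \<open>1 / \<alpha>\<close> to \<open>2\<close> decreases the
    power.\<close>
  define k where "k = min 1 (C5 / (2 * C4))"
  define d where "d = \<bar>s - s'\<bar>"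
  have k: "0 < k" "k \<le> 1" "k \<le> C5 / (2 * C4)" using assms by (auto simp: k_def)
  have d: "0 \<le> d" "d \<le> 1" using assms by (auto simp: d_def)
  have "(k * d)\<^sup>2 \<le> \<bar>t - t'\<bar>"
  proof (cases "d = 0")
    case False
    then have kd: "0 < k * d" "k * d \<le> 1" using k d by (auto intro: mult_le_one)
    have "k * d \<le> C5 / (2 * C4) * d" using k d by (intro mult_right_mono) auto
    also have "\<dots> \<le> \<bar>t - t'\<bar> powr \<alpha>" using \<open>\<not> C4 * _ \<le> _\<close> \<open>C4 > 0\<close> by (simp add: d_def field_simps)
    finally have "(k * d) powr (1 / \<alpha>) \<le> (\<bar>t - t'\<bar> powr \<alpha>) powr (1 / \<alpha>)"
      using kd assms by (intro powr_mono2) auto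
    also have "\<dots> = \<bar>t - t'\<bar>" using assms by (simp add: powr_powr)
    finally have "(k * d) powr (1 / \<alpha>) \<le> \<bar>t - t'\<bar>" .
    moreover have "(k * d) powr 2 \<le> (k * d) powr (1 / \<alpha>)"
      using kd assms by (intro powr_mono') (auto simp: field_simps)
    ultimately show ?thesis using kd by simp
  qed simp
  moreover have "c * d\<^sup>2 \<le> k\<^sup>2 * d\<^sup>2" using c(2) by (intro mult_right_mono) (auto simp: k_def)
  ultimately show ?thesis by (simp add: d_def power_mult_distrib)
qed

text \<open>The increment is split into a Lipschitz step in \<open>s\<close> at the varying time and
  a Hoelder step in time at the fixed \<open>s\<close>. Joint continuity supplies measurability and
  the reduction to countably many times.\<close>

lemma hoelder_lipschitz_continuous:
  fixes \<rho> :: "real \<Rightarrow> real \<Rightarrow> real"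
  assumes "\<alpha> > 0"
    and hoelder: "\<And>s t t'. s \<in> I \<Longrightarrow> t \<in> J \<Longrightarrow> t' \<in> J \<Longrightarrow> \<bar>\<rho> s t - \<rho> s t'\<bar> \<le> C4 * \<bar>t - t'\<bar> powr \<alpha>"
    and lipschitz: "\<And>s s' t. s \<in> I \<Longrightarrow> s' \<in> I \<Longrightarrow> t \<in> J \<Longrightarrow> \<bar>\<rho> s t - \<rho> s' t\<bar> \<le> C6 * \<bar>s - s'\<bar>"
  shows "continuous_on (I \<times> J) (\<lambda>(s, t). \<rho> s t)"
  unfolding continuous_on_def
proof
  fix p0 assume p0: "p0 \<in> I \<times> J"
  define B where "B p = C6 * \<bar>fst p - fst p0\<bar> + C4 * \<bar>snd p - snd p0\<bar> powr \<alpha>" for p :: "real \<times> real"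
  have "continuous_on (I \<times> J) B"
    unfolding B_def[abs_def] using \<open>\<alpha> > 0\<close> by (intro continuous_intros continuous_on_powr') auto
  then have "(B \<longlongrightarrow> B p0) (at p0 within I \<times> J)" using p0 unfolding continuous_on_def by blast
  then have B: "(B \<longlongrightarrow> 0) (at p0 within I \<times> J)" by (simp add: B_def)
  have "((\<lambda>p. (case p of (s, t) \<Rightarrow> \<rho> s t) - (case p0 of (s, t) \<Rightarrow> \<rho> s t)) \<longlongrightarrow> 0) (at p0 within I \<times> J)"
  proof (rule Lim_null_comparison[OF _ B])
    show "\<forall>\<^sub>F p in at p0 within I \<times> J. norm ((case p of (s, t) \<Rightarrow> \<rho> s t) - (case p0 of (s, t) \<Rightarrow> \<rho> s t)) \<le> B p"
      unfolding eventually_at_topological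
    proof (intro exI[of _ UNIV] conjI ballI impI)
      fix p assume "p \<in> I \<times> J"
      then show "norm ((case p of (s, t) \<Rightarrow> \<rho> s t) - (case p0 of (s, t) \<Rightarrow> \<rho> s t)) \<le> B p"
        using p0 lipschitz[of "fst p" "fst p0" "snd p"] hoelder[of "fst p0" "snd p" "snd p0"]
        by (cases p; cases p0) (simp add: B_def)
    qed auto
  qed
  then show "((\<lambda>(s, t). \<rho> s t) \<longlongrightarrow> (case p0 of (s, t) \<Rightarrow> \<rho> s t)) (at p0 within I \<times> J)"
    by (rule LIM_zero_cancel)
qed

theorem theorem1p5:
  fixes C4 C5 C6 :: real
  assumes "CARD('n::finite) \<ge> 2" and "C4 > 0" and "C5 > 0" and "C6 > 0"
  shows "\<exists>\<delta>0>0. \<forall>\<delta>1 \<delta>2. 0 < \<delta>1 \<longrightarrow> \<delta>1 < \<delta>2 \<longrightarrow> \<delta>2 \<le> \<delta>0 \<longrightarrow>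
    (\<exists>C>0. \<forall>\<alpha>\<in>{1/2..1}. \<forall>T. 0 < T \<longrightarrow> T < (C5 * \<delta>1 / (2 * C4)) powr (1 / \<alpha>) \<longrightarrow>
      (\<forall>\<gamma> :: real \<Rightarrow> real \<Rightarrow> real ^ 'n.
        (\<forall>s\<ge>0. norm (\<gamma> s 0) = s) \<longrightarrow>
        (\<forall>s\<in>{0..<\<delta>2}. \<forall>t\<in>{-T..T}. \<forall>t'\<in>{-T..T}.
           \<bar>norm (\<gamma> s t) - norm (\<gamma> s t')\<bar> \<le> C4 * \<bar>t - t'\<bar> powr \<alpha>) \<longrightarrow>
        (\<forall>s\<in>{0..<\<delta>2}. \<forall>s'\<in>{0..<\<delta>2}. \<forall>t\<in>{-T..T}.
           C5 * \<bar>s - s'\<bar> \<le> \<bar>norm (\<gamma> s t) - norm (\<gamma> s' t)\<bar> \<and>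
           \<bar>norm (\<gamma> s t) - norm (\<gamma> s' t)\<bar> \<le> C6 * \<bar>s - s'\<bar>) \<longrightarrow>
        (\<forall>f :: real ^ 'n \<Rightarrow> complex. schwartz f \<longrightarrow> radial f \<longrightarrow>
           ennreal_sqrt (\<integral>\<^sup>+ s \<in> {\<delta>1..\<delta>2}.
             (SUP t\<in>{-T..T}. ennreal (cmod (schroedinger t f (norm (\<gamma> s t)))))\<^sup>2
               * ennreal (s ^ (CARD('n) - 1)) \<partial>lborel)
           \<le> ennreal C * hdot_quarter_norm f)))"
proof (rule exI[of _ "1::real"], intro conjI allI impI)
  fix \<delta>1 \<delta>2 :: real
  \<comment> \<open>With \<open>\<delta>0 = 1\<close>, distances \<open>\<bar>s - s'\<bar>\<close>
    are at most \<open>1\<close>, as the separation of curves requires, and the weight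
    \<open>s ^ (CARD('n) - 1)\<close> is at most \<open>1\<close>.\<close>
  assume \<delta>: "0 < \<delta>1" "\<delta>1 < \<delta>2" "\<delta>2 \<le> 1"
  define n where "n = CARD('n)"
  have n: "n \<ge> 2" using assms(1) by (simp add: n_def)
  define k where "k = min 1 (C5 / (2 * C4))"
  have "k > 0" using assms by (simp add: k_def)
  define c where "c = min (C5 / 2) (k\<^sup>2)"
  have c: "c > 0" "c \<le> C5 / 2" "c \<le> k\<^sup>2" using assms \<open>k > 0\<close> by (auto simp: c_def)
  \<comment> \<open>All radii will lie in \<open>{\<delta>1 / 2..2}\<close>. Fixing \<open>K\<close>
    here, before \<open>\<alpha>\<close>, \<open>T\<close>, the curves and \<open>f\<close>, makes
    the final constant independent of them.\<close>
  obtain K where K: "K \<ge> 0"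
    "\<And>F \<rho> T. F \<in> borel_measurable borel \<Longrightarrow> hdot_integral n F < \<infinity> \<Longrightarrow> T \<ge> 0 \<Longrightarrow>
      continuous_on ({\<delta>1..<\<delta>2} \<times> {- T..T}) (\<lambda>(s, t). \<rho> s t) \<Longrightarrow>
      (\<And>s t. s \<in> {\<delta>1..<\<delta>2} \<Longrightarrow> t \<in> {- T..T} \<Longrightarrow> \<rho> s t \<in> {\<delta>1 / 2..2}) \<Longrightarrow>
      (\<And>s s' t t'. s \<in> {\<delta>1..<\<delta>2} \<Longrightarrow> s' \<in> {\<delta>1..<\<delta>2} \<Longrightarrow> t \<in> {- T..T} \<Longrightarrow> t' \<in> {- T..T} \<Longrightarrow>
        c * \<bar>s - s'\<bar> \<le> \<bar>\<rho> s t - \<rho> s' t'\<bar> \<or> c * \<bar>s - s'\<bar>\<^sup>2 \<le> \<bar>t - t'\<bar>) \<Longrightarrow>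
      (\<integral>\<^sup>+s. (SUP t\<in>{- T..T}. ennreal (cmod (LINT l:{0..}|lborel. schroedinger_integrand n F (\<rho> s t) t l)))\<^sup>2 * indicator {\<delta>1..<\<delta>2} s \<partial>lborel)
        \<le> ennreal K * hdot_integral n F"
    by (rule schroedinger_maximal[OF n _ c(1) \<delta>(2), of "\<delta>1 / 2" 2]) (use \<delta> in auto)
  show "\<exists>C>0. \<forall>\<alpha>\<in>{1/2..1}. \<forall>T. 0 < T \<longrightarrow> T < (C5 * \<delta>1 / (2 * C4)) powr (1 / \<alpha>) \<longrightarrow>
      (\<forall>\<gamma> :: real \<Rightarrow> real \<Rightarrow> real ^ 'n.
        (\<forall>s\<ge>0. norm (\<gamma> s 0) = s) \<longrightarrow>
        (\<forall>s\<in>{0..<\<delta>2}. \<forall>t\<in>{-T..T}. \<forall>t'\<in>{-T..T}.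
           \<bar>norm (\<gamma> s t) - norm (\<gamma> s t')\<bar> \<le> C4 * \<bar>t - t'\<bar> powr \<alpha>) \<longrightarrow>
        (\<forall>s\<in>{0..<\<delta>2}. \<forall>s'\<in>{0..<\<delta>2}. \<forall>t\<in>{-T..T}.
           C5 * \<bar>s - s'\<bar> \<le> \<bar>norm (\<gamma> s t) - norm (\<gamma> s' t)\<bar> \<and>
           \<bar>norm (\<gamma> s t) - norm (\<gamma> s' t)\<bar> \<le> C6 * \<bar>s - s'\<bar>) \<longrightarrow>
        (\<forall>f :: real ^ 'n \<Rightarrow> complex. schwartz f \<longrightarrow> radial f \<longrightarrow>
           ennreal_sqrt (\<integral>\<^sup>+ s \<in> {\<delta>1..\<delta>2}.
             (SUP t\<in>{-T..T}. ennreal (cmod (schroedinger t f (norm (\<gamma> s t)))))\<^sup>2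
               * ennreal (s ^ (CARD('n) - 1)) \<partial>lborel)
           \<le> ennreal C * hdot_quarter_norm f))"
  \<comment> \<open>\<open>K\<close> bounds squares, hence the root; the added \<open>1\<close>
    makes the constant positive.\<close>
  proof (rule exI[of _ "sqrt (K + 1)"], intro conjI ballI allI impI)
    show "0 < sqrt (K + 1)" using K(1) by simp
    fix \<alpha> T :: real and \<gamma> :: "real \<Rightarrow> real \<Rightarrow> real ^ 'n" and f :: "real ^ 'n \<Rightarrow> complex"
    assume \<alpha>: "\<alpha> \<in> {1/2..1}" and T: "0 < T" "T < (C5 * \<delta>1 / (2 * C4)) powr (1 / \<alpha>)"
      and \<gamma>0: "\<forall>s\<ge>0. norm (\<gamma> s 0) = s"
      and hoelder: "\<forall>s\<in>{0..<\<delta>2}. \<forall>t\<in>{-T..T}. \<forall>t'\<in>{-T..T}.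
           \<bar>norm (\<gamma> s t) - norm (\<gamma> s t')\<bar> \<le> C4 * \<bar>t - t'\<bar> powr \<alpha>"
      and bilip: "\<forall>s\<in>{0..<\<delta>2}. \<forall>s'\<in>{0..<\<delta>2}. \<forall>t\<in>{-T..T}.
           C5 * \<bar>s - s'\<bar> \<le> \<bar>norm (\<gamma> s t) - norm (\<gamma> s' t)\<bar> \<and>
           \<bar>norm (\<gamma> s t) - norm (\<gamma> s' t)\<bar> \<le> C6 * \<bar>s - s'\<bar>"
      and f: "schwartz f" "radial f"
    define F where "F = spherical_fourier f"
    define \<rho> where "\<rho> s t = norm (\<gamma> s t)" for s t
    define L where "L = (\<integral>\<^sup>+ s \<in> {\<delta>1..\<delta>2}. (SUP t\<in>{-T..T}. ennreal (cmod (schroedinger t f (norm (\<gamma> s t)))))\<^sup>2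
               * ennreal (s ^ (CARD('n) - 1)) \<partial>lborel)"
    have hol: "\<bar>\<rho> s t - \<rho> s t'\<bar> \<le> C4 * \<bar>t - t'\<bar> powr \<alpha>"
      if "s \<in> {0..<\<delta>2}" "t \<in> {-T..T}" "t' \<in> {-T..T}" for s t t'
      using hoelder that unfolding \<rho>_def by blast
    have low: "C5 * \<bar>s - s'\<bar> \<le> \<bar>\<rho> s t - \<rho> s' t\<bar>" and lip: "\<bar>\<rho> s t - \<rho> s' t\<bar> \<le> C6 * \<bar>s - s'\<bar>"
      if "s \<in> {0..<\<delta>2}" "s' \<in> {0..<\<delta>2}" "t \<in> {-T..T}" for s s' t
      using bilip that unfolding \<rho>_def by blast+
    \<comment> \<open>At time \<open>0\<close> the radii are \<open>0\<close> and
      \<open>\<delta>1\<close> themselves, which forces \<open>C5 \<le> 1\<close>.\<close>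
    have "C5 * \<bar>0 - \<delta>1\<bar> \<le> \<bar>\<rho> 0 0 - \<rho> \<delta>1 0\<bar>" using \<delta> T by (intro low) auto
    then have "C5 * \<delta>1 \<le> 1 * \<delta>1" using \<gamma>0 \<delta> by (simp add: \<rho>_def)
    then have "C5 \<le> 1" using \<delta>(1) by (simp only: mult_le_cancel_right_pos)
    \<comment> \<open>The bound on \<open>T\<close> says that a radius drifts by at most
      \<open>C5 * \<delta>1 / 2\<close>, hence by at most \<open>\<delta>1 / 2\<close>, from its
      initial value \<open>s \<ge> \<delta>1\<close>.\<close>
    have "T powr \<alpha> < ((C5 * \<delta>1 / (2 * C4)) powr (1 / \<alpha>)) powr \<alpha>"
      using T \<alpha> by (intro powr_less_mono2) auto
    also have "\<dots> = C5 * \<delta>1 / (2 * C4)" using \<alpha> assms \<delta> by (simp add: powr_powr)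
    finally have "C4 * T powr \<alpha> \<le> C5 * \<delta>1 / 2" using assms by (simp add: field_simps)
    also have "\<dots> \<le> \<delta>1 / 2" using \<open>C5 \<le> 1\<close> \<delta> by (simp add: mult_le_cancel_right1)
    finally have small: "C4 * T powr \<alpha> \<le> \<delta>1 / 2" .
    have range: "\<rho> s t \<in> {\<delta>1 / 2..2}" if s: "s \<in> {\<delta>1..<\<delta>2}" and t: "t \<in> {- T..T}" for s t
    proof -
      have "\<bar>\<rho> s t - \<rho> s 0\<bar> \<le> C4 * \<bar>t - 0\<bar> powr \<alpha>" using s t \<delta> T by (intro hol) auto
      also have "\<dots> \<le> C4 * T powr \<alpha>" using t \<alpha> assms by (intro mult_left_mono powr_mono2) auto
      finally have "\<bar>\<rho> s t - s\<bar> \<le> \<delta>1 / 2" using small \<gamma>0 s \<delta> by (simp add: \<rho>_def)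
      then show ?thesis using s \<delta> unfolding atLeastAtMost_iff atLeastLessThan_iff by linarith
    qed
    have bound: "L \<le> ennreal K * hdot_integral n F" if "hdot_integral n F < \<infinity>"
    proof -
      have "L \<le> (\<integral>\<^sup>+s. (SUP t\<in>{- T..T}. ennreal (cmod (LINT l:{0..}|lborel. schroedinger_integrand n F (\<rho> s t) t l)))\<^sup>2 * indicator {\<delta>1..<\<delta>2} s \<partial>lborel)"
        unfolding L_def
      proof (rule nn_integral_mono_AE)
        show "AE s in lborel. (SUP t\<in>{-T..T}. ennreal (cmod (schroedinger t f (norm (\<gamma> s t)))))\<^sup>2
               * ennreal (s ^ (CARD('n) - 1)) * indicator {\<delta>1..\<delta>2} s
          \<le> (SUP t\<in>{- T..T}. ennreal (cmod (LINT l:{0..}|lborel. schroedinger_integrand n F (\<rho> s t) t l)))\<^sup>2 * indicator {\<delta>1..<\<delta>2} s"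
          \<comment> \<open>The curves are controlled only for \<open>s < \<delta>2\<close>; the
            endpoint of the integral is a null set.\<close>
          using AE_lborel_singleton[of \<delta>2]
        proof eventually_elim
          fix s assume "s \<noteq> \<delta>2"
          have "X * ennreal (s ^ (CARD('n) - 1)) \<le> X * 1" if "s \<in> {\<delta>1..\<delta>2}" for X
            using that \<delta> by (intro mult_left_mono) (auto intro!: power_le_one simp: ennreal_le_1)
          then show "(SUP t\<in>{-T..T}. ennreal (cmod (schroedinger t f (norm (\<gamma> s t)))))\<^sup>2
               * ennreal (s ^ (CARD('n) - 1)) * indicator {\<delta>1..\<delta>2} s
          \<le> (SUP t\<in>{- T..T}. ennreal (cmod (LINT l:{0..}|lborel. schroedinger_integrand n F (\<rho> s t) t l)))\<^sup>2 * indicator {\<delta>1..<\<delta>2} s"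
            using \<open>s \<noteq> \<delta>2\<close> by (auto simp: schroedinger_eq n_def F_def \<rho>_def split: split_indicator)
        qed
      qed
      also have "\<dots> \<le> ennreal K * hdot_integral n F"
      proof (rule K(2))
        show "F \<in> borel_measurable borel" unfolding F_def by (rule measurable_spherical_fourier[OF f(1)])
        show "continuous_on ({\<delta>1..<\<delta>2} \<times> {- T..T}) (\<lambda>(s, t). \<rho> s t)"
          by (rule hoelder_lipschitz_continuous[of \<alpha> _ _ _ C4 C6]) (use \<alpha> \<delta> in \<open>auto intro!: hol lip\<close>)
        fix s s' t t' assume *: "s \<in> {\<delta>1..<\<delta>2}" "s' \<in> {\<delta>1..<\<delta>2}" "t \<in> {- T..T}" "t' \<in> {- T..T}"
        show "c * \<bar>s - s'\<bar> \<le> \<bar>\<rho> s t - \<rho> s' t'\<bar> \<or> c * \<bar>s - s'\<bar>\<^sup>2 \<le> \<bar>t - t'\<bar>"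
        proof (rule curve_separation[OF \<open>C4 > 0\<close> \<open>C5 > 0\<close> \<alpha> _ _ _ c(2) c(3)[unfolded k_def]])
          show "\<bar>s - s'\<bar> \<le> 1" using * \<delta> by auto
        qed (use * \<delta> in \<open>auto intro!: hol low\<close>)
      qed (use that T range in auto)
      finally show ?thesis .
    qed
    show "ennreal_sqrt (\<integral>\<^sup>+ s \<in> {\<delta>1..\<delta>2}. (SUP t\<in>{-T..T}. ennreal (cmod (schroedinger t f (norm (\<gamma> s t)))))\<^sup>2
               * ennreal (s ^ (CARD('n) - 1)) \<partial>lborel)
           \<le> ennreal (sqrt (K + 1)) * hdot_quarter_norm f"
    proof (cases "hdot_integral n F < \<infinity>")
      case True
      have "L \<le> ennreal (K + 1) * hdot_integral n F"
        using bound[OF True] by (rule order_trans) (intro mult_right_mono ennreal_leI; simp)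
      then have "ennreal_sqrt L \<le> ennreal_sqrt (ennreal (K + 1) * hdot_integral n F)" by (rule ennreal_sqrt_mono)
      also have "\<dots> = ennreal (sqrt (K + 1)) * ennreal_sqrt (hdot_integral n F)"
        using K(1) True by (intro ennreal_sqrt_cmult) auto
      finally show ?thesis by (simp add: L_def hdot_quarter_norm_eq F_def n_def)
    next
      case False
      \<comment> \<open>With an infinite norm, the positive constant makes the right-hand side
        \<open>top\<close>.\<close>
      then have "hdot_quarter_norm f = top"
        by (simp add: hdot_quarter_norm_eq F_def n_def ennreal_sqrt_def less_top)
      then show ?thesis using K(1) by (simp add: ennreal_mult_top)
    qed
  qed
qed simp

end
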